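(* Among the sixteen lattices $U+A_2$, $U(2)+A_2$, $U+A_2+D_4$, $U(2)+A_2+D_4$, $U+E_6(2)$, $U(2)+E_6(2)$, $U+A_2+E_8$, $U(2)+A_2+E_8$, $U+A_2+2D_4$, $U(2)+A_2+2D_4$, $U+A_2+E_8(2)$, $U(2)+A_2+E_8(2)$, $U+A_2+D_4+E_8$, $U(2)+A_2+D_4+E_8$, $U+A_2+2E_8$, $U(2)+A_2+2E_8$ there are exactly 4 chiral lattices: ${U+A_2}$, ${U(2)+A_2}$, ${U+A_2+D_4}$, and ${U+A_2+E_8}$. All the others are achiral.
   Context: These sixteen lattices are exactly the lattices $\mathbb M_+^0(X)$ (invariant part of $H^4$ of a real non-singular cubic fourfold $X$, orthogonal to the polarization) for the coarse deformation classes with even 2-primary discriminant form. $U$ is the hyperbolic plane, $A_n,D_n,E_n$ the positive definite root lattices, $\mathbb L(2)$ the lattice with form multiplied by 2, $+$ orthogonal sum. For such a lattice $\mathbb L$ (even, signature $(n,1)$, $\operatorname{discr}_3\mathbb L=\mathbb Z/3$, $\operatorname{discr}_2$ of period 2), let $W$ be the group generated by reflections in 2-roots ($v^2=2$) and 6-roots ($v^2=6$, $v\cdot\mathbb L\subset3\mathbb Z$); cells $P$ are its fundamental chambers in the hyperbolic space, each lifting to $\pm P^\#$ in the double cover. An automorphism is $P$-direct if it preserves $P^\#$, $\mathbb Z/3$-reversing if it acts as $-\operatorname{id}$ on $\operatorname{discr}_3\mathbb L$. $\mathbb L$ is achiral if it has an automorphism $\mathbb Z/3$-reversing and $P$-direct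 for some cell $P$, chiral otherwise. *)

theory Defs
  imports "HOL-Analysis.Analysis"
begin

text \<open>A lattice is represented by its Gram matrix G (an n x n integer matrix, as a
list of rows) with respect to a basis; the lattice is Z^n with form x^T G y.
Vectors are functions nat => real supported on {0..<n}; the ambient real space
carries the (product = Euclidean) topology.\<close>

type_synonym gram = "int list list"

definition gdim :: "gram \<Rightarrow> nat" where
  "gdim G = length G"

definition gent :: "gram \<Rightarrow> nat \<Rightarrow> nat \<Rightarrow> int" where
  "gent G i j = G ! i ! j"

definition bform :: "gram \<Rightarrow> (nat \<Rightarrow> real) \<Rightarrow> (nat \<Rightarrow> real) \<Rightarrow> real" where
  "bform G x y = (\<Sum>i<gdim G. \<Sum>j<gdim G. x i * of_int (gent G i j) * y j)"

definition ambient :: "gram \<Rightarrow> (nat \<Rightarrow> real) set" where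
  "ambient G = {x. \<forall>i\<ge>gdim G. x i = 0}"

definition latt :: "gram \<Rightarrow> (nat \<Rightarrow> real) set" where
  "latt G = {x \<in> ambient G. \<forall>i<gdim G. x i \<in> \<int>}"

definition dual_latt :: "gram \<Rightarrow> (nat \<Rightarrow> real) set" where
  "dual_latt G = {x \<in> ambient G. \<forall>v\<in>latt G. bform G x v \<in> \<int>}"

text \<open>Representatives in L^* of the 3-primary part discr_3 L of L^*/L.\<close>
definition discr3_reps :: "gram \<Rightarrow> (nat \<Rightarrow> real) set" where
  "discr3_reps G = {x \<in> dual_latt G. \<exists>k::nat. (\<lambda>i. 3 ^ k * x i) \<in> latt G}"

definition mact :: "gram \<Rightarrow> (nat \<Rightarrow> nat \<Rightarrow> int) \<Rightarrow> (nat \<Rightarrow> real) \<Rightarrow> (nat \<Rightarrow> real)" where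
  "mact G M x = (\<lambda>i. if i < gdim G then (\<Sum>j<gdim G. of_int (M i j) * x j) else 0)"

definition is_aut :: "gram \<Rightarrow> (nat \<Rightarrow> nat \<Rightarrow> int) \<Rightarrow> bool" where
  "is_aut G M \<longleftrightarrow> bij_betw (mact G M) (latt G) (latt G) \<and>
     (\<forall>x\<in>latt G. \<forall>y\<in>latt G. bform G (mact G M x) (mact G M y) = bform G x y)"

text \<open>Z/3-reversing: acts as -id on discr_3 L.\<close>
definition z3_reversing :: "gram \<Rightarrow> (nat \<Rightarrow> nat \<Rightarrow> int) \<Rightarrow> bool" where
  "z3_reversing G M \<longleftrightarrow>
     (\<forall>x\<in>discr3_reps G. (\<lambda>i. mact G M x i + x i) \<in> latt G)"

definition root2 :: "gram \<Rightarrow> (nat \<Rightarrow> real) \<Rightarrow> bool" where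
  "root2 G v \<longleftrightarrow> v \<in> latt G \<and> bform G v v = 2"

definition root6 :: "gram \<Rightarrow> (nat \<Rightarrow> real) \<Rightarrow> bool" where
  "root6 G v \<longleftrightarrow> v \<in> latt G \<and> bform G v v = 6 \<and>
     (\<forall>w\<in>latt G. bform G v w / 3 \<in> \<int>)"

text \<open>Mirrors of W: hyperplanes orthogonal to 2-roots and 6-roots.\<close>
definition wroot :: "gram \<Rightarrow> (nat \<Rightarrow> real) \<Rightarrow> bool" where
  "wroot G v \<longleftrightarrow> root2 G v \<or> root6 G v"

text \<open>The negative cone (double cover of the hyperbolic space), minus all mirrors.\<close>
definition open_cone_part :: "gram \<Rightarrow> (nat \<Rightarrow> real) set" where
  "open_cone_part G = {x \<in> ambient G. bform G x x < 0 \<and> (\<forall>v. wroot G v \<longrightarrow> bform G v x \<noteq> 0)}"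

text \<open>Lifts P^# of cells P to the double cover: (the interiors of) the connected
components of the negative cone minus the mirrors of W.\<close>
definition cell_lift :: "gram \<Rightarrow> (nat \<Rightarrow> real) set \<Rightarrow> bool" where
  "cell_lift G Q \<longleftrightarrow> (\<exists>x\<in>open_cone_part G. Q = connected_component_set (open_cone_part G) x)"

definition direct :: "gram \<Rightarrow> (nat \<Rightarrow> nat \<Rightarrow> int) \<Rightarrow> (nat \<Rightarrow> real) set \<Rightarrow> bool" where
  "direct G M Q \<longleftrightarrow> mact G M ` Q = Q"

definition achiral :: "gram \<Rightarrow> bool" where
  "achiral G \<longleftrightarrow> (\<exists>M Q. is_aut G M \<and> z3_reversing G M \<and> cell_lift G Q \<and> direct G M Q)"

definition chiral :: "gram \<Rightarrow> bool" where
  "chiral G \<longleftrightarrow> \<not> achiral G"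

definition osum :: "gram \<Rightarrow> gram \<Rightarrow> gram" (infixl "\<oplus>\<^sub>L" 65) where
  "osum G H = map (\<lambda>r. r @ replicate (length H) 0) G @ map (\<lambda>r. replicate (length G) 0 @ r) H"

definition gscale :: "int \<Rightarrow> gram \<Rightarrow> gram" where
  "gscale k G = map (map (\<lambda>a. k * a)) G"

definition U_lat :: gram where "U_lat = [[0,1],[1,0]]"
definition A2_lat :: gram where "A2_lat = [[2,-1],[-1,2]]"
definition D4_lat :: gram where
  "D4_lat = [[2,-1,0,0],[-1,2,-1,-1],[0,-1,2,0],[0,-1,0,2]]"
definition E6_lat :: gram where
  "E6_lat = [[2,0,-1,0,0,0],
             [0,2,0,-1,0,0],
             [-1,0,2,-1,0,0],
             [0,-1,-1,2,-1,0],
             [0,0,0,-1,2,-1],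
             [0,0,0,0,-1,2]]"
definition E8_lat :: gram where
  "E8_lat = [[2,0,-1,0,0,0,0,0],
             [0,2,0,-1,0,0,0,0],
             [-1,0,2,-1,0,0,0,0],
             [0,-1,-1,2,-1,0,0,0],
             [0,0,0,-1,2,-1,0,0],
             [0,0,0,0,-1,2,-1,0],
             [0,0,0,0,0,-1,2,-1],
             [0,0,0,0,0,0,-1,2]]"

definition sixteen_lattices :: "gram list" where
  "sixteen_lattices =
    [U_lat \<oplus>\<^sub>L A2_lat,
     gscale 2 U_lat \<oplus>\<^sub>L A2_lat,
     U_lat \<oplus>\<^sub>L A2_lat \<oplus>\<^sub>L D4_lat,
     gscale 2 U_lat \<oplus>\<^sub>L A2_lat \<oplus>\<^sub>L D4_lat,
     U_lat \<oplus>\<^sub>L gscale 2 E6_lat,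
     gscale 2 U_lat \<oplus>\<^sub>L gscale 2 E6_lat,
     U_lat \<oplus>\<^sub>L A2_lat \<oplus>\<^sub>L E8_lat,
     gscale 2 U_lat \<oplus>\<^sub>L A2_lat \<oplus>\<^sub>L E8_lat,
     U_lat \<oplus>\<^sub>L A2_lat \<oplus>\<^sub>L D4_lat \<oplus>\<^sub>L D4_lat,
     gscale 2 U_lat \<oplus>\<^sub>L A2_lat \<oplus>\<^sub>L D4_lat \<oplus>\<^sub>L D4_lat,
     U_lat \<oplus>\<^sub>L A2_lat \<oplus>\<^sub>L gscale 2 E8_lat,
     gscale 2 U_lat \<oplus>\<^sub>L A2_lat \<oplus>\<^sub>L gscale 2 E8_lat,
     U_lat \<oplus>\<^sub>L A2_lat \<oplus>\<^sub>L D4_lat \<oplus>\<^sub>L E8_lat,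
     gscale 2 U_lat \<oplus>\<^sub>L A2_lat \<oplus>\<^sub>L D4_lat \<oplus>\<^sub>L E8_lat,
     U_lat \<oplus>\<^sub>L A2_lat \<oplus>\<^sub>L E8_lat \<oplus>\<^sub>L E8_lat,
     gscale 2 U_lat \<oplus>\<^sub>L A2_lat \<oplus>\<^sub>L E8_lat \<oplus>\<^sub>L E8_lat]"

end

theory Submission
  imports Defs
begin

text \<open>
  Achirality. Let \<open>S\<close> be a primitive sublattice isometric to \<open>E\<^sub>6(2)\<close> such that the isometry \<open>M\<close> equal
  to \<open>-1\<close> on \<open>S\<close> and to \<open>1\<close> on its orthogonal complement preserves the lattice. Then \<open>S\<close> carries the
  3-part of the discriminant, so \<open>M\<close> is \<open>\<int>/3\<close>-reversing. All norms in \<open>S\<close> are divisible by 4, so \<open>S\<close>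
  contains no 2-root and no 6-root, and a generic vector of the negative cone fixed by \<open>M\<close> lies on no
  mirror; its cell is preserved. Twelve of the lattices contain such an \<open>S\<close>.

  Chirality. For \<open>U + A\<^sub>2 + K\<close> with \<open>K\<close> zero, \<open>D\<^sub>4\<close> or \<open>E\<^sub>8\<close>, and for \<open>U(2) + A\<^sub>2\<close>, there are finitely many
  simple roots, exactly one of which, \<open>c\<close>, is a 6-root, and every root is up to sign a nonnegative
  combination of them: the coefficients of a root are estimated through the covering radii of \<open>A\<^sub>2\<close> and
  \<open>K\<close>. Every cell lies in a translate of the simple chamber, and an isometry preserving the cell
  permutes the positive roots. It therefore fixes \<open>c\<close>, the only extremal 6-root, and with it the class of
  \<open>c/3\<close>, which generates the 3-part of the discriminant.
\<close>

section \<open>The bilinear form of a Gram matrix\<close>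

text \<open>The decisive numbers are squared covering radii: 2/3 for \<open>A2\<close>, 1 for
  \<open>D4\<close> and \<open>E8\<close>. For a root of norm \<open>N\<close> in
  \<open>U + A2 + K\<close> with hyperbolic coordinates \<open>a\<close>, \<open>b\<close> and
  \<open>b > 0\<close>, the inequality needed for nonnegative coefficients, multiplied by
  \<open>2 b\<close>, is a sum of squares plus \<open>(2 - 1 - 2/3) b^2 - N\<close>. The surplus 1/3
  settles all but the smallest values of \<open>b\<close>; there integrality has to help. When
  \<open>K\<close> is nonzero, the simple roots are linearly dependent: the roots over
  \<open>A2\<close> and those over \<open>K\<close> each form an affine diagram, and both null
  vectors equal \<open>-u\<close>. The coefficients of a root are therefore not unique, and
  simplicity cannot be read off from them. Extremality is tested by a linear functional instead, one
  that vanishes on \<open>c\<close> and is positive on the other simple roots. Cells are compared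
  with the simple chamber through arbitrary isometries of the lattice; they preserve the set of
  roots, which is all that the comparison of positive roots uses.\<close>

definition uvec :: "nat \<Rightarrow> nat \<Rightarrow> real" where
  "uvec j = (\<lambda>i. if i = j then 1 else 0)"

lemma bform_add_left: "bform G (\<lambda>i. x i + y i) z = bform G x z + bform G y z"
  by (simp add: bform_def sum.distrib distrib_right)

lemma bform_add_right: "bform G z (\<lambda>i. x i + y i) = bform G z x + bform G z y"
  by (simp add: bform_def sum.distrib distrib_left)

lemma bform_scale_left: "bform G (\<lambda>i. a * x i) y = a * bform G x y"
  by (simp add: bform_def sum_distrib_left mult.assoc)

lemma bform_scale_right: "bform G x (\<lambda>i. a * y i) = a * bform G x y"
  by (simp add: bform_def sum_distrib_left algebra_simps)

lemma bform_diff_left: "bform G (\<lambda>i. x i - y i) z = bform G x z - bform G y z"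
  by (simp add: bform_def sum_subtractf left_diff_distrib)

lemma bform_diff_right: "bform G z (\<lambda>i. x i - y i) = bform G z x - bform G z y"
  by (simp add: bform_def sum_subtractf right_diff_distrib)

lemma bform_sum_left: "bform G (\<lambda>i. \<Sum>k\<in>A. f k i) y = (\<Sum>k\<in>A. bform G (f k) y)"
  by (induction A rule: infinite_finite_induct) (simp_all add: bform_add_left, simp_all add: bform_def)

lemma bform_sum_right: "bform G y (\<lambda>i. \<Sum>k\<in>A. f k i) = (\<Sum>k\<in>A. bform G y (f k))"
  by (induction A rule: infinite_finite_induct) (simp_all add: bform_add_right, simp_all add: bform_def)

lemmas bform_linear = bform_add_left bform_add_right bform_scale_left bform_scale_right
  bform_diff_left bform_diff_right

lemma bform_uvec_right:
  assumes "j < gdim G"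
  shows "bform G x (uvec j) = (\<Sum>i<gdim G. x i * of_int (gent G i j))"
  unfolding bform_def uvec_def by (rule sum.cong) (use assms in \<open>simp_all add: if_distrib sum.delta cong: if_cong\<close>)

lemma bform_uvec_left:
  assumes "i < gdim G"
  shows "bform G (uvec i) y = (\<Sum>j<gdim G. of_int (gent G i j) * y j)"
proof -
  have "bform G (uvec i) y = (\<Sum>k<gdim G. if k = i then (\<Sum>j<gdim G. of_int (gent G i j) * y j) else 0)"
    unfolding bform_def uvec_def by (rule sum.cong) auto
  then show ?thesis using assms by simp
qed

lemma bform_expand_right: "bform G x y = (\<Sum>j<gdim G. y j * bform G x (uvec j))"
proof -
  have "bform G x y = (\<Sum>j<gdim G. \<Sum>i<gdim G. x i * of_int (gent G i j) * y j)"
    unfolding bform_def by (rule sum.swap)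
  also have "\<dots> = (\<Sum>j<gdim G. y j * bform G x (uvec j))"
    by (rule sum.cong) (simp_all add: bform_uvec_right sum_distrib_left mult_ac)
  finally show ?thesis .
qed

lemma latt_closed:
  assumes "x \<in> latt G" "y \<in> latt G"
  shows "(\<lambda>i. x i + y i) \<in> latt G" "(\<lambda>i. x i - y i) \<in> latt G" "a \<in> \<int> \<Longrightarrow> (\<lambda>i. a * x i) \<in> latt G"
  using assms by (auto simp: latt_def ambient_def)

lemma latt_ambient: "x \<in> latt G \<Longrightarrow> x \<in> ambient G"
  by (simp add: latt_def)

lemma uvec_latt: "j < gdim G \<Longrightarrow> uvec j \<in> latt G"
  by (auto simp: latt_def ambient_def uvec_def)

lemma bform_latt_Ints: "x \<in> latt G \<Longrightarrow> y \<in> latt G \<Longrightarrow> bform G x y \<in> \<int>"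
  by (auto simp: latt_def bform_def intro!: Ints_sum Ints_mult)

lemma mact_ambient: "mact G M x \<in> ambient G"
  by (simp add: mact_def ambient_def)

lemma mact_linear: "mact G M (\<lambda>i. a * x i + b * y i) = (\<lambda>i. a * mact G M x i + b * mact G M y i)"
  by (auto simp: mact_def fun_eq_iff sum.distrib sum_distrib_left algebra_simps)

lemma mact_latt: "x \<in> latt G \<Longrightarrow> mact G M x \<in> latt G"
  by (auto simp: latt_def mact_ambient) (auto simp: mact_def intro!: Ints_sum Ints_mult)

lemma countable_latt: "countable (latt G)"
proof -
  have "latt G \<subseteq> (\<lambda>l i. if i < gdim G then of_int (l ! i) else 0) ` (UNIV :: int list set)"
  proof
    fix x assume x: "x \<in> latt G"
    let ?l = "map (\<lambda>i. \<lfloor>x i\<rfloor>) [0..<gdim G]"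
    have "x = (\<lambda>i. if i < gdim G then of_int (?l ! i) else 0)"
      using x by (auto simp: latt_def ambient_def fun_eq_iff elim!: Ints_cases)
    then show "x \<in> (\<lambda>l i. if i < gdim G then of_int (l ! i) else 0) ` (UNIV :: int list set)"
      by blast
  qed
  then show ?thesis by (rule countable_subset) simp
qed

lemma continuous_on_coord: "continuous_on S (\<lambda>x :: nat \<Rightarrow> real. x i)"
  by (rule continuous_on_product_coordinates[THEN continuous_on_subset]) simp

lemma continuous_on_bform: "continuous_on S (bform G r)"
  unfolding bform_def by (intro continuous_intros continuous_on_coord)

lemma continuous_on_mact: "continuous_on S (mact G M)"
proof (rule continuous_on_coordinatewise_then_product)
  fix i show "continuous_on S (\<lambda>x. mact G M x i)"
    unfolding mact_def by (cases "i < gdim G") (auto intro!: continuous_intros continuous_on_coord)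
qed

locale sym_gram =
  fixes G :: gram
  assumes sym: "i < gdim G \<Longrightarrow> j < gdim G \<Longrightarrow> gent G i j = gent G j i"
begin

lemma bform_sym: "bform G x y = bform G y x"
proof -
  have "bform G x y = (\<Sum>j<gdim G. \<Sum>i<gdim G. x i * of_int (gent G i j) * y j)"
    unfolding bform_def by (rule sum.swap)
  also have "\<dots> = bform G y x"
    unfolding bform_def by (intro sum.cong refl) (simp add: sym)
  finally show ?thesis .
qed

end

section \<open>Achirality from an embedded E6(2)\<close>

text \<open>The form of \<open>E6\<close> itself, not of \<open>E6(2)\<close>: \<open>cv\<close>
  returns twice the coordinates of a projection, and this doubling absorbs the scale in
  \<open>bform_sv\<close>.\<close>

definition e6form :: "(nat \<Rightarrow> real) \<Rightarrow> (nat \<Rightarrow> real) \<Rightarrow> real" where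
  "e6form x y = (\<Sum>k<6. \<Sum>l<6. x k * of_int (E6_lat ! k ! l) * y l)"

lemma E6_lat_sym: "k < 6 \<Longrightarrow> l < 6 \<Longrightarrow> E6_lat ! k ! l = E6_lat ! l ! k"
proof -
  have "\<forall>k\<in>set [0..<6]. \<forall>l\<in>set [0..<6]. E6_lat ! k ! l = E6_lat ! l ! k"
    unfolding E6_lat_def by code_simp
  then show "k < 6 \<Longrightarrow> l < 6 \<Longrightarrow> E6_lat ! k ! l = E6_lat ! l ! k" by simp
qed

lemma e6form_sym: "e6form x y = e6form y x"
proof -
  have "e6form x y = (\<Sum>l<6. \<Sum>k<6. x k * of_int (E6_lat ! k ! l) * y l)"
    unfolding e6form_def by (rule sum.swap)
  also have "\<dots> = e6form y x"
    unfolding e6form_def by (intro sum.cong refl) (simp add: E6_lat_sym[of _ _])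
  finally show ?thesis .
qed

lemma e6form_scale: "e6form (\<lambda>k. a * x k) (\<lambda>k. a * y k) = a\<^sup>2 * e6form x y"
  by (simp add: e6form_def sum_distrib_left algebra_simps power2_eq_square)

lemma e6form_even:
  assumes "\<And>k. k < 6 \<Longrightarrow> x k \<in> \<int>"
  shows "\<exists>m::int. e6form x x = 2 * of_int m"
proof -
  have "\<forall>k. \<exists>m::int. k < 6 \<longrightarrow> x k = of_int m" using assms by (metis Ints_cases)
  then obtain m :: "nat \<Rightarrow> int" where m: "\<And>k. k < 6 \<Longrightarrow> x k = of_int (m k)" by metis
  have "e6form x x = 2 * (x 0 * x 0 + x 1 * x 1 + x 2 * x 2 + x 3 * x 3 + x 4 * x 4 + x 5 * x 5
      - x 0 * x 2 - x 1 * x 3 - x 2 * x 3 - x 3 * x 4 - x 4 * x 5)"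
    by (simp add: e6form_def E6_lat_def eval_nat_numeral algebra_simps)
  also have "\<dots> = 2 * of_int (m 0 * m 0 + m 1 * m 1 + m 2 * m 2 + m 3 * m 3 + m 4 * m 4 + m 5 * m 5
      - m 0 * m 2 - m 1 * m 3 - m 2 * m 3 - m 3 * m 4 - m 4 * m 5)"
    by (simp add: m)
  finally show ?thesis by blast
qed

text \<open>The rows of \<open>B\<close> span a copy of \<open>E\<^sub>6(2)\<close>, the rows of \<open>C\<close> are twice the coordinate functionals of
  the orthogonal projection onto it, \<open>F\<close> witnesses primitivity, and \<open>H\<close> factors \<open>1 + M\<close> through the Gram
  matrix, so that \<open>1 + M\<close> maps the dual lattice into the lattice.\<close>

locale E6_2_embedding = sym_gram +
  fixes B C F H :: "nat \<Rightarrow> nat \<Rightarrow> int" and x0 :: "nat \<Rightarrow> int"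
  assumes E6_C: "k < 6 \<Longrightarrow> j < gdim G \<Longrightarrow>
      (\<Sum>l<6. E6_lat ! k ! l * C l j) = (\<Sum>i<gdim G. B k i * gent G i j)"
    and C_B: "k < 6 \<Longrightarrow> l < 6 \<Longrightarrow> (\<Sum>j<gdim G. C k j * B l j) = (if k = l then 2 else 0)"
    and F_B: "k < 6 \<Longrightarrow> l < 6 \<Longrightarrow> (\<Sum>j<gdim G. F k j * B l j) = (if k = l then 1 else 0)"
    and H_G: "i < gdim G \<Longrightarrow> j < gdim G \<Longrightarrow>
      (\<Sum>l<gdim G. H i l * gent G l j) = (if i = j then 2 else 0) - (\<Sum>k<6. B k i * C k j)"
    and C_x0: "k < 6 \<Longrightarrow> (\<Sum>j<gdim G. C k j * x0 j) = 0"
    and x0_neg: "(\<Sum>i<gdim G. \<Sum>j<gdim G. x0 i * gent G i j * x0 j) < 0"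
begin

definition cv :: "(nat \<Rightarrow> real) \<Rightarrow> nat \<Rightarrow> real" where
  "cv x k = (\<Sum>j<gdim G. of_int (C k j) * x j)"

definition fv :: "(nat \<Rightarrow> real) \<Rightarrow> nat \<Rightarrow> real" where
  "fv x k = (\<Sum>j<gdim G. of_int (F k j) * x j)"

definition bv :: "nat \<Rightarrow> nat \<Rightarrow> real" where
  "bv k i = (if i < gdim G then of_int (B k i) else 0)"

text \<open>Twice the orthogonal projection onto the span of the rows of \<open>B\<close>;
  subtracting it from the identity gives the isometry \<open>M\<close>.\<close>

definition sv :: "(nat \<Rightarrow> real) \<Rightarrow> nat \<Rightarrow> real" where
  "sv x i = (\<Sum>k<6. cv x k * bv k i)"

definition M :: "nat \<Rightarrow> nat \<Rightarrow> int" where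
  "M i j = (if i = j then 1 else 0) - (\<Sum>k<6. B k i * C k j)"

lemma cv_linear: "cv (\<lambda>i. a * x i + b * y i) = (\<lambda>k. a * cv x k + b * cv y k)"
  by (simp add: cv_def sum.distrib sum_distrib_left algebra_simps fun_eq_iff)

lemma sv_linear: "sv (\<lambda>i. a * x i + b * y i) = (\<lambda>i. a * sv x i + b * sv y i)"
  by (simp add: sv_def cv_linear sum.distrib sum_distrib_left algebra_simps fun_eq_iff)

lemma sv_ambient: "sv x \<in> ambient G"
  by (simp add: sv_def ambient_def bv_def)

lemma bform_bv: "k < 6 \<Longrightarrow> bform G (bv k) x = (\<Sum>l<6. of_int (E6_lat ! k ! l) * cv x l)"
proof -
  assume k: "k < 6"
  have "bform G (bv k) x = (\<Sum>j<gdim G. x j * of_int (\<Sum>i<gdim G. B k i * gent G i j))"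
    by (subst bform_expand_right, rule sum.cong) (simp_all add: bform_uvec_right bv_def)
  also have "\<dots> = (\<Sum>j<gdim G. x j * of_int (\<Sum>l<6. E6_lat ! k ! l * C l j))"
    by (rule sum.cong) (simp_all add: E6_C[OF k])
  also have "\<dots> = (\<Sum>j<gdim G. \<Sum>l<6. of_int (E6_lat ! k ! l) * (of_int (C l j) * x j))"
    by (simp add: sum_distrib_left mult_ac)
  also have "\<dots> = (\<Sum>l<6. of_int (E6_lat ! k ! l) * cv x l)"
    by (subst sum.swap) (simp add: cv_def sum_distrib_left)
  finally show ?thesis .
qed

lemma bform_sv: "bform G (sv x) y = e6form (cv x) (cv y)"
proof -
  have "bform G (sv x) y = (\<Sum>k<6. cv x k * bform G (bv k) y)"
    unfolding sv_def by (simp add: bform_sum_left bform_scale_left)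
  also have "\<dots> = e6form (cv x) (cv y)"
    unfolding e6form_def by (rule sum.cong) (simp_all add: bform_bv sum_distrib_left mult.assoc)
  finally show ?thesis .
qed

lemma bform_sv_swap: "bform G x (sv y) = bform G (sv x) y"
  by (metis bform_sym bform_sv e6form_sym)

lemma cv_bv: "k < 6 \<Longrightarrow> l < 6 \<Longrightarrow> cv (bv l) k = (if k = l then 2 else 0)"
proof -
  assume "k < 6" "l < 6"
  have "cv (bv l) k = of_int (\<Sum>j<gdim G. C k j * B l j)"
    by (simp add: cv_def bv_def)
  then show ?thesis using C_B[OF \<open>k < 6\<close> \<open>l < 6\<close>] by simp
qed

lemma fv_bv: "k < 6 \<Longrightarrow> l < 6 \<Longrightarrow> fv (bv l) k = (if k = l then 1 else 0)"
proof -
  assume "k < 6" "l < 6"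
  have "fv (bv l) k = of_int (\<Sum>j<gdim G. F k j * B l j)"
    by (simp add: fv_def bv_def)
  then show ?thesis using F_B[OF \<open>k < 6\<close> \<open>l < 6\<close>] by simp
qed

lemma cv_sv: "k < 6 \<Longrightarrow> cv (sv x) k = 2 * cv x k"
proof -
  assume k: "k < 6"
  have "cv (sv x) k = (\<Sum>j<gdim G. \<Sum>l<6. cv x l * (of_int (C k j) * bv l j))"
    unfolding cv_def[of "sv x"] sv_def by (simp add: sum_distrib_left mult_ac)
  also have "\<dots> = (\<Sum>l<6. cv x l * cv (bv l) k)"
    by (subst sum.swap) (simp add: cv_def[of "bv _"] sum_distrib_left)
  also have "\<dots> = (\<Sum>l<6. if l = k then 2 * cv x k else 0)"
    by (rule sum.cong) (use k in \<open>auto simp: cv_bv\<close>)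
  finally show ?thesis using k by simp
qed

lemma fv_sv: "k < 6 \<Longrightarrow> fv (sv x) k = cv x k"
proof -
  assume k: "k < 6"
  have "fv (sv x) k = (\<Sum>j<gdim G. \<Sum>l<6. cv x l * (of_int (F k j) * bv l j))"
    unfolding fv_def sv_def by (simp add: sum_distrib_left mult_ac)
  also have "\<dots> = (\<Sum>l<6. cv x l * fv (bv l) k)"
    by (subst sum.swap) (simp add: fv_def sum_distrib_left)
  also have "\<dots> = (\<Sum>l<6. if l = k then cv x k else 0)"
    by (rule sum.cong) (use k in \<open>auto simp: fv_bv\<close>)
  finally show ?thesis using k by simp
qed

lemma sv_sv: "sv (sv x) = (\<lambda>i. 2 * sv x i)"
  unfolding sv_def[of "sv x"] by (simp add: cv_sv sv_def[of x] fun_eq_iff sum_distrib_left mult.assoc)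

lemma mact_M: "x \<in> ambient G \<Longrightarrow> mact G M x = (\<lambda>i. x i - sv x i)"
proof (rule ext)
  fix i assume x: "x \<in> ambient G"
  show "mact G M x i = x i - sv x i"
  proof (cases "i < gdim G")
    case True
    have "mact G M x i = (\<Sum>j<gdim G. (if i = j then x j else 0)
        - (\<Sum>k<6. of_int (B k i) * (of_int (C k j) * x j)))"
      using True by (auto simp: mact_def M_def left_diff_distrib sum_distrib_right mult.assoc intro!: sum.cong)
    also have "\<dots> = x i - (\<Sum>k<6. of_int (B k i) * cv x k)"
      using True by (simp add: sum_subtractf, subst sum.swap) (simp add: cv_def sum_distrib_left)
    finally show ?thesis using True by (simp add: sv_def bv_def mult.commute)
  next
    case False
    then show ?thesis using x sv_ambient[of x] by (simp add: mact_def ambient_def)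
  qed
qed

lemma mact_M_isom:
  assumes "x \<in> ambient G" "y \<in> ambient G"
  shows "bform G (mact G M x) (mact G M y) = bform G x y"
proof -
  have "bform G (sv x) (sv y) = 2 * bform G (sv x) y"
    by (simp add: bform_sv_swap sv_sv bform_scale_left)
  then show ?thesis using assms
    by (simp add: mact_M bform_diff_left bform_diff_right bform_sv_swap)
qed

lemma mact_M_invol: "x \<in> ambient G \<Longrightarrow> mact G M (mact G M x) = x"
proof -
  assume x: "x \<in> ambient G"
  have "sv (\<lambda>i. x i - sv x i) = (\<lambda>i. - sv x i)"
    using sv_linear[of 1 x "-1" "sv x"] by (simp add: sv_sv fun_eq_iff)
  then show ?thesis
    using x mact_ambient[of G M x] by (simp add: mact_M)
qed

lemma is_aut_M: "is_aut G M"
  unfolding is_aut_def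
proof (intro conjI ballI)
  show "bij_betw (mact G M) (latt G) (latt G)"
    by (rule bij_betw_byWitness[where f' = "mact G M"])
      (auto simp: mact_M_invol latt_ambient mact_latt)
qed (simp add: mact_M_isom latt_ambient)

text \<open>\<open>H\<close> is \<open>1 + M\<close> times the inverse Gram matrix, so the value of
  \<open>1 + M\<close> at \<open>x\<close> depends integrally on the products of \<open>x\<close>
  with the basis. This serves twice: dual vectors are sent to lattice vectors, and a vector with all
  products zero is negated by \<open>M\<close>.\<close>

lemma H_apply:
  assumes "x \<in> ambient G" "i < gdim G"
  shows "x i + mact G M x i = (\<Sum>l<gdim G. of_int (H i l) * bform G (uvec l) x)"
proof -
  have "(\<Sum>l<gdim G. of_int (H i l) * bform G (uvec l) x)
      = (\<Sum>l<gdim G. \<Sum>j<gdim G. of_int (H i l) * of_int (gent G l j) * x j)"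
    by (rule sum.cong) (simp_all add: bform_uvec_left sum_distrib_left mult.assoc)
  also have "\<dots> = (\<Sum>j<gdim G. of_int (\<Sum>l<gdim G. H i l * gent G l j) * x j)"
    by (subst sum.swap) (simp add: sum_distrib_right)
  also have "\<dots> = (\<Sum>j<gdim G. (if i = j then x j else 0) + of_int (M i j) * x j)"
    by (rule sum.cong) (auto simp: H_G[OF assms(2)] M_def algebra_simps)
  also have "\<dots> = x i + mact G M x i"
    using assms(2) by (simp add: sum.distrib mact_def)
  finally show ?thesis by simp
qed

text \<open>Integral products with the lattice suffice in \<open>H_apply\<close>, so
  \<open>M\<close> acts as -1 on the whole discriminant group and in particular on its
  3-part.\<close>

lemma z3_reversing_M: "z3_reversing G M"
  unfolding z3_reversing_def
proof
  fix x assume "x \<in> discr3_reps G"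
  then have x: "x \<in> ambient G" "\<And>v. v \<in> latt G \<Longrightarrow> bform G x v \<in> \<int>"
    by (auto simp: discr3_reps_def dual_latt_def)
  have "mact G M x i + x i \<in> \<int>" if "i < gdim G" for i
    using H_apply[OF x(1) that]
    by (auto simp: add.commute bform_sym[of "uvec _"] uvec_latt x(2) intro!: Ints_sum Ints_mult)
  then show "(\<lambda>i. mact G M x i + x i) \<in> latt G"
    using x(1) mact_ambient[of G M x] by (simp add: latt_def ambient_def)
qed

lemma wroot_not_negated:
  assumes r: "wroot G r"
  shows "mact G M r \<noteq> (\<lambda>i. - r i)"
proof
  assume neg: "mact G M r = (\<lambda>i. - r i)"
  have rl: "r \<in> latt G" using r by (auto simp: wroot_def root2_def root6_def)
  have "sv r = (\<lambda>i. 2 * r i)"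
    using neg mact_M[OF latt_ambient[OF rl]] by (auto simp: fun_eq_iff algebra_simps)
  \<comment> \<open>Primitivity enters here: \<open>r\<close> lies in the real span of
    \<open>S\<close>, and its coordinates in the basis \<open>B\<close> are the integers
    \<open>fv r k\<close>.\<close>
  then have fc: "cv r k = 2 * fv r k" if "k < 6" for k
    using fv_sv[OF that, of r] by (simp add: fv_def sum_distrib_left mult_ac)
  have "\<And>k. k < 6 \<Longrightarrow> fv r k \<in> \<int>"
    using rl by (auto simp: fv_def latt_def intro!: Ints_sum Ints_mult)
  then obtain m :: int where m: "e6form (fv r) (fv r) = 2 * of_int m"
    using e6form_even by blast
  have "2 * bform G r r = bform G (sv r) r"
    by (simp add: \<open>sv r = _\<close> bform_scale_left)
  also have "\<dots> = e6form (\<lambda>k. 2 * fv r k) (\<lambda>k. 2 * fv r k)"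
    unfolding bform_sv unfolding e6form_def by (intro sum.cong refl) (simp add: fc)
  also have "\<dots> = 4 * e6form (fv r) (fv r)"
    by (simp add: e6form_scale)
  finally have "bform G r r = of_int (4 * m)" using m by simp
  moreover have "bform G r r = of_int 2 \<or> bform G r r = of_int 6"
    using r by (auto simp: wroot_def root2_def root6_def)
  ultimately have "4 * m = 2 \<or> 4 * m = 6" by (metis of_int_eq_iff)
  then show False by presburger
qed

lemma wroot_mact:
  assumes r: "wroot G r"
  shows "wroot G (mact G M r)"
proof -
  have rl: "r \<in> latt G" using r by (auto simp: wroot_def root2_def root6_def)
  have "bform G (mact G M r) w = bform G r (mact G M w)" if "w \<in> latt G" for w
    using mact_M_isom[OF latt_ambient[OF rl] mact_ambient[of G M w]] that
    by (simp add: mact_M_invol latt_ambient)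
  then show ?thesis using r rl
    by (auto simp: wroot_def root2_def root6_def mact_latt mact_M_isom latt_ambient)
qed

text \<open>A fixed vector on the moment curve \<open>x0 + (1 + M) (t, t\<^sup>2, \<dots>)\<close>: a mirror containing more than
  finitely many of these points is orthogonal to all fixed vectors, so its root is negated by \<open>M\<close>.\<close>

lemma generic_fixed_vector: "\<exists>x \<in> open_cone_part G. mact G M x = x"
proof -
  define y0 where "y0 = (\<lambda>i. if i < gdim G then real_of_int (x0 i) else 0)"
  define z where "z = (\<lambda>t i. if i < gdim G then (t::real) ^ (Suc i) else 0)"
  define x where "x = (\<lambda>t i. y0 i + (2 * z t i - sv (z t) i))"
  have y0A: "y0 \<in> ambient G" and zA: "z t \<in> ambient G" for t
    by (simp_all add: y0_def z_def ambient_def)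
  have xA: "x t \<in> ambient G" for t
    using y0A zA[of t] sv_ambient[of "z t"] by (simp add: x_def ambient_def)
  have cy0: "cv y0 k = 0" if "k < 6" for k
  proof -
    have "cv y0 k = of_int (\<Sum>j<gdim G. C k j * x0 j)" by (simp add: cv_def y0_def)
    then show ?thesis using C_x0[OF that] by simp
  qed
  then have sy0: "sv y0 = (\<lambda>i. 0)" by (simp add: sv_def fun_eq_iff)
  have sx: "sv (x t) = (\<lambda>i. 0)" for t
  proof -
    have "x t = (\<lambda>i. 1 * y0 i + 1 * (2 * z t i + (-1) * sv (z t) i))" by (simp add: x_def fun_eq_iff)
    then have "sv (x t) = (\<lambda>i. 1 * sv y0 i + 1 * (2 * sv (z t) i + (-1) * sv (sv (z t)) i))"
      by (simp only: sv_linear)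
    then show ?thesis by (simp add: sv_sv sy0)
  qed
  then have fixed: "mact G M (x t) = x t" for t
    by (simp add: mact_M[OF xA])
  have bad: "finite {t. bform G r (x t) = 0}" if r: "wroot G r" for r
  proof -
    have rl: "r \<in> latt G" using r by (auto simp: wroot_def root2_def root6_def)
    \<comment> \<open>\<open>q\<close> is twice the projection of \<open>r\<close> to the fixed
      space of \<open>M\<close>; since \<open>M\<close> is self-adjoint, \<open>r\<close> pairs with
      \<open>(1 + M) z\<close> as \<open>q\<close> pairs with \<open>z\<close>.\<close>
    define q where "q = (\<lambda>i. r i + mact G M r i)"
    have qA: "q \<in> ambient G"
      using latt_ambient[OF rl] mact_ambient[of G M r] by (simp add: q_def ambient_def)
    \<comment> \<open>The exponents \<open>Suc i\<close> in \<open>z\<close> leave the constant term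
      to \<open>y0\<close>, so the other coefficients are exactly the products of \<open>q\<close>
      with the basis.\<close>
    define c where "c = (\<lambda>k. case k of 0 \<Rightarrow> bform G r y0 | Suc j \<Rightarrow> bform G q (uvec j))"
    have "bform G r (x t) = (\<Sum>k\<le>gdim G. c k * t ^ k)" for t
    proof -
      have "bform G r (x t) = bform G r y0 + bform G q (z t)"
        unfolding x_def q_def mact_M[OF latt_ambient[OF rl]]
        by (simp add: bform_linear bform_sv_swap)
      also have "bform G q (z t) = (\<Sum>j<gdim G. bform G q (uvec j) * t ^ Suc j)"
        by (subst bform_expand_right) (simp add: z_def mult.commute)
      finally show ?thesis
        unfolding lessThan_Suc_atMost[symmetric] sum.lessThan_Suc_shift by (simp add: c_def)
    qed
    moreover have "\<exists>k\<le>gdim G. c k \<noteq> 0"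
    proof (rule ccontr)
      assume *: "\<not> (\<exists>k\<le>gdim G. c k \<noteq> 0)"
      have "bform G q (uvec j) = 0" if "j < gdim G" for j
        using * that by (auto simp: c_def dest!: spec[of _ "Suc j"])
      then have "q i + mact G M q i = 0" if "i < gdim G" for i
        using H_apply[OF qA that] by (simp add: bform_sym[of "uvec _"])
      moreover have "mact G M q = q"
        using mact_linear[of G M 1 r 1 "mact G M r"] mact_M_invol[OF latt_ambient[OF rl]]
        by (simp add: q_def add.commute)
      ultimately have "q i = 0" for i
        using qA by (cases "i < gdim G") (auto simp: ambient_def)
      then have "mact G M r = (\<lambda>i. - r i)"
        by (auto simp: q_def fun_eq_iff eq_neg_iff_add_eq_0 add.commute)
      then show False using wroot_not_negated[OF r] by blast
    qed
    ultimately show ?thesis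
      using polyfun_finite_roots[of c "gdim G"] by simp
  qed
  \<comment> \<open>Countably many roots, each excluding finitely many parameters, cannot exhaust an
    interval on which the norm stays negative.\<close>
  have "countable (\<Union>r\<in>{r. wroot G r}. {t. bform G r (x t) = 0})"
  proof (rule countable_UN)
    show "countable {r. wroot G r}"
      by (rule countable_subset[OF _ countable_latt[of G]]) (auto simp: wroot_def root2_def root6_def)
  qed (simp add: bad countable_finite)
  moreover have "\<exists>d>0. \<forall>t. \<bar>t\<bar> < d \<longrightarrow> bform G (x t) (x t) < 0"
  proof -
    have "bform G (x 0) (x 0) = of_int (\<Sum>i<gdim G. \<Sum>j<gdim G. x0 i * gent G i j * x0 j)"
    proof -
      have "x 0 = y0"
        by (auto simp: x_def fun_eq_iff z_def sv_def cv_def)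
      then show ?thesis by (simp add: bform_def y0_def)
    qed
    then have neg: "bform G (x 0) (x 0) < 0" using x0_neg by (simp only: of_int_less_0_iff)
    have "isCont (\<lambda>t. bform G (x t) (x t)) 0"
    proof -
      have c: "isCont (\<lambda>t. x t i) 0" for i
      proof -
        have "isCont (\<lambda>t. z t j) 0" for j by (cases "j < gdim G") (auto simp: z_def)
        then show ?thesis unfolding x_def sv_def cv_def by (intro continuous_intros)
      qed
      show ?thesis unfolding bform_def by (intro continuous_intros c)
    qed
    then have "\<forall>\<^sub>F t in at 0. bform G (x t) (x t) < 0"
      using neg unfolding isCont_def by (rule order_tendstoD(2))
    then obtain d where "d > 0" "\<And>t. t \<noteq> 0 \<Longrightarrow> dist t 0 < d \<Longrightarrow> bform G (x t) (x t) < 0"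
      by (auto simp: eventually_at)
    then have "bform G (x t) (x t) < 0" if "\<bar>t\<bar> < d" for t
      using neg that by (cases "t = 0") auto
    then show ?thesis using \<open>d > 0\<close> by blast
  qed
  then obtain d :: real where d: "d > 0" "\<And>t. \<bar>t\<bar> < d \<Longrightarrow> bform G (x t) (x t) < 0" by blast
  ultimately have "\<not> {0<..<d} \<subseteq> (\<Union>r\<in>{r. wroot G r}. {t. bform G r (x t) = 0})"
    using uncountable_open_interval[of 0 d] countable_subset by auto
  then obtain t where "0 < t" "t < d" "\<And>r. wroot G r \<Longrightarrow> bform G r (x t) \<noteq> 0"
    by (auto simp: subset_iff)
  then have "x t \<in> open_cone_part G"
    using d(2)[of t] xA by (simp add: open_cone_part_def)
  then show ?thesis using fixed by blast
qed

text \<open>\<open>M\<close> preserves the complement of the mirrors and acts continuously. The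
  image of the component of a fixed vector is connected and contains that vector, so it stays inside
  the component; equality follows because \<open>M\<close> is an involution.\<close>

theorem achiral: "achiral G"
proof -
  obtain x where x: "x \<in> open_cone_part G" "mact G M x = x"
    using generic_fixed_vector by blast
  define Q where "Q = connected_component_set (open_cone_part G) x"
  have Qsub: "Q \<subseteq> open_cone_part G"
    unfolding Q_def by (rule connected_component_subset)
  have QA: "q \<in> ambient G" if "q \<in> Q" for q
    using that Qsub by (auto simp: open_cone_part_def)
  have xQ: "x \<in> Q" unfolding Q_def using x(1) by simp
  have "mact G M ` Q \<subseteq> open_cone_part G"
  proof
    fix y assume "y \<in> mact G M ` Q"
    then obtain q where q: "q \<in> Q" "y = mact G M q" by blast
    have qo: "q \<in> open_cone_part G" using q(1) Qsub by blast
    have "bform G v y \<noteq> 0" if v: "wroot G v" for v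
    proof -
      have vA: "v \<in> ambient G" using v by (auto simp: wroot_def root2_def root6_def latt_ambient)
      have "bform G v y = bform G (mact G M v) q"
        using mact_M_isom[OF mact_ambient[of G M v] QA[OF q(1)]] mact_M_invol[OF vA] q(2) by simp
      then show ?thesis using qo wroot_mact[OF v] by (simp add: open_cone_part_def)
    qed
    then show "y \<in> open_cone_part G"
      using qo q(2) by (simp add: open_cone_part_def mact_ambient mact_M_isom QA q(1))
  qed
  moreover have "connected (mact G M ` Q)"
    unfolding Q_def by (intro connected_continuous_image continuous_on_mact connected_connected_component)
  moreover have "x \<in> mact G M ` Q" using xQ x(2) by (metis image_eqI)
  ultimately have sub: "mact G M ` Q \<subseteq> Q"
    unfolding Q_def[symmetric] using connected_component_maximal Q_def by metis
  have "q \<in> mact G M ` Q" if "q \<in> Q" for q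
    using sub that mact_M_invol[OF QA[OF that]] by (metis image_eqI image_subset_iff)
  with sub have "direct G M Q" unfolding direct_def by blast
  then show ?thesis
    unfolding achiral_def using is_aut_M z3_reversing_M x(1) Q_def by (auto simp: cell_lift_def)
qed

end

section \<open>Integer matrix certificates for an embedded E6(2)\<close>

definition dot :: "int list \<Rightarrow> int list \<Rightarrow> int" where
  "dot xs ys = sum_list (map2 (*) xs ys)"

definition cols :: "nat \<Rightarrow> int list list \<Rightarrow> int list list" where
  "cols n A = map (\<lambda>j. map (\<lambda>r. r ! j) A) [0..<n]"

definition scalar_mat :: "nat \<Rightarrow> int \<Rightarrow> int list list" where
  "scalar_mat n c = map (\<lambda>i. map (\<lambda>j. if i = j then c else 0) [0..<n]) [0..<n]"

definition mat_diff :: "int list list \<Rightarrow> int list list \<Rightarrow> int list list" where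
  "mat_diff = map2 (map2 (-))"

definition mul_tr :: "int list list \<Rightarrow> int list list \<Rightarrow> int list list" where
  "mul_tr A B = map (\<lambda>r. map (dot r) B) A"

definition has_shape :: "nat \<Rightarrow> nat \<Rightarrow> int list list \<Rightarrow> bool" where
  "has_shape m n A \<longleftrightarrow> length A = m \<and> list_all (\<lambda>r. length r = n) A"

definition E6_2_certificate ::
    "gram \<Rightarrow> int list list \<Rightarrow> int list list \<Rightarrow> int list list \<Rightarrow> int list list \<Rightarrow> int list \<Rightarrow> bool" where
  "E6_2_certificate G B C F H x \<longleftrightarrow> (let n = length G in
     has_shape n n G \<and> has_shape 6 n B \<and> has_shape 6 n C \<and> has_shape 6 n F \<and> has_shape n n H \<and>
     length x = n \<and> cols n G = G \<and>
     mul_tr E6_lat (cols n C) = mul_tr B G \<and>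
     mul_tr C B = scalar_mat 6 2 \<and>
     mul_tr F B = scalar_mat 6 1 \<and>
     mul_tr H G = mat_diff (scalar_mat n 2) (mul_tr (cols n B) (cols n C)) \<and>
     mul_tr C [x] = replicate 6 [0] \<and>
     dot x (map (dot x) G) < 0)"

lemma dot_eq_sum: "length xs = n \<Longrightarrow> length ys = n \<Longrightarrow> dot xs ys = (\<Sum>i<n. xs ! i * ys ! i)"
  by (simp add: dot_def sum_list_sum_nth atLeast0LessThan)

lemma has_shape_length:
  "has_shape m n A \<Longrightarrow> length A = m" "has_shape m n A \<Longrightarrow> i < m \<Longrightarrow> length (A ! i) = n"
  by (auto simp: has_shape_def list_all_length)

lemma nth_mul_tr:
  assumes "has_shape m k A" "has_shape n k B" "i < m" "j < n"
  shows "mul_tr A B ! i ! j = (\<Sum>l<k. A ! i ! l * B ! j ! l)"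
  using assms has_shape_length[OF assms(1)] has_shape_length[OF assms(2)]
  by (simp add: mul_tr_def dot_eq_sum)

lemma has_shape_cols: "has_shape m n A \<Longrightarrow> has_shape n m (cols n A)"
  by (auto simp: has_shape_def cols_def list_all_iff)

lemma nth_cols: "has_shape m n A \<Longrightarrow> i < m \<Longrightarrow> j < n \<Longrightarrow> cols n A ! j ! i = A ! i ! j"
  by (simp add: cols_def has_shape_def)

lemma nth_scalar_mat: "i < n \<Longrightarrow> j < n \<Longrightarrow> scalar_mat n c ! i ! j = (if i = j then c else 0)"
  by (simp add: scalar_mat_def)

lemma achiral_if_certificate:
  assumes "E6_2_certificate G B C F H x"
  shows "achiral G"
proof -
  define n where "n = length G"
  have shapes: "has_shape n n G" "has_shape 6 n B" "has_shape 6 n C" "has_shape 6 n F" "has_shape n n H"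
    "length x = n"
    and GG: "cols n G = G" and EC: "mul_tr E6_lat (cols n C) = mul_tr B G"
    and CB: "mul_tr C B = scalar_mat 6 2" and FB: "mul_tr F B = scalar_mat 6 1"
    and HG: "mul_tr H G = mat_diff (scalar_mat n 2) (mul_tr (cols n B) (cols n C))"
    and Cx: "mul_tr C [x] = replicate 6 [0]" and neg: "dot x (map (dot x) G) < 0"
    using assms by (simp_all add: E6_2_certificate_def Let_def n_def)
  have E6: "has_shape 6 6 E6_lat" by (simp add: has_shape_def E6_lat_def)
  have sym: "G ! i ! j = G ! j ! i" if "i < n" "j < n" for i j
    using nth_cols[OF shapes(1) that(2,1)] GG by simp
  have gd: "gdim G = n" "gent G i j = G ! i ! j" for i j by (simp_all add: gdim_def n_def gent_def)
  interpret E6_2_embedding G "\<lambda>i j. B ! i ! j" "\<lambda>i j. C ! i ! j" "\<lambda>i j. F ! i ! j" "\<lambda>i j. H ! i ! j" "\<lambda>i. x ! i"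
  proof (unfold_locales, goal_cases)
    case (1 i j)
    then show ?case using sym by (simp add: gd)
  next
    case (2 k j)
    have "(\<Sum>l<6. E6_lat ! k ! l * C ! l ! j) = mul_tr E6_lat (cols n C) ! k ! j"
      using 2 by (simp add: gd nth_mul_tr[OF E6 has_shape_cols[OF shapes(3)]] nth_cols[OF shapes(3)])
    then show ?case using 2 by (simp add: gd EC nth_mul_tr[OF shapes(2,1)] sym)
  next
    case (3 k l)
    then show ?case using nth_mul_tr[OF shapes(3,2), of k l] by (simp add: gd CB nth_scalar_mat)
  next
    case (4 k l)
    then show ?case using nth_mul_tr[OF shapes(4,2), of k l] by (simp add: gd FB nth_scalar_mat)
  next
    case (5 i j)
    have "(\<Sum>l<n. H ! i ! l * G ! l ! j) = mul_tr H G ! i ! j"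
      using 5 by (simp add: gd nth_mul_tr[OF shapes(5,1)] sym)
    also have "\<dots> = scalar_mat n 2 ! i ! j - mul_tr (cols n B) (cols n C) ! i ! j"
      unfolding HG using 5 by (simp add: gd mat_diff_def scalar_mat_def mul_tr_def cols_def)
    finally show ?case
      using 5 by (simp add: gd nth_scalar_mat nth_mul_tr[OF has_shape_cols[OF shapes(2)] has_shape_cols[OF shapes(3)]]
          nth_cols[OF shapes(2)] nth_cols[OF shapes(3)])
  next
    case (6 k)
    have "dot (C ! k) x = 0"
      using arg_cong[OF Cx, of "\<lambda>A. A ! k ! 0"] 6 has_shape_length(1)[OF shapes(3)] by (simp add: mul_tr_def)
    then show ?case using 6 dot_eq_sum[of "C ! k" n x] has_shape_length(2)[OF shapes(3)] shapes(6)
      by (simp add: gd)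
  next
    case 7
    have "dot x (map (dot x) G) = (\<Sum>i<n. x ! i * (\<Sum>j<n. x ! j * G ! i ! j))"
      using shapes(6) has_shape_length[OF shapes(1)] by (subst dot_eq_sum[where n = n]) (auto simp: dot_eq_sum[where n = n])
    also have "\<dots> = (\<Sum>i<n. \<Sum>j<n. x ! i * G ! i ! j * x ! j)"
      by (simp add: sum_distrib_left mult_ac)
    finally show ?case using neg by (simp add: gd)
  qed
  show ?thesis by (rule achiral)
qed

subsection \<open>Certificates\<close>

text \<open>The basis of \<open>E\<^sub>6(2)\<close> in \<open>U(2) + A\<^sub>2 + D\<^sub>4\<close> was found by a search. Lattices with a summand \<open>E\<^sub>8\<close> or with
  \<open>U\<close> instead of \<open>U(2)\<close> receive its image under \<open>D\<^sub>4 \<subset> E\<^sub>8\<close> and under the embedding of \<open>U(2)\<close> spanned by \<open>u\<close>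
  and \<open>-u + 2v + \<kappa>\<close> with \<open>\<kappa>\<^sup>2 = 4\<close>. In the lattices with a summand \<open>E\<^sub>8(2)\<close> the first basis vector of
  \<open>E\<^sub>6(2) \<subset> E\<^sub>8(2)\<close> is shifted by an isotropic vector orthogonal to \<open>E\<^sub>6(2)\<close>, which makes \<open>C\<close> integral.\<close>

lemma achiral_U2_A2_D4: "achiral (gscale 2 U_lat \<oplus>\<^sub>L A2_lat \<oplus>\<^sub>L D4_lat)"
proof (rule achiral_if_certificate)
  show "E6_2_certificate (gscale 2 U_lat \<oplus>\<^sub>L A2_lat \<oplus>\<^sub>L D4_lat)
    [[1, -2, 2, 1, 1, 0, 1, 1],
     [-2, 1, -2, -1, -2, -2, -2, -1],
     [1, 0, 1, 0, -1, -1, 0, -1],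
     [0, 1, -1, 0, 1, 1, 0, 1],
     [-2, 1, -2, 0, -1, 0, 0, -1],
     [1, -1, 1, -1, 1, 1, 1, 1]]
    [[2, -2, -3, 1, -1, -1, 1, 1],
     [8, -8, -10, 2, -4, 2, -2, 0],
     [8, -6, -9, 2, -4, 1, 0, 0],
     [14, -12, -17, 4, -6, 3, -2, 0],
     [10, -10, -13, 3, -5, 3, -1, -1],
     [4, -4, -5, 0, -2, 1, 0, 0]]
    [[3, -3, -4, 1, -1, 0, 0, 0],
     [0, 0, 0, 0, -1, 0, 0, 1],
     [5, -4, -6, 1, -1, 0, 0, -1],
     [4, -3, -5, 1, -1, 0, 0, 0],
     [5, -5, -7, 1, 0, 0, 0, -2],
     [3, -3, -4, 0, 0, 0, 0, -1]]
    [[-12, 12, -17, -5, -7, -3, -5, -3],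
     [12, -12, 17, 5, 7, 3, 5, 3],
     [-17, 17, -24, -7, -10, -4, -7, -4],
     [-5, 5, -7, -2, -3, -1, -2, -1],
     [-7, 7, -10, -3, -4, -2, -3, -2],
     [-3, 3, -4, -1, -2, 0, -1, 0],
     [-5, 5, -7, -2, -3, -1, -2, -1],
     [-3, 3, -4, -1, -2, 0, -1, 0]]
    [-5, 5, -7, -2, -3, -1, -2, -1]"
    by code_simp
qed

text \<open>Here \<open>S\<close> is the summand itself: the first and third matrices,
  \<open>B\<close> and \<open>F\<close>, consist of coordinate vectors, \<open>C\<close> is twice
  \<open>B\<close>, and \<open>H\<close> is twice the inverse Gram matrix of the hyperbolic part,
  extended by zero.\<close>

lemma achiral_U_E6t: "achiral (U_lat \<oplus>\<^sub>L gscale 2 E6_lat)"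
proof (rule achiral_if_certificate)
  show "E6_2_certificate (U_lat \<oplus>\<^sub>L gscale 2 E6_lat)
    [[0, 0, 1, 0, 0, 0, 0, 0],
     [0, 0, 0, 1, 0, 0, 0, 0],
     [0, 0, 0, 0, 1, 0, 0, 0],
     [0, 0, 0, 0, 0, 1, 0, 0],
     [0, 0, 0, 0, 0, 0, 1, 0],
     [0, 0, 0, 0, 0, 0, 0, 1]]
    [[0, 0, 2, 0, 0, 0, 0, 0],
     [0, 0, 0, 2, 0, 0, 0, 0],
     [0, 0, 0, 0, 2, 0, 0, 0],
     [0, 0, 0, 0, 0, 2, 0, 0],
     [0, 0, 0, 0, 0, 0, 2, 0],
     [0, 0, 0, 0, 0, 0, 0, 2]]
    [[0, 0, 1, 0, 0, 0, 0, 0],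
     [0, 0, 0, 1, 0, 0, 0, 0],
     [0, 0, 0, 0, 1, 0, 0, 0],
     [0, 0, 0, 0, 0, 1, 0, 0],
     [0, 0, 0, 0, 0, 0, 1, 0],
     [0, 0, 0, 0, 0, 0, 0, 1]]
    [[0, 2, 0, 0, 0, 0, 0, 0],
     [2, 0, 0, 0, 0, 0, 0, 0],
     [0, 0, 0, 0, 0, 0, 0, 0],
     [0, 0, 0, 0, 0, 0, 0, 0],
     [0, 0, 0, 0, 0, 0, 0, 0],
     [0, 0, 0, 0, 0, 0, 0, 0],
     [0, 0, 0, 0, 0, 0, 0, 0],
     [0, 0, 0, 0, 0, 0, 0, 0]]
    [2, -2, 0, 0, 0, 0, 0, 0]"
    by code_simp
qed

lemma achiral_U2_E6t: "achiral (gscale 2 U_lat \<oplus>\<^sub>L gscale 2 E6_lat)"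
proof (rule achiral_if_certificate)
  show "E6_2_certificate (gscale 2 U_lat \<oplus>\<^sub>L gscale 2 E6_lat)
    [[0, 0, 1, 0, 0, 0, 0, 0],
     [0, 0, 0, 1, 0, 0, 0, 0],
     [0, 0, 0, 0, 1, 0, 0, 0],
     [0, 0, 0, 0, 0, 1, 0, 0],
     [0, 0, 0, 0, 0, 0, 1, 0],
     [0, 0, 0, 0, 0, 0, 0, 1]]
    [[0, 0, 2, 0, 0, 0, 0, 0],
     [0, 0, 0, 2, 0, 0, 0, 0],
     [0, 0, 0, 0, 2, 0, 0, 0],
     [0, 0, 0, 0, 0, 2, 0, 0],
     [0, 0, 0, 0, 0, 0, 2, 0],
     [0, 0, 0, 0, 0, 0, 0, 2]]
    [[0, 0, 1, 0, 0, 0, 0, 0],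
     [0, 0, 0, 1, 0, 0, 0, 0],
     [0, 0, 0, 0, 1, 0, 0, 0],
     [0, 0, 0, 0, 0, 1, 0, 0],
     [0, 0, 0, 0, 0, 0, 1, 0],
     [0, 0, 0, 0, 0, 0, 0, 1]]
    [[0, 1, 0, 0, 0, 0, 0, 0],
     [1, 0, 0, 0, 0, 0, 0, 0],
     [0, 0, 0, 0, 0, 0, 0, 0],
     [0, 0, 0, 0, 0, 0, 0, 0],
     [0, 0, 0, 0, 0, 0, 0, 0],
     [0, 0, 0, 0, 0, 0, 0, 0],
     [0, 0, 0, 0, 0, 0, 0, 0],
     [0, 0, 0, 0, 0, 0, 0, 0]]
    [2, -2, 0, 0, 0, 0, 0, 0]"
    by code_simp
qed

lemma achiral_U2_A2_E8: "achiral (gscale 2 U_lat \<oplus>\<^sub>L A2_lat \<oplus>\<^sub>L E8_lat)"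
proof (rule achiral_if_certificate)
  show "E6_2_certificate (gscale 2 U_lat \<oplus>\<^sub>L A2_lat \<oplus>\<^sub>L E8_lat)
    [[1, -2, 2, 1, 0, 1, 1, 0, 1, 0, 0, 0],
     [-2, 1, -2, -1, 0, -2, -2, -2, -1, 0, 0, 0],
     [1, 0, 1, 0, 0, -1, 0, -1, -1, 0, 0, 0],
     [0, 1, -1, 0, 0, 1, 0, 1, 1, 0, 0, 0],
     [-2, 1, -2, 0, 0, -1, 0, 0, -1, 0, 0, 0],
     [1, -1, 1, -1, 0, 1, 1, 1, 1, 0, 0, 0]]
    [[2, -2, -3, 1, 0, -1, 1, -1, 1, 0, 0, 0],
     [8, -8, -10, 2, 2, -4, -2, 2, 0, 1, 0, 0],
     [8, -6, -9, 2, 1, -4, 0, 1, 0, 1, 0, 0],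
     [14, -12, -17, 4, 2, -6, -2, 3, 0, 1, 0, 0],
     [10, -10, -13, 3, 1, -5, -1, 3, -1, 1, 0, 0],
     [4, -4, -5, 0, 0, -2, 0, 1, 0, 0, 0, 0]]
    [[3, -3, -4, 1, 0, -1, 0, 0, 0, 0, 0, 0],
     [0, 0, 0, 0, 0, -1, 0, 0, 1, 0, 0, 0],
     [5, -4, -6, 1, 0, -1, 0, 0, -1, 0, 0, 0],
     [4, -3, -5, 1, 0, -1, 0, 0, 0, 0, 0, 0],
     [5, -5, -7, 1, 0, 0, 0, 0, -2, 0, 0, 0],
     [3, -3, -4, 0, 0, 0, 0, 0, -1, 0, 0, 0]]
    [[-12, 12, -17, -5, 0, -7, -5, -3, -3, 0, 0, 0],
     [12, -12, 17, 5, 0, 7, 5, 3, 3, 0, 0, 0],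
     [-17, 17, -24, -7, 0, -10, -7, -4, -4, 0, 0, 0],
     [-5, 5, -7, -2, 0, -3, -2, -1, -1, 0, 0, 0],
     [0, 0, 0, 0, 8, 10, 14, 20, 16, 12, 8, 4],
     [-7, 7, -10, -3, 10, 10, 16, 26, 21, 18, 12, 6],
     [-5, 5, -7, -2, 14, 16, 24, 37, 30, 24, 16, 8],
     [-3, 3, -4, -1, 20, 26, 37, 56, 46, 36, 24, 12],
     [-3, 3, -4, -1, 16, 21, 30, 46, 38, 30, 20, 10],
     [0, 0, 0, 0, 12, 18, 24, 36, 30, 24, 16, 8],
     [0, 0, 0, 0, 8, 12, 16, 24, 20, 16, 12, 6],
     [0, 0, 0, 0, 4, 6, 8, 12, 10, 8, 6, 4]]
    [-5, 5, -7, -2, 0, -3, -2, -1, -1, 0, 0, 0]"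
    by code_simp
qed

lemma achiral_U_A2_D4_D4: "achiral (U_lat \<oplus>\<^sub>L A2_lat \<oplus>\<^sub>L D4_lat \<oplus>\<^sub>L D4_lat)"
proof (rule achiral_if_certificate)
  show "E6_2_certificate (U_lat \<oplus>\<^sub>L A2_lat \<oplus>\<^sub>L D4_lat \<oplus>\<^sub>L D4_lat)
    [[3, -4, 2, 1, -2, 0, -2, 0, 1, 0, 1, 1],
     [-3, 2, -2, -1, 1, 0, 1, 0, -2, -2, -2, -1],
     [1, 0, 1, 0, 0, 0, 0, 0, -1, -1, 0, -1],
     [-1, 2, -1, 0, 1, 0, 1, 0, 1, 1, 0, 1],
     [-3, 2, -2, 0, 1, 0, 1, 0, -1, 0, 0, -1],
     [2, -2, 1, -1, -1, 0, -1, 0, 1, 1, 1, 1]]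
    [[2, -2, -3, 1, 2, -2, 2, 0, -1, -1, 1, 1],
     [8, -8, -10, 2, 8, -8, 8, 0, -4, 2, -2, 0],
     [8, -7, -9, 2, 8, -8, 8, 0, -4, 1, 0, 0],
     [14, -13, -17, 4, 14, -14, 14, 0, -6, 3, -2, 0],
     [10, -10, -13, 3, 10, -10, 10, 0, -5, 3, -1, -1],
     [4, -4, -5, 0, 4, -4, 4, 0, -2, 1, 0, 0]]
    [[3, 0, -4, 1, 0, 0, 0, 0, -1, 0, 0, 0],
     [0, 0, 0, 0, 0, 0, 0, 0, -1, 0, 0, 1],
     [5, 0, -6, 1, 1, 0, 0, 0, -1, 0, 0, -1],
     [4, 0, -5, 1, 1, 0, 0, 0, -1, 0, 0, 0],
     [5, 0, -7, 1, 0, 0, 0, 0, 0, 0, 0, -2],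
     [3, 0, -4, 0, 0, 0, 0, 0, 0, 0, 0, -1]]
    [[-46, 48, -34, -10, 23, 0, 23, 0, -14, -6, -10, -6],
     [48, -48, 34, 10, -24, 0, -24, 0, 14, 6, 10, 6],
     [-34, 34, -24, -7, 17, 0, 17, 0, -10, -4, -7, -4],
     [-10, 10, -7, -2, 5, 0, 5, 0, -3, -1, -2, -1],
     [23, -24, 17, 5, -10, 2, -11, 1, 7, 3, 5, 3],
     [0, 0, 0, 0, 2, 4, 2, 2, 0, 0, 0, 0],
     [23, -24, 17, 5, -11, 2, -10, 1, 7, 3, 5, 3],
     [0, 0, 0, 0, 1, 2, 1, 2, 0, 0, 0, 0],
     [-14, 14, -10, -3, 7, 0, 7, 0, -4, -2, -3, -2],
     [-6, 6, -4, -1, 3, 0, 3, 0, -2, 0, -1, 0],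
     [-10, 10, -7, -2, 5, 0, 5, 0, -3, -1, -2, -1],
     [-6, 6, -4, -1, 3, 0, 3, 0, -2, 0, -1, 0]]
    [-10, 10, -7, -2, 5, 0, 5, 0, -3, -1, -2, -1]"
    by code_simp
qed

lemma achiral_U2_A2_D4_D4: "achiral (gscale 2 U_lat \<oplus>\<^sub>L A2_lat \<oplus>\<^sub>L D4_lat \<oplus>\<^sub>L D4_lat)"
proof (rule achiral_if_certificate)
  show "E6_2_certificate (gscale 2 U_lat \<oplus>\<^sub>L A2_lat \<oplus>\<^sub>L D4_lat \<oplus>\<^sub>L D4_lat)
    [[1, -2, 2, 1, 1, 0, 1, 1, 0, 0, 0, 0],
     [-2, 1, -2, -1, -2, -2, -2, -1, 0, 0, 0, 0],
     [1, 0, 1, 0, -1, -1, 0, -1, 0, 0, 0, 0],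
     [0, 1, -1, 0, 1, 1, 0, 1, 0, 0, 0, 0],
     [-2, 1, -2, 0, -1, 0, 0, -1, 0, 0, 0, 0],
     [1, -1, 1, -1, 1, 1, 1, 1, 0, 0, 0, 0]]
    [[2, -2, -3, 1, -1, -1, 1, 1, 0, 0, 0, 0],
     [8, -8, -10, 2, -4, 2, -2, 0, 0, 0, 0, 0],
     [8, -6, -9, 2, -4, 1, 0, 0, 0, 0, 0, 0],
     [14, -12, -17, 4, -6, 3, -2, 0, 0, 0, 0, 0],
     [10, -10, -13, 3, -5, 3, -1, -1, 0, 0, 0, 0],
     [4, -4, -5, 0, -2, 1, 0, 0, 0, 0, 0, 0]]
    [[3, -3, -4, 1, -1, 0, 0, 0, 0, 0, 0, 0],
     [0, 0, 0, 0, -1, 0, 0, 1, 0, 0, 0, 0],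
     [5, -4, -6, 1, -1, 0, 0, -1, 0, 0, 0, 0],
     [4, -3, -5, 1, -1, 0, 0, 0, 0, 0, 0, 0],
     [5, -5, -7, 1, 0, 0, 0, -2, 0, 0, 0, 0],
     [3, -3, -4, 0, 0, 0, 0, -1, 0, 0, 0, 0]]
    [[-12, 12, -17, -5, -7, -3, -5, -3, 0, 0, 0, 0],
     [12, -12, 17, 5, 7, 3, 5, 3, 0, 0, 0, 0],
     [-17, 17, -24, -7, -10, -4, -7, -4, 0, 0, 0, 0],
     [-5, 5, -7, -2, -3, -1, -2, -1, 0, 0, 0, 0],
     [-7, 7, -10, -3, -4, -2, -3, -2, 0, 0, 0, 0],
     [-3, 3, -4, -1, -2, 0, -1, 0, 0, 0, 0, 0],
     [-5, 5, -7, -2, -3, -1, -2, -1, 0, 0, 0, 0],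
     [-3, 3, -4, -1, -2, 0, -1, 0, 0, 0, 0, 0],
     [0, 0, 0, 0, 0, 0, 0, 0, 2, 2, 1, 1],
     [0, 0, 0, 0, 0, 0, 0, 0, 2, 4, 2, 2],
     [0, 0, 0, 0, 0, 0, 0, 0, 1, 2, 2, 1],
     [0, 0, 0, 0, 0, 0, 0, 0, 1, 2, 1, 2]]
    [-5, 5, -7, -2, -3, -1, -2, -1, 0, 0, 0, 0]"
    by code_simp
qed

lemma achiral_U_A2_E8t: "achiral (U_lat \<oplus>\<^sub>L A2_lat \<oplus>\<^sub>L gscale 2 E8_lat)"
proof (rule achiral_if_certificate)
  show "E6_2_certificate (U_lat \<oplus>\<^sub>L A2_lat \<oplus>\<^sub>L gscale 2 E8_lat)
    [[3, -3, -1, 1, 3, 3, 4, 6, 5, 4, 3, 0],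
     [0, 0, 0, 0, 0, 1, 0, 0, 0, 0, 0, 0],
     [0, 0, 0, 0, 0, 0, 1, 0, 0, 0, 0, 0],
     [0, 0, 0, 0, 0, 0, 0, 1, 0, 0, 0, 0],
     [0, 0, 0, 0, 0, 0, 0, 0, 1, 0, 0, 0],
     [0, 0, 0, 0, 0, 0, 0, 0, 0, 1, 0, 0]]
    [[-4, 4, -4, 4, 2, 0, 0, 0, 0, 0, 4, -8],
     [-3, 3, -3, 3, 0, 2, 0, 0, 0, 0, 2, -6],
     [-5, 5, -5, 5, 0, 0, 2, 0, 0, 0, 4, -10],
     [-6, 6, -6, 6, 0, 0, 0, 2, 0, 0, 4, -12],
     [-4, 4, -4, 4, 0, 0, 0, 0, 2, 0, 2, -8],
     [-2, 2, -2, 2, 0, 0, 0, 0, 0, 2, 0, -4]]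
    [[0, 0, -1, 0, 0, 0, 0, 0, 0, 0, 0, 0],
     [0, 0, 3, 0, 0, 1, 0, 0, 0, 0, 0, 0],
     [0, 0, 4, 0, 0, 0, 1, 0, 0, 0, 0, 0],
     [0, 0, 6, 0, 0, 0, 0, 1, 0, 0, 0, 0],
     [0, 0, 5, 0, 0, 0, 0, 0, 1, 0, 0, 0],
     [0, 0, 4, 0, 0, 0, 0, 0, 0, 1, 0, 0]]
    [[-12, 14, 4, -4, -12, -15, -21, -30, -24, -18, -12, 0],
     [14, -12, -4, 4, 12, 15, 21, 30, 24, 18, 12, 0],
     [4, -4, 0, 2, 4, 5, 7, 10, 8, 6, 4, 0],
     [-4, 4, 2, 0, -4, -5, -7, -10, -8, -6, -4, 0],
     [-12, 12, 4, -4, -8, -10, -14, -20, -16, -12, -8, 2],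
     [-15, 15, 5, -5, -10, -12, -17, -24, -19, -14, -9, 3],
     [-21, 21, 7, -7, -14, -17, -24, -34, -27, -20, -13, 4],
     [-30, 30, 10, -10, -20, -24, -34, -48, -38, -28, -18, 6],
     [-24, 24, 8, -8, -16, -19, -27, -38, -30, -22, -14, 5],
     [-18, 18, 6, -6, -12, -14, -20, -28, -22, -16, -10, 4],
     [-12, 12, 4, -4, -8, -9, -13, -18, -14, -10, -6, 3],
     [0, 0, 0, 0, 2, 3, 4, 6, 5, 4, 3, 2]]
    [-10, 12, 4, -4, -12, -15, -21, -30, -24, -18, -12, -2]"
    by code_simp
qed

lemma achiral_U2_A2_E8t: "achiral (gscale 2 U_lat \<oplus>\<^sub>L A2_lat \<oplus>\<^sub>L gscale 2 E8_lat)"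
proof (rule achiral_if_certificate)
  show "E6_2_certificate (gscale 2 U_lat \<oplus>\<^sub>L A2_lat \<oplus>\<^sub>L gscale 2 E8_lat)
    [[3, -3, -2, 2, 3, 3, 4, 6, 5, 4, 3, 0],
     [0, 0, 0, 0, 0, 1, 0, 0, 0, 0, 0, 0],
     [0, 0, 0, 0, 0, 0, 1, 0, 0, 0, 0, 0],
     [0, 0, 0, 0, 0, 0, 0, 1, 0, 0, 0, 0],
     [0, 0, 0, 0, 0, 0, 0, 0, 1, 0, 0, 0],
     [0, 0, 0, 0, 0, 0, 0, 0, 0, 1, 0, 0]]
    [[-8, 8, -8, 8, 2, 0, 0, 0, 0, 0, 4, -8],
     [-6, 6, -6, 6, 0, 2, 0, 0, 0, 0, 2, -6],
     [-10, 10, -10, 10, 0, 0, 2, 0, 0, 0, 4, -10],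
     [-12, 12, -12, 12, 0, 0, 0, 2, 0, 0, 4, -12],
     [-8, 8, -8, 8, 0, 0, 0, 0, 2, 0, 2, -8],
     [-4, 4, -4, 4, 0, 0, 0, 0, 0, 2, 0, -4]]
    [[0, -1, 1, 0, 0, 0, 0, 0, 0, 0, 0, 0],
     [0, -1, 3, 0, 0, 1, 0, 0, 0, 0, 0, 0],
     [0, 0, 2, 0, 0, 0, 1, 0, 0, 0, 0, 0],
     [0, 0, 3, 0, 0, 0, 0, 1, 0, 0, 0, 0],
     [0, -1, 4, 0, 0, 0, 0, 0, 1, 0, 0, 0],
     [0, 0, 2, 0, 0, 0, 0, 0, 0, 1, 0, 0]]
    [[-12, 13, 8, -8, -12, -15, -21, -30, -24, -18, -12, 0],
     [13, -12, -8, 8, 12, 15, 21, 30, 24, 18, 12, 0],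
     [8, -8, -4, 6, 8, 10, 14, 20, 16, 12, 8, 0],
     [-8, 8, 6, -4, -8, -10, -14, -20, -16, -12, -8, 0],
     [-12, 12, 8, -8, -8, -10, -14, -20, -16, -12, -8, 2],
     [-15, 15, 10, -10, -10, -12, -17, -24, -19, -14, -9, 3],
     [-21, 21, 14, -14, -14, -17, -24, -34, -27, -20, -13, 4],
     [-30, 30, 20, -20, -20, -24, -34, -48, -38, -28, -18, 6],
     [-24, 24, 16, -16, -16, -19, -27, -38, -30, -22, -14, 5],
     [-18, 18, 12, -12, -12, -14, -20, -28, -22, -16, -10, 4],
     [-12, 12, 8, -8, -8, -9, -13, -18, -14, -10, -6, 3],
     [0, 0, 0, 0, 2, 3, 4, 6, 5, 4, 3, 2]]
    [14, -12, -8, 8, 12, 16, 22, 32, 26, 20, 14, 0]"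
    by code_simp
qed

lemma achiral_U_A2_D4_E8: "achiral (U_lat \<oplus>\<^sub>L A2_lat \<oplus>\<^sub>L D4_lat \<oplus>\<^sub>L E8_lat)"
proof (rule achiral_if_certificate)
  show "E6_2_certificate (U_lat \<oplus>\<^sub>L A2_lat \<oplus>\<^sub>L D4_lat \<oplus>\<^sub>L E8_lat)
    [[3, -4, 2, 1, -2, 0, -2, 0, 0, 1, 1, 0, 1, 0, 0, 0],
     [-3, 2, -2, -1, 1, 0, 1, 0, 0, -2, -2, -2, -1, 0, 0, 0],
     [1, 0, 1, 0, 0, 0, 0, 0, 0, -1, 0, -1, -1, 0, 0, 0],
     [-1, 2, -1, 0, 1, 0, 1, 0, 0, 1, 0, 1, 1, 0, 0, 0],
     [-3, 2, -2, 0, 1, 0, 1, 0, 0, -1, 0, 0, -1, 0, 0, 0],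
     [2, -2, 1, -1, -1, 0, -1, 0, 0, 1, 1, 1, 1, 0, 0, 0]]
    [[2, -2, -3, 1, 2, -2, 2, 0, 0, -1, 1, -1, 1, 0, 0, 0],
     [8, -8, -10, 2, 8, -8, 8, 0, 2, -4, -2, 2, 0, 1, 0, 0],
     [8, -7, -9, 2, 8, -8, 8, 0, 1, -4, 0, 1, 0, 1, 0, 0],
     [14, -13, -17, 4, 14, -14, 14, 0, 2, -6, -2, 3, 0, 1, 0, 0],
     [10, -10, -13, 3, 10, -10, 10, 0, 1, -5, -1, 3, -1, 1, 0, 0],
     [4, -4, -5, 0, 4, -4, 4, 0, 0, -2, 0, 1, 0, 0, 0, 0]]
    [[3, 0, -4, 1, 0, 0, 0, 0, 0, -1, 0, 0, 0, 0, 0, 0],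
     [0, 0, 0, 0, 0, 0, 0, 0, 0, -1, 0, 0, 1, 0, 0, 0],
     [5, 0, -6, 1, 1, 0, 0, 0, 0, -1, 0, 0, -1, 0, 0, 0],
     [4, 0, -5, 1, 1, 0, 0, 0, 0, -1, 0, 0, 0, 0, 0, 0],
     [5, 0, -7, 1, 0, 0, 0, 0, 0, 0, 0, 0, -2, 0, 0, 0],
     [3, 0, -4, 0, 0, 0, 0, 0, 0, 0, 0, 0, -1, 0, 0, 0]]
    [[-46, 48, -34, -10, 23, 0, 23, 0, 0, -14, -10, -6, -6, 0, 0, 0],
     [48, -48, 34, 10, -24, 0, -24, 0, 0, 14, 10, 6, 6, 0, 0, 0],
     [-34, 34, -24, -7, 17, 0, 17, 0, 0, -10, -7, -4, -4, 0, 0, 0],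
     [-10, 10, -7, -2, 5, 0, 5, 0, 0, -3, -2, -1, -1, 0, 0, 0],
     [23, -24, 17, 5, -10, 2, -11, 1, 0, 7, 5, 3, 3, 0, 0, 0],
     [0, 0, 0, 0, 2, 4, 2, 2, 0, 0, 0, 0, 0, 0, 0, 0],
     [23, -24, 17, 5, -11, 2, -10, 1, 0, 7, 5, 3, 3, 0, 0, 0],
     [0, 0, 0, 0, 1, 2, 1, 2, 0, 0, 0, 0, 0, 0, 0, 0],
     [0, 0, 0, 0, 0, 0, 0, 0, 8, 10, 14, 20, 16, 12, 8, 4],
     [-14, 14, -10, -3, 7, 0, 7, 0, 10, 10, 16, 26, 21, 18, 12, 6],
     [-10, 10, -7, -2, 5, 0, 5, 0, 14, 16, 24, 37, 30, 24, 16, 8],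
     [-6, 6, -4, -1, 3, 0, 3, 0, 20, 26, 37, 56, 46, 36, 24, 12],
     [-6, 6, -4, -1, 3, 0, 3, 0, 16, 21, 30, 46, 38, 30, 20, 10],
     [0, 0, 0, 0, 0, 0, 0, 0, 12, 18, 24, 36, 30, 24, 16, 8],
     [0, 0, 0, 0, 0, 0, 0, 0, 8, 12, 16, 24, 20, 16, 12, 6],
     [0, 0, 0, 0, 0, 0, 0, 0, 4, 6, 8, 12, 10, 8, 6, 4]]
    [-10, 10, -7, -2, 5, 0, 5, 0, 0, -3, -2, -1, -1, 0, 0, 0]"
    by code_simp
qed

lemma achiral_U2_A2_D4_E8: "achiral (gscale 2 U_lat \<oplus>\<^sub>L A2_lat \<oplus>\<^sub>L D4_lat \<oplus>\<^sub>L E8_lat)"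
proof (rule achiral_if_certificate)
  show "E6_2_certificate (gscale 2 U_lat \<oplus>\<^sub>L A2_lat \<oplus>\<^sub>L D4_lat \<oplus>\<^sub>L E8_lat)
    [[1, -2, 2, 1, 1, 0, 1, 1, 0, 0, 0, 0, 0, 0, 0, 0],
     [-2, 1, -2, -1, -2, -2, -2, -1, 0, 0, 0, 0, 0, 0, 0, 0],
     [1, 0, 1, 0, -1, -1, 0, -1, 0, 0, 0, 0, 0, 0, 0, 0],
     [0, 1, -1, 0, 1, 1, 0, 1, 0, 0, 0, 0, 0, 0, 0, 0],
     [-2, 1, -2, 0, -1, 0, 0, -1, 0, 0, 0, 0, 0, 0, 0, 0],
     [1, -1, 1, -1, 1, 1, 1, 1, 0, 0, 0, 0, 0, 0, 0, 0]]
    [[2, -2, -3, 1, -1, -1, 1, 1, 0, 0, 0, 0, 0, 0, 0, 0],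
     [8, -8, -10, 2, -4, 2, -2, 0, 0, 0, 0, 0, 0, 0, 0, 0],
     [8, -6, -9, 2, -4, 1, 0, 0, 0, 0, 0, 0, 0, 0, 0, 0],
     [14, -12, -17, 4, -6, 3, -2, 0, 0, 0, 0, 0, 0, 0, 0, 0],
     [10, -10, -13, 3, -5, 3, -1, -1, 0, 0, 0, 0, 0, 0, 0, 0],
     [4, -4, -5, 0, -2, 1, 0, 0, 0, 0, 0, 0, 0, 0, 0, 0]]
    [[3, -3, -4, 1, -1, 0, 0, 0, 0, 0, 0, 0, 0, 0, 0, 0],
     [0, 0, 0, 0, -1, 0, 0, 1, 0, 0, 0, 0, 0, 0, 0, 0],
     [5, -4, -6, 1, -1, 0, 0, -1, 0, 0, 0, 0, 0, 0, 0, 0],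
     [4, -3, -5, 1, -1, 0, 0, 0, 0, 0, 0, 0, 0, 0, 0, 0],
     [5, -5, -7, 1, 0, 0, 0, -2, 0, 0, 0, 0, 0, 0, 0, 0],
     [3, -3, -4, 0, 0, 0, 0, -1, 0, 0, 0, 0, 0, 0, 0, 0]]
    [[-12, 12, -17, -5, -7, -3, -5, -3, 0, 0, 0, 0, 0, 0, 0, 0],
     [12, -12, 17, 5, 7, 3, 5, 3, 0, 0, 0, 0, 0, 0, 0, 0],
     [-17, 17, -24, -7, -10, -4, -7, -4, 0, 0, 0, 0, 0, 0, 0, 0],
     [-5, 5, -7, -2, -3, -1, -2, -1, 0, 0, 0, 0, 0, 0, 0, 0],
     [-7, 7, -10, -3, -4, -2, -3, -2, 0, 0, 0, 0, 0, 0, 0, 0],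
     [-3, 3, -4, -1, -2, 0, -1, 0, 0, 0, 0, 0, 0, 0, 0, 0],
     [-5, 5, -7, -2, -3, -1, -2, -1, 0, 0, 0, 0, 0, 0, 0, 0],
     [-3, 3, -4, -1, -2, 0, -1, 0, 0, 0, 0, 0, 0, 0, 0, 0],
     [0, 0, 0, 0, 0, 0, 0, 0, 8, 10, 14, 20, 16, 12, 8, 4],
     [0, 0, 0, 0, 0, 0, 0, 0, 10, 16, 20, 30, 24, 18, 12, 6],
     [0, 0, 0, 0, 0, 0, 0, 0, 14, 20, 28, 40, 32, 24, 16, 8],
     [0, 0, 0, 0, 0, 0, 0, 0, 20, 30, 40, 60, 48, 36, 24, 12],
     [0, 0, 0, 0, 0, 0, 0, 0, 16, 24, 32, 48, 40, 30, 20, 10],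
     [0, 0, 0, 0, 0, 0, 0, 0, 12, 18, 24, 36, 30, 24, 16, 8],
     [0, 0, 0, 0, 0, 0, 0, 0, 8, 12, 16, 24, 20, 16, 12, 6],
     [0, 0, 0, 0, 0, 0, 0, 0, 4, 6, 8, 12, 10, 8, 6, 4]]
    [-5, 5, -7, -2, -3, -1, -2, -1, 0, 0, 0, 0, 0, 0, 0, 0]"
    by code_simp
qed

lemma achiral_U_A2_E8_E8: "achiral (U_lat \<oplus>\<^sub>L A2_lat \<oplus>\<^sub>L E8_lat \<oplus>\<^sub>L E8_lat)"
proof (rule achiral_if_certificate)
  show "E6_2_certificate (U_lat \<oplus>\<^sub>L A2_lat \<oplus>\<^sub>L E8_lat \<oplus>\<^sub>L E8_lat)
    [[3, -4, 2, 1, -2, -2, 0, 0, 0, 0, 0, 0, 0, 1, 1, 0, 1, 0, 0, 0],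
     [-3, 2, -2, -1, 1, 1, 0, 0, 0, 0, 0, 0, 0, -2, -2, -2, -1, 0, 0, 0],
     [1, 0, 1, 0, 0, 0, 0, 0, 0, 0, 0, 0, 0, -1, 0, -1, -1, 0, 0, 0],
     [-1, 2, -1, 0, 1, 1, 0, 0, 0, 0, 0, 0, 0, 1, 0, 1, 1, 0, 0, 0],
     [-3, 2, -2, 0, 1, 1, 0, 0, 0, 0, 0, 0, 0, -1, 0, 0, -1, 0, 0, 0],
     [2, -2, 1, -1, -1, -1, 0, 0, 0, 0, 0, 0, 0, 1, 1, 1, 1, 0, 0, 0]]
    [[2, -2, -3, 1, 2, 2, -1, -1, 0, 0, 0, 0, 0, -1, 1, -1, 1, 0, 0, 0],
     [8, -8, -10, 2, 8, 8, -4, -4, 0, 0, 0, 0, 2, -4, -2, 2, 0, 1, 0, 0],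
     [8, -7, -9, 2, 8, 8, -4, -4, 0, 0, 0, 0, 1, -4, 0, 1, 0, 1, 0, 0],
     [14, -13, -17, 4, 14, 14, -7, -7, 0, 0, 0, 0, 2, -6, -2, 3, 0, 1, 0, 0],
     [10, -10, -13, 3, 10, 10, -5, -5, 0, 0, 0, 0, 1, -5, -1, 3, -1, 1, 0, 0],
     [4, -4, -5, 0, 4, 4, -2, -2, 0, 0, 0, 0, 0, -2, 0, 1, 0, 0, 0, 0]]
    [[3, 0, -4, 1, 0, 0, 0, 0, 0, 0, 0, 0, 0, -1, 0, 0, 0, 0, 0, 0],
     [0, 0, 0, 0, 0, 0, 0, 0, 0, 0, 0, 0, 0, -1, 0, 0, 1, 0, 0, 0],
     [5, 0, -6, 1, 1, 0, 0, 0, 0, 0, 0, 0, 0, -1, 0, 0, -1, 0, 0, 0],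
     [4, 0, -5, 1, 1, 0, 0, 0, 0, 0, 0, 0, 0, -1, 0, 0, 0, 0, 0, 0],
     [5, 0, -7, 1, 0, 0, 0, 0, 0, 0, 0, 0, 0, 0, 0, 0, -2, 0, 0, 0],
     [3, 0, -4, 0, 0, 0, 0, 0, 0, 0, 0, 0, 0, 0, 0, 0, -1, 0, 0, 0]]
    [[-46, 48, -34, -10, 23, 23, 0, 0, 0, 0, 0, 0, 0, -14, -10, -6, -6, 0, 0, 0],
     [48, -48, 34, 10, -24, -24, 0, 0, 0, 0, 0, 0, 0, 14, 10, 6, 6, 0, 0, 0],
     [-34, 34, -24, -7, 17, 17, 0, 0, 0, 0, 0, 0, 0, -10, -7, -4, -4, 0, 0, 0],
     [-10, 10, -7, -2, 5, 5, 0, 0, 0, 0, 0, 0, 0, -3, -2, -1, -1, 0, 0, 0],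
     [23, -24, 17, 5, -4, -2, 14, 20, 16, 12, 8, 4, 0, 7, 5, 3, 3, 0, 0, 0],
     [23, -24, 17, 5, -2, 4, 20, 30, 24, 18, 12, 6, 0, 7, 5, 3, 3, 0, 0, 0],
     [0, 0, 0, 0, 14, 20, 28, 40, 32, 24, 16, 8, 0, 0, 0, 0, 0, 0, 0, 0],
     [0, 0, 0, 0, 20, 30, 40, 60, 48, 36, 24, 12, 0, 0, 0, 0, 0, 0, 0, 0],
     [0, 0, 0, 0, 16, 24, 32, 48, 40, 30, 20, 10, 0, 0, 0, 0, 0, 0, 0, 0],
     [0, 0, 0, 0, 12, 18, 24, 36, 30, 24, 16, 8, 0, 0, 0, 0, 0, 0, 0, 0],
     [0, 0, 0, 0, 8, 12, 16, 24, 20, 16, 12, 6, 0, 0, 0, 0, 0, 0, 0, 0],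
     [0, 0, 0, 0, 4, 6, 8, 12, 10, 8, 6, 4, 0, 0, 0, 0, 0, 0, 0, 0],
     [0, 0, 0, 0, 0, 0, 0, 0, 0, 0, 0, 0, 8, 10, 14, 20, 16, 12, 8, 4],
     [-14, 14, -10, -3, 7, 7, 0, 0, 0, 0, 0, 0, 10, 10, 16, 26, 21, 18, 12, 6],
     [-10, 10, -7, -2, 5, 5, 0, 0, 0, 0, 0, 0, 14, 16, 24, 37, 30, 24, 16, 8],
     [-6, 6, -4, -1, 3, 3, 0, 0, 0, 0, 0, 0, 20, 26, 37, 56, 46, 36, 24, 12],
     [-6, 6, -4, -1, 3, 3, 0, 0, 0, 0, 0, 0, 16, 21, 30, 46, 38, 30, 20, 10],
     [0, 0, 0, 0, 0, 0, 0, 0, 0, 0, 0, 0, 12, 18, 24, 36, 30, 24, 16, 8],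
     [0, 0, 0, 0, 0, 0, 0, 0, 0, 0, 0, 0, 8, 12, 16, 24, 20, 16, 12, 6],
     [0, 0, 0, 0, 0, 0, 0, 0, 0, 0, 0, 0, 4, 6, 8, 12, 10, 8, 6, 4]]
    [-10, 10, -7, -2, 5, 5, 0, 0, 0, 0, 0, 0, 0, -3, -2, -1, -1, 0, 0, 0]"
    by code_simp
qed

lemma achiral_U2_A2_E8_E8: "achiral (gscale 2 U_lat \<oplus>\<^sub>L A2_lat \<oplus>\<^sub>L E8_lat \<oplus>\<^sub>L E8_lat)"
proof (rule achiral_if_certificate)
  show "E6_2_certificate (gscale 2 U_lat \<oplus>\<^sub>L A2_lat \<oplus>\<^sub>L E8_lat \<oplus>\<^sub>L E8_lat)
    [[1, -2, 2, 1, 0, 1, 1, 0, 1, 0, 0, 0, 0, 0, 0, 0, 0, 0, 0, 0],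
     [-2, 1, -2, -1, 0, -2, -2, -2, -1, 0, 0, 0, 0, 0, 0, 0, 0, 0, 0, 0],
     [1, 0, 1, 0, 0, -1, 0, -1, -1, 0, 0, 0, 0, 0, 0, 0, 0, 0, 0, 0],
     [0, 1, -1, 0, 0, 1, 0, 1, 1, 0, 0, 0, 0, 0, 0, 0, 0, 0, 0, 0],
     [-2, 1, -2, 0, 0, -1, 0, 0, -1, 0, 0, 0, 0, 0, 0, 0, 0, 0, 0, 0],
     [1, -1, 1, -1, 0, 1, 1, 1, 1, 0, 0, 0, 0, 0, 0, 0, 0, 0, 0, 0]]
    [[2, -2, -3, 1, 0, -1, 1, -1, 1, 0, 0, 0, 0, 0, 0, 0, 0, 0, 0, 0],
     [8, -8, -10, 2, 2, -4, -2, 2, 0, 1, 0, 0, 0, 0, 0, 0, 0, 0, 0, 0],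
     [8, -6, -9, 2, 1, -4, 0, 1, 0, 1, 0, 0, 0, 0, 0, 0, 0, 0, 0, 0],
     [14, -12, -17, 4, 2, -6, -2, 3, 0, 1, 0, 0, 0, 0, 0, 0, 0, 0, 0, 0],
     [10, -10, -13, 3, 1, -5, -1, 3, -1, 1, 0, 0, 0, 0, 0, 0, 0, 0, 0, 0],
     [4, -4, -5, 0, 0, -2, 0, 1, 0, 0, 0, 0, 0, 0, 0, 0, 0, 0, 0, 0]]
    [[3, -3, -4, 1, 0, -1, 0, 0, 0, 0, 0, 0, 0, 0, 0, 0, 0, 0, 0, 0],
     [0, 0, 0, 0, 0, -1, 0, 0, 1, 0, 0, 0, 0, 0, 0, 0, 0, 0, 0, 0],
     [5, -4, -6, 1, 0, -1, 0, 0, -1, 0, 0, 0, 0, 0, 0, 0, 0, 0, 0, 0],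
     [4, -3, -5, 1, 0, -1, 0, 0, 0, 0, 0, 0, 0, 0, 0, 0, 0, 0, 0, 0],
     [5, -5, -7, 1, 0, 0, 0, 0, -2, 0, 0, 0, 0, 0, 0, 0, 0, 0, 0, 0],
     [3, -3, -4, 0, 0, 0, 0, 0, -1, 0, 0, 0, 0, 0, 0, 0, 0, 0, 0, 0]]
    [[-12, 12, -17, -5, 0, -7, -5, -3, -3, 0, 0, 0, 0, 0, 0, 0, 0, 0, 0, 0],
     [12, -12, 17, 5, 0, 7, 5, 3, 3, 0, 0, 0, 0, 0, 0, 0, 0, 0, 0, 0],
     [-17, 17, -24, -7, 0, -10, -7, -4, -4, 0, 0, 0, 0, 0, 0, 0, 0, 0, 0, 0],
     [-5, 5, -7, -2, 0, -3, -2, -1, -1, 0, 0, 0, 0, 0, 0, 0, 0, 0, 0, 0],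
     [0, 0, 0, 0, 8, 10, 14, 20, 16, 12, 8, 4, 0, 0, 0, 0, 0, 0, 0, 0],
     [-7, 7, -10, -3, 10, 10, 16, 26, 21, 18, 12, 6, 0, 0, 0, 0, 0, 0, 0, 0],
     [-5, 5, -7, -2, 14, 16, 24, 37, 30, 24, 16, 8, 0, 0, 0, 0, 0, 0, 0, 0],
     [-3, 3, -4, -1, 20, 26, 37, 56, 46, 36, 24, 12, 0, 0, 0, 0, 0, 0, 0, 0],
     [-3, 3, -4, -1, 16, 21, 30, 46, 38, 30, 20, 10, 0, 0, 0, 0, 0, 0, 0, 0],
     [0, 0, 0, 0, 12, 18, 24, 36, 30, 24, 16, 8, 0, 0, 0, 0, 0, 0, 0, 0],
     [0, 0, 0, 0, 8, 12, 16, 24, 20, 16, 12, 6, 0, 0, 0, 0, 0, 0, 0, 0],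
     [0, 0, 0, 0, 4, 6, 8, 12, 10, 8, 6, 4, 0, 0, 0, 0, 0, 0, 0, 0],
     [0, 0, 0, 0, 0, 0, 0, 0, 0, 0, 0, 0, 8, 10, 14, 20, 16, 12, 8, 4],
     [0, 0, 0, 0, 0, 0, 0, 0, 0, 0, 0, 0, 10, 16, 20, 30, 24, 18, 12, 6],
     [0, 0, 0, 0, 0, 0, 0, 0, 0, 0, 0, 0, 14, 20, 28, 40, 32, 24, 16, 8],
     [0, 0, 0, 0, 0, 0, 0, 0, 0, 0, 0, 0, 20, 30, 40, 60, 48, 36, 24, 12],
     [0, 0, 0, 0, 0, 0, 0, 0, 0, 0, 0, 0, 16, 24, 32, 48, 40, 30, 20, 10],
     [0, 0, 0, 0, 0, 0, 0, 0, 0, 0, 0, 0, 12, 18, 24, 36, 30, 24, 16, 8],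
     [0, 0, 0, 0, 0, 0, 0, 0, 0, 0, 0, 0, 8, 12, 16, 24, 20, 16, 12, 6],
     [0, 0, 0, 0, 0, 0, 0, 0, 0, 0, 0, 0, 4, 6, 8, 12, 10, 8, 6, 4]]
    [-5, 5, -7, -2, 0, -3, -2, -1, -1, 0, 0, 0, 0, 0, 0, 0, 0, 0, 0, 0]"
    by code_simp
qed

section \<open>Lorentzian forms and lattice isometries\<close>

text \<open>Signature \<open>(n, 1)\<close> is expressed by one negative vector with positive
  definite complement. \<open>dual_basis\<close> represents each coordinate as a product with a
  fixed vector, so bounds on products bound coordinates.\<close>

locale lorentz_gram = sym_gram +
  fixes t :: "nat \<Rightarrow> real"
  assumes t_ambient: "t \<in> ambient G" and t_neg: "bform G t t < 0"
    and t_perp_pos: "z \<in> ambient G \<Longrightarrow> bform G z t = 0 \<Longrightarrow> z \<noteq> (\<lambda>i. 0) \<Longrightarrow> bform G z z > 0"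
    and dual_basis: "i < gdim G \<Longrightarrow> \<exists>y\<in>ambient G. \<forall>q\<in>ambient G. bform G y q = q i"
begin

text \<open>Definiteness is transported from the complement of \<open>t\<close> to that of any
  negative \<open>x\<close>: if \<open>z\<close> had nonpositive norm, the combination
  \<open>w\<close> of \<open>x\<close> and \<open>z\<close> orthogonal to \<open>t\<close> would
  too, hence vanish.\<close>

lemma perp_pos:
  assumes x: "x \<in> ambient G" "bform G x x < 0"
    and z: "z \<in> ambient G" "bform G z x = 0" "z \<noteq> (\<lambda>i. 0)"
  shows "bform G z z > 0"
proof (rule ccontr)
  assume "\<not> bform G z z > 0"
  then have zz: "bform G z z \<le> 0" by simp
  define a b where "a = bform G z t" and "b = - bform G x t"
  define w where "w = (\<lambda>i. a * x i + b * z i)"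
  have wA: "w \<in> ambient G" using x z by (simp add: w_def ambient_def)
  have "bform G w t = 0" by (simp add: w_def bform_linear a_def b_def)
  moreover have "bform G w w = a\<^sup>2 * bform G x x + b\<^sup>2 * bform G z z"
    unfolding w_def by (simp only: bform_linear) (use z(2) bform_sym[of x z] in \<open>simp add: power2_eq_square algebra_simps\<close>)
  moreover have "a\<^sup>2 * bform G x x \<le> 0" "b\<^sup>2 * bform G z z \<le> 0"
    using x zz by (simp_all add: mult_le_0_iff)
  ultimately have w0: "w = (\<lambda>i. 0)" using t_perp_pos[OF wA] by force
  have "bform G x t \<noteq> 0"
    using t_perp_pos[OF x(1)] x(2) by (force simp: bform_def)
  moreover have "bform G w x = a * bform G x x"
    using z(2) by (simp add: w_def bform_linear)
  then have "a = 0" using w0 x(2) by (auto simp: bform_def)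
  ultimately have "z = (\<lambda>i. 0)" using w0 by (auto simp: w_def b_def fun_eq_iff)
  then show False using z(3) by simp
qed

lemma perp_nonneg:
  assumes "x \<in> ambient G" "bform G x x < 0" "z \<in> ambient G" "bform G z x = 0"
  shows "bform G z z \<ge> 0"
  using perp_pos[OF assms] by (cases "z = (\<lambda>i. 0)") (auto simp: bform_def)

lemma neg_bform_nz:
  assumes "x \<in> ambient G" "bform G x x < 0" "y \<in> ambient G" "bform G y y < 0"
  shows "bform G x y \<noteq> 0"
  using perp_nonneg[OF assms(3,4,1)] assms(2) by auto

text \<open>If \<open>x\<close> separated \<open>a\<close> from \<open>b\<close>, a positive
  combination of them would be orthogonal to \<open>x\<close>, hence of nonnegative norm; but a
  negative product \<open>bform G a b\<close> keeps the norm of every such combination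
  negative.\<close>

lemma same_half:
  assumes x: "x \<in> ambient G" "bform G x x < 0"
    and a: "a \<in> ambient G" "bform G a a < 0" and b: "b \<in> ambient G" "bform G b b < 0"
    and ab: "bform G a b < 0"
  shows "bform G x a * bform G x b > 0"
proof (rule ccontr)
  assume "\<not> ?thesis"
  moreover have nz: "bform G x a \<noteq> 0" "bform G x b \<noteq> 0" using neg_bform_nz x a b by auto
  ultimately have opp: "bform G x a * bform G x b < 0"
    by (meson mult_eq_0_iff not_less_iff_gr_or_eq)
  define l m where "l = \<bar>bform G x b\<bar>" and "m = \<bar>bform G x a\<bar>"
  have pos: "l > 0" "m > 0" using nz by (simp_all add: l_def m_def)
  define c where "c = (\<lambda>i. l * a i + m * b i)"
  have cA: "c \<in> ambient G" using a b by (simp add: c_def ambient_def)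
  have "bform G c x = l * bform G x a + m * bform G x b"
    by (simp add: c_def bform_linear bform_sym)
  also have "\<dots> = 0" using opp by (auto simp: l_def m_def abs_if mult_less_0_iff)
  finally have "bform G c c \<ge> 0" by (rule perp_nonneg[OF x cA])
  moreover have "bform G c c = l\<^sup>2 * bform G a a + m\<^sup>2 * bform G b b + 2 * l * m * bform G a b"
    unfolding c_def by (simp only: bform_linear) (simp add: bform_sym[of b a] power2_eq_square algebra_simps)
  moreover have "l\<^sup>2 * bform G a a < 0" "m\<^sup>2 * bform G b b < 0" "2 * l * m * bform G a b < 0"
    using pos a b ab by (simp_all add: mult_less_0_iff)
  ultimately show False by linarith
qed

lemma perp_Cauchy_Schwarz:
  assumes x: "x \<in> ambient G" "bform G x x < 0"
    and u: "u \<in> ambient G" "bform G u x = 0" and v: "v \<in> ambient G" "bform G v x = 0"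
  shows "(bform G u v)\<^sup>2 \<le> bform G u u * bform G v v"
proof (cases "v = (\<lambda>i. 0)")
  case True
  then show ?thesis by (simp add: bform_def)
next
  case False
  then have vv: "bform G v v > 0" using perp_pos[OF x v] by simp
  define w where "w = (\<lambda>i. bform G v v * u i - bform G u v * v i)"
  have "w \<in> ambient G" using u v by (simp add: w_def ambient_def)
  moreover have "bform G w x = 0" using u v by (simp add: w_def bform_linear)
  ultimately have "0 \<le> bform G w w" by (rule perp_nonneg[OF x])
  also have "bform G w w = bform G v v * (bform G u u * bform G v v - (bform G u v)\<^sup>2)"
    unfolding w_def by (simp only: bform_linear) (simp add: bform_sym[of v u] power2_eq_square algebra_simps)
  finally show ?thesis using vv by (simp add: zero_le_mult_iff)
qed

text \<open>\<open>pr\<close> projects to the complement of \<open>x\<close>, where the form is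
  positive definite. Cauchy-Schwarz applies there, and the norm of \<open>pr q\<close> is at most
  \<open>N + b^2 / X\<close>.\<close>

lemma bform_bounded:
  assumes x: "x \<in> ambient G" "bform G x x < 0" and y: "y \<in> ambient G"
  shows "\<exists>K. \<forall>q\<in>ambient G. bform G q q = N \<and> \<bar>bform G x q\<bar> \<le> b \<longrightarrow> \<bar>bform G y q\<bar> \<le> K"
proof -
  define X where "X = - bform G x x"
  have X: "X > 0" using x by (simp add: X_def)
  define pr where "pr = (\<lambda>v i. v i + bform G x v / X * x i)"
  have prA: "pr v \<in> ambient G" if "v \<in> ambient G" for v
    using that x by (simp add: pr_def ambient_def)
  have prx: "bform G (pr v) x = 0" for v
    unfolding pr_def by (simp only: bform_linear) (use x bform_sym[of v x] in \<open>simp add: X_def\<close>)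
  have prpr: "bform G (pr u) (pr v) = bform G u v + bform G x u * bform G x v / X" for u v
  proof -
    have "bform G (pr u) (pr v) = bform G (pr u) (\<lambda>i. v i + bform G x v / X * x i)"
      by (simp add: pr_def)
    also have "\<dots> = bform G (pr u) v" by (simp only: bform_linear prx mult_zero_right add_0_right)
    also have "\<dots> = bform G (\<lambda>i. u i + bform G x u / X * x i) v" by (simp add: pr_def)
    also have "\<dots> = bform G u v + bform G x u * bform G x v / X" by (simp only: bform_linear) simp
    finally show ?thesis .
  qed
  define K where "K = b * \<bar>bform G x y\<bar> / X + sqrt (bform G (pr y) (pr y) * (N + b\<^sup>2 / X))"
  have "\<bar>bform G y q\<bar> \<le> K" if q: "q \<in> ambient G" "bform G q q = N" "\<bar>bform G x q\<bar> \<le> b" for q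
  proof -
    have "(bform G (pr y) (pr q))\<^sup>2 \<le> bform G (pr y) (pr y) * bform G (pr q) (pr q)"
      by (rule perp_Cauchy_Schwarz[OF x prA[OF y] prx prA[OF q(1)] prx])
    also have "\<dots> \<le> bform G (pr y) (pr y) * (N + b\<^sup>2 / X)"
    proof (rule mult_left_mono)
      have "(bform G x q)\<^sup>2 \<le> b\<^sup>2" using q(3) abs_ge_zero power2_abs power_mono by metis
      then show "bform G (pr q) (pr q) \<le> N + b\<^sup>2 / X"
        using X q(2) by (simp add: prpr divide_right_mono flip: power2_eq_square)
    qed (rule perp_nonneg[OF x prA[OF y] prx])
    finally have "\<bar>bform G (pr y) (pr q)\<bar> \<le> sqrt (bform G (pr y) (pr y) * (N + b\<^sup>2 / X))"
      using real_le_rsqrt by (metis power2_abs)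
    moreover have "bform G y q = bform G (pr y) (pr q) - bform G x y * bform G x q / X"
      by (simp add: prpr)
    moreover have "\<bar>bform G x y * bform G x q / X\<bar> \<le> b * \<bar>bform G x y\<bar> / X"
      using q(3) X by (simp add: abs_mult divide_right_mono mult_right_mono mult.commute)
    ultimately show ?thesis unfolding K_def by linarith
  qed
  then show ?thesis by blast
qed

lemma finite_bounded_latt: "finite {q \<in> latt G. \<forall>i<gdim G. \<bar>q i\<bar> \<le> K}"
proof -
  let ?S = "{l :: int list. set l \<subseteq> {-\<lceil>K\<rceil>..\<lceil>K\<rceil>} \<and> length l = gdim G}"
  have "{q \<in> latt G. \<forall>i<gdim G. \<bar>q i\<bar> \<le> K}
      \<subseteq> (\<lambda>l i. if i < gdim G then of_int (l ! i) else 0) ` ?S"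
  proof
    fix q assume q: "q \<in> {q \<in> latt G. \<forall>i<gdim G. \<bar>q i\<bar> \<le> K}"
    let ?l = "map (\<lambda>i. \<lfloor>q i\<rfloor>) [0..<gdim G]"
    have "q = (\<lambda>i. if i < gdim G then of_int (?l ! i) else 0)"
      using q by (auto simp: latt_def ambient_def fun_eq_iff elim!: Ints_cases)
    moreover have "?l \<in> ?S"
    proof -
      have "- \<lceil>K\<rceil> \<le> \<lfloor>q i\<rfloor>" "\<lfloor>q i\<rfloor> \<le> \<lceil>K\<rceil>" if "i < gdim G" for i
      proof -
        have "\<bar>q i\<bar> \<le> K" "q i \<in> \<int>" using q that by (auto simp: latt_def)
        then show "- \<lceil>K\<rceil> \<le> \<lfloor>q i\<rfloor>" "\<lfloor>q i\<rfloor> \<le> \<lceil>K\<rceil>" by (auto elim!: Ints_cases) linarith+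
      qed
      then show ?thesis by auto
    qed
    ultimately show "q \<in> (\<lambda>l i. if i < gdim G then of_int (l ! i) else 0) ` ?S" by blast
  qed
  moreover have "finite ?S" by (rule finite_lists_length_eq) simp
  ultimately show ?thesis by (meson finite_imageI finite_subset)
qed

text \<open>This local finiteness is what lets a minimum over an orbit of lattice vectors be
  attained in \<open>exists_chamber_isom\<close>.\<close>

lemma finite_latt_norm:
  assumes x: "x \<in> ambient G" "bform G x x < 0"
  shows "finite {q \<in> latt G. bform G q q = N \<and> \<bar>bform G x q\<bar> \<le> b}"
proof -
  have "\<exists>K. i < gdim G \<longrightarrow> (\<forall>q\<in>ambient G. bform G q q = N \<and> \<bar>bform G x q\<bar> \<le> b \<longrightarrow> \<bar>q i\<bar> \<le> K)" for i
    using dual_basis[of i] bform_bounded[OF x, of _ N b] by metis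
  then obtain K where K: "\<And>i q. i < gdim G \<Longrightarrow> q \<in> ambient G \<Longrightarrow> bform G q q = N \<Longrightarrow>
      \<bar>bform G x q\<bar> \<le> b \<Longrightarrow> \<bar>q i\<bar> \<le> K i" by metis
  have "\<bar>q i\<bar> \<le> (\<Sum>j<gdim G. \<bar>K j\<bar>)"
    if "i < gdim G" "q \<in> ambient G" "bform G q q = N" "\<bar>bform G x q\<bar> \<le> b" for i q
    using K[OF that] member_le_sum[of i "{..<gdim G}" "\<lambda>j. \<bar>K j\<bar>"] that(1) by force
  then have "{q \<in> latt G. bform G q q = N \<and> \<bar>bform G x q\<bar> \<le> b}
      \<subseteq> {q \<in> latt G. \<forall>i<gdim G. \<bar>q i\<bar> \<le> (\<Sum>j<gdim G. \<bar>K j\<bar>)}"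
    using latt_ambient by blast
  then show ?thesis using finite_bounded_latt finite_subset by blast
qed

end

text \<open>Isometries are maps rather than matrices, so that reflections and compositions can be
  used directly beside \<open>mact G M\<close>.\<close>

definition lat_isom :: "gram \<Rightarrow> ((nat \<Rightarrow> real) \<Rightarrow> (nat \<Rightarrow> real)) \<Rightarrow> bool" where
  "lat_isom G w \<longleftrightarrow> (\<forall>x\<in>ambient G. w x \<in> ambient G) \<and>
     (\<forall>a b x y. w (\<lambda>i. a * x i + b * y i) = (\<lambda>i. a * w x i + b * w y i)) \<and>
     (\<forall>x\<in>ambient G. \<forall>y\<in>ambient G. bform G (w x) (w y) = bform G x y) \<and> w ` latt G = latt G"

lemma
  assumes "lat_isom G w"
  shows lat_isom_ambient: "x \<in> ambient G \<Longrightarrow> w x \<in> ambient G"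
    and lat_isom_linear: "w (\<lambda>i. a * x i + b * y i) = (\<lambda>i. a * w x i + b * w y i)"
    and lat_isom_bform: "x \<in> ambient G \<Longrightarrow> y \<in> ambient G \<Longrightarrow> bform G (w x) (w y) = bform G x y"
    and lat_isom_latt: "x \<in> latt G \<Longrightarrow> w x \<in> latt G"
    and lat_isom_surj: "x \<in> latt G \<Longrightarrow> \<exists>z\<in>latt G. w z = x"
proof -
  show "\<exists>z\<in>latt G. w z = x" if "x \<in> latt G"
  proof -
    have "x \<in> w ` latt G" using that assms by (simp add: lat_isom_def)
    then show ?thesis by blast
  qed
qed (use assms in \<open>auto simp: lat_isom_def\<close>)

lemma lat_isom_scale: "lat_isom G w \<Longrightarrow> w (\<lambda>i. a * x i) = (\<lambda>i. a * w x i)"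
  using lat_isom_linear[of G w a x 0 x] by simp

lemma lat_isom_sum:
  assumes "lat_isom G w" "finite A"
  shows "w (\<lambda>i. \<Sum>k\<in>A. n k * f k i) = (\<lambda>i. \<Sum>k\<in>A. n k * w (f k) i)"
  using assms(2)
proof (induction A rule: finite_induct)
  case empty
  then show ?case using lat_isom_scale[OF assms(1), of 0 "\<lambda>i. 0"] by simp
next
  case (insert k A)
  have "w (\<lambda>i. n k * f k i + 1 * (\<Sum>k\<in>A. n k * f k i))
      = (\<lambda>i. n k * w (f k) i + 1 * w (\<lambda>i. \<Sum>k\<in>A. n k * f k i) i)"
    by (rule lat_isom_linear[OF assms(1)])
  then show ?case using insert by simp
qed

lemma lat_isom_id: "lat_isom G (\<lambda>x. x)"
  by (simp add: lat_isom_def)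

lemma lat_isom_comp: "lat_isom G v \<Longrightarrow> lat_isom G w \<Longrightarrow> lat_isom G (\<lambda>x. v (w x))"
  unfolding lat_isom_def by (auto simp flip: image_image)

text \<open>\<open>is_aut\<close> constrains the matrix on lattice vectors only; expansion in the
  basis extends invariance of the form to real vectors.\<close>

lemma lat_isom_mact:
  assumes "is_aut G M"
  shows "lat_isom G (mact G M)"
proof -
  let ?w = "mact G M"
  have exp: "?w x = (\<lambda>i. \<Sum>j<gdim G. x j * ?w (uvec j) i)" for x
    by (auto simp: mact_def uvec_def fun_eq_iff if_distrib mult.commute cong: if_cong intro!: sum.cong)
  have "bform G (?w x) (?w y) = bform G x y" if "x \<in> ambient G" "y \<in> ambient G" for x y
  proof -
    have "bform G (?w x) (?w y)
        = (\<Sum>i<gdim G. \<Sum>j<gdim G. x i * y j * bform G (?w (uvec i)) (?w (uvec j)))"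
      by (subst exp, subst exp[of y])
        (simp add: bform_sum_left bform_sum_right bform_scale_left bform_scale_right sum_distrib_left mult_ac)
    also have "\<dots> = (\<Sum>i<gdim G. \<Sum>j<gdim G. x i * of_int (gent G i j) * y j)"
    proof (intro sum.cong refl)
      fix i j assume "i \<in> {..<gdim G}" "j \<in> {..<gdim G}"
      then have ij: "i < gdim G" "j < gdim G" by auto
      then have "bform G (?w (uvec i)) (?w (uvec j)) = bform G (uvec i) (uvec j)"
        using assms uvec_latt by (auto simp: is_aut_def)
      also have "\<dots> = of_int (gent G i j)"
        using ij by (simp add: bform_uvec_left) (simp add: uvec_def if_distrib cong: if_cong)
      finally show "x i * y j * bform G (?w (uvec i)) (?w (uvec j)) = x i * of_int (gent G i j) * y j"
        by simp
    qed
    finally show ?thesis by (simp add: bform_def)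
  qed
  then show ?thesis
    using assms by (simp add: lat_isom_def mact_ambient mact_linear is_aut_def bij_betw_def)
qed

lemma wroot_latt: "wroot G v \<Longrightarrow> v \<in> latt G"
  by (auto simp: wroot_def root2_def root6_def)

lemma wroot_lat_isom_iff:
  assumes w: "lat_isom G w" and v: "v \<in> latt G"
  shows "wroot G (w v) \<longleftrightarrow> wroot G v"
proof -
  have "(\<forall>u\<in>latt G. bform G (w v) u / 3 \<in> \<int>) \<longleftrightarrow> (\<forall>u\<in>latt G. bform G v u / 3 \<in> \<int>)"
    using lat_isom_bform[OF w] lat_isom_latt[OF w] lat_isom_surj[OF w] latt_ambient v by metis
  then show ?thesis using v
    by (simp add: wroot_def root2_def root6_def lat_isom_latt[OF w] lat_isom_bform[OF w] latt_ambient)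
qed

definition refl_in :: "gram \<Rightarrow> (nat \<Rightarrow> real) \<Rightarrow> (nat \<Rightarrow> real) \<Rightarrow> (nat \<Rightarrow> real)" where
  "refl_in G e x = (\<lambda>i. x i - 2 * bform G e x / bform G e e * e i)"

text \<open>The reflection coefficient is an integer: for norm 2 at once, for norm 6 because the
  products of a 6-root with the lattice are divisible by 3.\<close>

lemma (in sym_gram) lat_isom_refl:
  assumes e: "wroot G e"
  shows "lat_isom G (refl_in G e)"
proof -
  have eA: "e \<in> ambient G" and el: "e \<in> latt G" and pos: "bform G e e > 0"
    using e by (auto simp: wroot_def root2_def root6_def latt_ambient)
  have inv: "refl_in G e (refl_in G e x) = x" for x
  proof -
    have "bform G e (refl_in G e x) = - bform G e x"
      unfolding refl_in_def by (simp only: bform_linear) (use pos in simp)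
    then show ?thesis by (simp add: refl_in_def[of G e "refl_in G e x"]) (simp add: refl_in_def)
  qed
  have latt: "refl_in G e x \<in> latt G" if x: "x \<in> latt G" for x
  proof -
    have "2 * bform G e x / bform G e e \<in> \<int>"
      using e x bform_latt_Ints[OF el x] by (auto simp: wroot_def root2_def root6_def)
    then show ?thesis unfolding refl_in_def by (intro latt_closed(2)[OF x] latt_closed(3)[OF el el])
  qed
  have "refl_in G e ` latt G = latt G"
  proof
    show "latt G \<subseteq> refl_in G e ` latt G"
    proof
      fix x assume "x \<in> latt G"
      then show "x \<in> refl_in G e ` latt G" using latt by (intro image_eqI[of _ _ "refl_in G e x"]) (simp_all add: inv)
    qed
  qed (use latt in blast)
  moreover have "bform G (refl_in G e x) (refl_in G e y) = bform G x y" for x y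
  proof -
    define l n where "l = 2 * bform G e x / bform G e e" and "n = 2 * bform G e y / bform G e e"
    have ln: "l * bform G e e = 2 * bform G e x" "n * bform G e e = 2 * bform G e y"
      using pos by (simp_all add: l_def n_def)
    have "bform G (refl_in G e x) (refl_in G e y) = bform G (\<lambda>i. x i - l * e i) (\<lambda>i. y i - n * e i)"
      by (simp add: refl_in_def l_def n_def)
    also have "\<dots> = bform G x y - n * bform G e x - l * bform G e y + l * (n * bform G e e)"
      by (simp only: bform_linear) (simp add: bform_sym[of x e] algebra_simps)
    also have "n * bform G e x = n * (l * bform G e e) / 2" by (simp add: ln)
    also have "l * bform G e y = l * (n * bform G e e) / 2" by (simp add: ln)
    finally show ?thesis by simp
  qed
  moreover have "refl_in G e (\<lambda>i. a * x i + b * y i) = (\<lambda>i. a * refl_in G e x i + b * refl_in G e y i)" for a b x y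
    unfolding refl_in_def by (simp only: bform_linear) (simp add: fun_eq_iff add_divide_distrib algebra_simps)
  moreover have "refl_in G e x \<in> ambient G" if "x \<in> ambient G" for x
    using that eA by (simp add: refl_in_def ambient_def)
  ultimately show ?thesis by (simp add: lat_isom_def)
qed

section \<open>Chirality from a system of simple roots\<close>

text \<open>\<open>E 0\<close> is the only simple 6-root; the functional \<open>y\<close> exposes it as an extremal ray of the cone
  spanned by the simple roots.\<close>

locale simple_roots = lorentz_gram +
  fixes E :: "nat \<Rightarrow> nat \<Rightarrow> real" and m :: nat and p y :: "nat \<Rightarrow> real"
  assumes m_pos: "0 < m" and root6_0: "root6 G (E 0)"
    and root2_E: "0 < k \<Longrightarrow> k < m \<Longrightarrow> root2 G (E k)"
    and unit_coord: "\<exists>i<gdim G. E 0 i = 1"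
    and p_latt: "p \<in> latt G" and p_neg: "bform G p p < 0"
    and p_E: "k < m \<Longrightarrow> bform G p (E k) > 0"
    and y_ambient: "y \<in> ambient G" and y_0: "bform G y (E 0) = 0"
    and y_E: "0 < k \<Longrightarrow> k < m \<Longrightarrow> bform G y (E k) > 0"
    and wroot_cone: "wroot G r \<Longrightarrow> \<exists>n. (\<forall>k<m. n k \<ge> 0) \<and>
       (r = (\<lambda>i. \<Sum>k<m. n k * E k i) \<or> r = (\<lambda>i. - (\<Sum>k<m. n k * E k i)))"
begin

lemma wroot_E: "k < m \<Longrightarrow> wroot G (E k)"
  using root6_0 root2_E by (cases "k = 0") (auto simp: wroot_def)

lemma E_ambient: "k < m \<Longrightarrow> E k \<in> ambient G"
  using wroot_E wroot_latt latt_ambient by blast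

text \<open>Among the images of \<open>p\<close> under isometries let \<open>q = w p\<close> have
  the least absolute product with \<open>x\<close>, that is, be closest to \<open>x\<close>.
  Reflecting \<open>q\<close> in \<open>w (E k)\<close> changes this product by a multiple of
  \<open>bform G x (w (E k))\<close> without changing its sign; minimality then determines the sign
  of the latter. The factor \<open>s\<close> records which half of the cone contains
  \<open>x\<close>.\<close>

lemma exists_chamber_isom:
  assumes x: "x \<in> open_cone_part G"
  shows "\<exists>w s. lat_isom G w \<and> (s = 1 \<or> s = -1) \<and> (\<forall>k<m. s * bform G x (w (E k)) > 0)"
proof -
  have xA: "x \<in> ambient G" and xneg: "bform G x x < 0"
    and xroot: "\<And>v. wroot G v \<Longrightarrow> bform G x v \<noteq> 0"
    using x bform_sym by (auto simp: open_cone_part_def)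
  \<comment> \<open>The bound by the value at \<open>p\<close> makes the set finite; images of
    \<open>p\<close> outside it are farther away than \<open>p\<close> itself.\<close>
  define A where "A = {q \<in> latt G. (bform G q q = bform G p p \<and> \<bar>bform G x q\<bar> \<le> \<bar>bform G x p\<bar>) \<and>
     (\<exists>w. lat_isom G w \<and> q = w p)}"
  have pA: "p \<in> ambient G" using p_latt latt_ambient by blast
  have "finite A"
    unfolding A_def by (rule finite_subset[OF _ finite_latt_norm[OF xA xneg]]) auto
  moreover have pinA: "p \<in> A" using p_latt lat_isom_id by (auto simp: A_def)
  ultimately have "\<exists>q\<in>A. \<forall>q'\<in>A. \<bar>bform G x q\<bar> \<le> \<bar>bform G x q'\<bar>"
    using ex_min_if_finite[of "(\<lambda>q. \<bar>bform G x q\<bar>) ` A"] by (force simp: not_less)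
  then obtain q where q: "q \<in> A" and qmin: "\<And>q'. q' \<in> A \<Longrightarrow> \<bar>bform G x q\<bar> \<le> \<bar>bform G x q'\<bar>" by blast
  obtain w where w: "lat_isom G w" and qw: "q = w p" using q by (auto simp: A_def)
  have wmin: "\<bar>bform G x q\<bar> \<le> \<bar>bform G x (v p)\<bar>" if v: "lat_isom G v" for v
  proof (cases "\<bar>bform G x (v p)\<bar> \<le> \<bar>bform G x p\<bar>")
    case True
    then have "v p \<in> A" using v p_latt pA by (auto simp: A_def lat_isom_latt lat_isom_bform)
    then show ?thesis by (rule qmin)
  next
    case False
    then show ?thesis using qmin[OF pinA] by linarith
  qed
  have qA: "q \<in> ambient G" and qneg: "bform G q q < 0"
    using lat_isom_ambient[OF w pA] lat_isom_bform[OF w pA pA] p_neg qw by auto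
  define s where "s = - sgn (bform G x q)"
  have xq: "bform G x q \<noteq> 0" by (rule neg_bform_nz[OF xA xneg qA qneg])
  have "s * bform G x (w (E k)) > 0" if k: "k < m" for k
  proof -
    define l where "l = 2 * bform G (E k) p / bform G (E k) (E k)"
    have l: "l > 0"
      using p_E[OF k] wroot_E[OF k] by (auto simp: l_def bform_sym[of "E k" p] wroot_def root2_def root6_def)
    define v where "v = (\<lambda>z. w (refl_in G (E k) z))"
    have v: "lat_isom G v"
      unfolding v_def by (rule lat_isom_comp[OF w lat_isom_refl[OF wroot_E[OF k]]])
    have ref: "refl_in G (E k) p = (\<lambda>i. 1 * p i + (-l) * E k i)"
      by (simp add: refl_in_def l_def)
    then have vp: "v p = (\<lambda>i. 1 * q i + (-l) * w (E k) i)"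
      by (simp only: v_def qw lat_isom_linear[OF w])
    have xv: "bform G x (v p) = bform G x q - l * bform G x (w (E k))"
      by (simp add: vp bform_linear)
    have vA: "v p \<in> ambient G" "bform G (v p) (v p) < 0"
      using lat_isom_ambient[OF v pA] lat_isom_bform[OF v pA pA] p_neg by auto
    have "bform G q (v p) = bform G p (refl_in G (E k) p)"
      unfolding qw v_def using lat_isom_bform[OF w pA] lat_isom_ambient[OF lat_isom_refl[OF wroot_E[OF k]] pA] by blast
    also have "\<dots> = bform G p p - l * bform G p (E k)"
      by (simp add: ref bform_linear)
    also have "\<dots> < 0" using p_neg l p_E[OF k] by (smt (verit) mult_pos_pos)
    finally have same: "bform G x q * bform G x (v p) > 0"
      by (rule same_half[OF xA xneg qA qneg vA])
    have nz: "bform G x (w (E k)) \<noteq> 0"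
      using xroot wroot_lat_isom_iff[OF w wroot_latt[OF wroot_E[OF k]]] wroot_E[OF k] by blast
    show ?thesis
    proof (cases "bform G x q < 0")
      case True
      then have "bform G x (v p) < 0" using same by (simp add: zero_less_mult_iff)
      then have "l * bform G x (w (E k)) \<ge> 0" using wmin[OF v] True xv by linarith
      then show ?thesis using True l nz by (simp add: s_def zero_le_mult_iff)
    next
      case False
      then have pos: "bform G x q > 0" using xq by simp
      then have "bform G x (v p) > 0" using same by (simp add: zero_less_mult_iff)
      then have "l * bform G x (w (E k)) \<le> 0" using wmin[OF v] pos xv by linarith
      then show ?thesis using pos l nz by (simp add: s_def mult_le_0_iff)
    qed
  qed
  moreover have "s = 1 \<or> s = -1" using xq by (auto simp: s_def sgn_if)
  ultimately show ?thesis using w by blast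
qed

text \<open>Let \<open>h\<close> be \<open>g\<close> conjugated by \<open>w\<close>. The images
  \<open>d\<close> of \<open>E 0\<close> under \<open>h\<close> and \<open>f k\<close> of
  \<open>E k\<close> under the inverse of \<open>h\<close> are positive roots. If \<open>d\<close>
  is the sum of \<open>n k * E k\<close>, pairing with the image of \<open>y\<close> gives zero as
  the sum of the nonnegative terms \<open>n k * bform G y (f k)\<close>. Some \<open>f k\<close>
  with nonzero \<open>n k\<close> is thus a multiple of \<open>E 0\<close>; comparing norms forces
  \<open>k = 0\<close> and the factor 1.\<close>

lemma fixed_simple_root:
  assumes w: "lat_isom G w" and s: "s = 1 \<or> s = -1"
    and xE: "\<And>k. k < m \<Longrightarrow> s * bform G x (w (E k)) > 0"
    and g: "lat_isom G g"
    and g_pos: "\<And>r. wroot G r \<Longrightarrow> s * bform G x r > 0 \<Longrightarrow> s * bform G x (g r) > 0"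
    and g_inv_pos: "\<And>r. wroot G r \<Longrightarrow> s * bform G x (g r) > 0 \<Longrightarrow> s * bform G x r > 0"
  shows "g (w (E 0)) = w (E 0)"
proof -
  have cone: "\<exists>n. (\<forall>k<m. n k \<ge> 0) \<and> r = (\<lambda>i. \<Sum>k<m. n k * E k i)"
    if r: "wroot G r" "s * bform G x (w r) > 0" for r
  proof (rule ccontr)
    assume "\<not> ?thesis"
    then obtain n where n: "\<forall>k<m. n k \<ge> 0" and rn: "r = (\<lambda>i. - (\<Sum>k<m. n k * E k i))"
      using wroot_cone[OF r(1)] by blast
    have "r = (\<lambda>i. \<Sum>k<m. (- n k) * E k i)" by (simp add: rn sum_negf)
    then have "w r = (\<lambda>i. \<Sum>k<m. (- n k) * w (E k) i)"
      using lat_isom_sum[OF w, of "{..<m}" "\<lambda>k. - n k" E] by simp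
    then have "s * bform G x (w r) = - (\<Sum>k<m. n k * (s * bform G x (w (E k))))"
      by (simp only: bform_sum_right bform_scale_right) (simp add: sum_negf sum_distrib_left mult_ac)
    also have "\<dots> \<le> 0"
    proof -
      have "0 \<le> (\<Sum>k<m. n k * (s * bform G x (w (E k))))"
      proof (rule sum_nonneg)
        fix k assume "k \<in> {..<m}"
        then show "0 \<le> n k * (s * bform G x (w (E k)))"
          using n less_imp_le[OF xE, of k] by (intro mult_nonneg_nonneg[of "n k"]) auto
      qed
      then show ?thesis by simp
    qed
    finally show False using r(2) by simp
  qed
  define c where "c = E 0"
  have c: "wroot G c" "c \<in> latt G" "c \<in> ambient G" "bform G c c = 6" "m > 0"
    using wroot_E[OF m_pos] wroot_latt latt_ambient root6_0 m_pos by (auto simp: c_def root6_def)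
  have wA: "w (E k) \<in> latt G" "wroot G (w (E k))" if "k < m" for k
    using that wroot_E wroot_latt lat_isom_latt[OF w] wroot_lat_isom_iff[OF w] by blast+
  obtain d where d: "d \<in> latt G" "w d = g (w c)"
    using lat_isom_surj[OF w] lat_isom_latt[OF g] lat_isom_latt[OF w] c(2) by metis
  have "wroot G (w d)"
    using d wA(2)[OF m_pos] wroot_lat_isom_iff[OF g wA(1)[OF m_pos]] by (simp add: c_def)
  then have "wroot G d" using wroot_lat_isom_iff[OF w d(1)] by blast
  moreover have "s * bform G x (w d) > 0"
    using g_pos[OF wA(2)[OF m_pos] xE[OF m_pos]] d(2) by (simp add: c_def)
  ultimately obtain n where n: "\<And>k. k < m \<Longrightarrow> n k \<ge> 0" and dn: "d = (\<lambda>i. \<Sum>k<m. n k * E k i)"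
    using cone by blast
  have "\<exists>f\<in>latt G. g (w f) = w (E k)" if "k < m" for k
    using lat_isom_surj[OF w] lat_isom_surj[OF g] wA(1)[OF that] by metis
  then obtain f where f: "\<And>k. k < m \<Longrightarrow> f k \<in> latt G" "\<And>k. k < m \<Longrightarrow> g (w (f k)) = w (E k)" by metis
  have fA: "f k \<in> ambient G" "w (f k) \<in> ambient G" if "k < m" for k
    using f(1)[OF that] lat_isom_latt[OF w] latt_ambient by blast+
  have wf: "wroot G (f k)" "wroot G (w (f k))" if "k < m" for k
    using wroot_lat_isom_iff[OF w f(1)[OF that]] wroot_lat_isom_iff[OF g lat_isom_latt[OF w f(1)[OF that]]]
      f(2)[OF that] wA(2)[OF that] by auto
  have "\<exists>a. (\<forall>j<m. a j \<ge> 0) \<and> f k = (\<lambda>i. \<Sum>j<m. a j * E j i)" if "k < m" for k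
    using cone[OF wf(1)[OF that]] g_inv_pos[OF wf(2)[OF that]] f(2)[OF that] xE[OF that] by auto
  then obtain a where a: "\<And>k j. k < m \<Longrightarrow> j < m \<Longrightarrow> a k j \<ge> 0"
    and fa: "\<And>k. k < m \<Longrightarrow> f k = (\<lambda>i. \<Sum>j<m. a k j * E j i)" by metis
  have yE: "bform G y (E j) \<ge> 0" if "j < m" for j
    using y_0 y_E[of j] that by (cases "j = 0") auto
  have yf: "bform G y (f k) = (\<Sum>j<m. a k j * bform G y (E j))" if "k < m" for k
    by (simp add: fa[OF that] bform_sum_right bform_scale_right)
  then have yf0: "bform G y (f k) \<ge> 0" if "k < m" for k
    using that a yE by (auto intro!: sum_nonneg)
  have wy: "w y \<in> ambient G" using lat_isom_ambient[OF w y_ambient] .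
  have "0 = bform G (w y) (w c)" using y_0 lat_isom_bform[OF w y_ambient c(3)] by (simp add: c_def)
  also have "\<dots> = bform G (g (w y)) (w d)"
    using lat_isom_bform[OF g wy lat_isom_ambient[OF w c(3)]] d(2) by simp
  also have "\<dots> = (\<Sum>k<m. n k * bform G (g (w y)) (w (E k)))"
    by (subst dn, subst lat_isom_sum[OF w]) (simp_all add: bform_sum_right bform_scale_right)
  also have "\<dots> = (\<Sum>k<m. n k * bform G y (f k))"
  proof (intro sum.cong refl)
    fix k assume "k \<in> {..<m}"
    then have k: "k < m" by simp
    have "bform G (g (w y)) (w (E k)) = bform G (g (w y)) (g (w (f k)))" using f(2)[OF k] by simp
    also have "\<dots> = bform G y (f k)"
      using lat_isom_bform[OF g wy fA(2)[OF k]] lat_isom_bform[OF w y_ambient fA(1)[OF k]] by simp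
    finally show "n k * bform G (g (w y)) (w (E k)) = n k * bform G y (f k)" by simp
  qed
  finally have sum0: "(\<Sum>k<m. n k * bform G y (f k)) = 0" by simp
  have zero: "n k * bform G y (f k) = 0" if "k < m" for k
    using sum_nonneg_eq_0_iff[of "{..<m}" "\<lambda>k. n k * bform G y (f k)"] sum0 n yf0 that by simp
  have "bform G d d = 6"
    using lat_isom_bform[OF w, of d d] lat_isom_bform[OF g, of "w c" "w c"] lat_isom_bform[OF w, of c c]
      d c lat_isom_ambient[OF w] latt_ambient by auto
  then have "\<exists>k<m. n k \<noteq> 0" by (rule_tac ccontr) (simp add: dn bform_def)
  then obtain k where k: "k < m" "n k \<noteq> 0" by blast
  then have "(\<Sum>j<m. a k j * bform G y (E j)) = 0" using zero[OF k(1)] yf by simp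
  then have "a k j * bform G y (E j) = 0" if "j < m" for j
    using sum_nonneg_eq_0_iff[of "{..<m}" "\<lambda>j. a k j * bform G y (E j)"] a[OF k(1)] yE that by simp
  then have "a k j = 0" if "j < m" "j \<noteq> 0" for j
    using y_E[of j] that by fastforce
  then have "f k = (\<lambda>i. \<Sum>j<m. if j = 0 then a k 0 * c i else 0)"
    unfolding fa[OF k(1)] by (intro ext sum.cong) (auto simp: c_def)
  then have fk: "f k = (\<lambda>i. a k 0 * c i)" using m_pos by simp
  \<comment> \<open>A coordinate of \<open>E 0\<close> equal to 1 makes every lattice multiple of
    \<open>E 0\<close> an integral one.\<close>
  have "a k 0 \<in> \<int>"
  proof -
    obtain i where "i < gdim G" "c i = 1" using unit_coord by (auto simp: c_def)
    then show ?thesis using f(1)[OF k(1)] fk by (auto simp: latt_def dest!: spec[of _ i])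
  qed
  then obtain z :: int where z: "a k 0 = of_int z" by (auto elim: Ints_cases)
  have "bform G (f k) (f k) = bform G (E k) (E k)"
    using lat_isom_bform[OF w fA(1)[OF k(1)] fA(1)[OF k(1)]] lat_isom_bform[OF g fA(2)[OF k(1)] fA(2)[OF k(1)]]
      f(2)[OF k(1)] lat_isom_bform[OF w E_ambient[OF k(1)] E_ambient[OF k(1)]] by simp
  then have Ek: "bform G (E k) (E k) = of_int (6 * z\<^sup>2)"
    by (simp add: fk bform_scale_left bform_scale_right c(4) z power2_eq_square)
  have k0: "k = 0"
  proof (rule ccontr)
    assume "k \<noteq> 0"
    then have "bform G (E k) (E k) = of_int 2" using root2_E k(1) by (auto simp: root2_def)
    then have "6 * z\<^sup>2 = 2" using Ek by (metis of_int_eq_iff)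
    then show False by presburger
  qed
  then have "of_int (6 * z\<^sup>2) = (of_int 6 :: real)" using Ek c(4) by (simp add: c_def)
  then have "6 * z\<^sup>2 = 6" by (metis of_int_eq_iff)
  then have "z = 1 \<or> z = -1" by (simp add: power2_eq_1_iff)
  then have "z = 1" using a[OF m_pos m_pos] z k0 by auto
  then have "f 0 = E 0" using fk z k0 by (simp add: c_def)
  then show ?thesis using f(2)[OF m_pos] by simp
qed

text \<open>Every root has constant sign on a connected cell, so an isometry preserving the cell
  preserves positivity and fixes the 6-root \<open>c\<close>. Reversal of the class of
  \<open>c / 3\<close> would then put \<open>2 c / 3\<close>, and with it \<open>c / 3\<close>, into
  the lattice; but the norm of \<open>c / 3\<close> is 2/3, not an integer.\<close>

theorem chiral: "chiral G"
  unfolding chiral_def achiral_def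
proof clarify
  fix M Q assume aut: "is_aut G M" and rev: "z3_reversing G M" and "cell_lift G Q" and "direct G M Q"
  then obtain x where x: "x \<in> open_cone_part G" and Q: "Q = connected_component_set (open_cone_part G) x"
    and gQ: "mact G M ` Q = Q" by (auto simp: cell_lift_def direct_def)
  define g where "g = mact G M"
  have g: "lat_isom G g" unfolding g_def by (rule lat_isom_mact[OF aut])
  have xQ: "x \<in> Q" using x by (simp add: Q)
  have Qsub: "Q \<subseteq> open_cone_part G" unfolding Q by (rule connected_component_subset)
  have QA: "q \<in> ambient G" if "q \<in> Q" for q using that Qsub by (auto simp: open_cone_part_def)
  have sign: "bform G b r > 0" if r: "wroot G r" and ab: "a \<in> Q" "b \<in> Q" and pos: "bform G a r > 0" for a b r
  proof (rule ccontr)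
    assume "\<not> bform G b r > 0"
    then have "0 \<in> {bform G r b..bform G r a}" using pos by (simp add: bform_sym[of r])
    moreover have "connected (bform G r ` Q)"
      unfolding Q by (intro connected_continuous_image continuous_on_bform connected_connected_component)
    ultimately have "0 \<in> bform G r ` Q"
      using connected_contains_Icc ab by blast
    then show False using Qsub r by (auto simp: open_cone_part_def)
  qed
  have neg: "wroot G (\<lambda>i. - r i)" if "wroot G r" for r
    using that by (auto simp: wroot_def root2_def root6_def latt_def ambient_def
        bform_scale_left[of G "-1", simplified] bform_scale_right[of G _ "-1", simplified])
  have sign': "s * bform G b r > 0" if s: "s = 1 \<or> s = -1" and r: "wroot G r" and ab: "a \<in> Q" "b \<in> Q"
    and pos: "s * bform G a r > 0" for a b r s
    using s sign[OF r ab] sign[OF neg[OF r] ab] pos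
    by (auto simp: bform_scale_right[of G _ "-1", simplified])
  obtain w s where w: "lat_isom G w" and s: "s = 1 \<or> s = -1"
    and xE: "\<And>k. k < m \<Longrightarrow> s * bform G x (w (E k)) > 0"
    using exists_chamber_isom[OF x] by blast
  obtain z where z: "z \<in> Q" "x = g z" using xQ gQ by (auto simp: g_def)
  have gbf: "bform G x (g r) = bform G z r" if "wroot G r" for r
    using z QA lat_isom_bform[OF g] wroot_latt[OF that] latt_ambient by auto
  have "g (w (E 0)) = w (E 0)"
  proof (rule fixed_simple_root[OF w s xE g])
    fix r assume r: "wroot G r"
    show "s * bform G x (g r) > 0" if "s * bform G x r > 0"
      using sign'[OF s r xQ z(1) that] gbf[OF r] by simp
    show "s * bform G x r > 0" if "s * bform G x (g r) > 0"
      using sign'[OF s r z(1) xQ] that gbf[OF r] by simp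
  qed
  moreover define c where "c = w (E 0)"
  ultimately have gc: "g c = c" by simp
  have E0: "E 0 \<in> latt G" "E 0 \<in> ambient G" "bform G (E 0) (E 0) = 6"
    using root6_0 by (auto simp: root6_def latt_ambient)
  have cl: "c \<in> latt G" and cc: "bform G c c = 6"
    using E0 lat_isom_latt[OF w] lat_isom_bform[OF w] by (auto simp: c_def)
  have c3: "bform G c v / 3 \<in> \<int>" if "v \<in> latt G" for v
  proof -
    obtain u where u: "u \<in> latt G" "w u = v" using lat_isom_surj[OF w \<open>v \<in> latt G\<close>] by blast
    then have "bform G c v = bform G (E 0) u" using lat_isom_bform[OF w E0(2)] latt_ambient by (auto simp: c_def)
    then show ?thesis using root6_0 u(1) by (simp add: root6_def)
  qed
  let ?d = "\<lambda>i. 1/3 * c i"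
  have "?d \<in> discr3_reps G"
    unfolding discr3_reps_def dual_latt_def
  proof (intro CollectI conjI ballI exI[of _ 1])
    show "?d \<in> ambient G" using latt_ambient[OF cl] by (simp add: ambient_def)
    show "bform G ?d v \<in> \<int>" if "v \<in> latt G" for v using c3[OF that] by (simp only: bform_scale_left) simp
    show "(\<lambda>i. 3 ^ 1 * ?d i) \<in> latt G" using cl by simp
  qed
  then have "(\<lambda>i. g ?d i + ?d i) \<in> latt G" using rev by (simp add: z3_reversing_def g_def)
  moreover have "g ?d = ?d" by (simp only: lat_isom_scale[OF g] gc)
  ultimately have "(\<lambda>i. ?d i + ?d i) \<in> latt G" by simp
  then have "(\<lambda>i. c i - (?d i + ?d i)) \<in> latt G" by (rule latt_closed(2)[OF cl])
  moreover have "(\<lambda>i. c i - (?d i + ?d i)) = ?d" by (simp add: fun_eq_iff)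
  ultimately have dl: "?d \<in> latt G" by metis
  have "bform G ?d ?d = 2/3" by (simp only: bform_scale_left bform_scale_right) (simp add: cc)
  then have "(2/3 :: real) \<in> \<int>" using bform_latt_Ints[OF dl dl] by metis
  then obtain k :: int where "(2/3 :: real) = of_int k" by (auto elim: Ints_cases)
  then have "of_int (3 * k) = (of_int 2 :: real)" by simp
  then have "3 * k = 2" by (simp only: of_int_eq_iff)
  then show False by presburger
qed

end

section \<open>Root lattices with a highest root\<close>

text \<open>\<open>Y\<close> is twice the inverse of the Gram matrix, the factor 2 clearing the
  denominators of \<open>D4\<close>; thus \<open>Y i / 2\<close> is the i-th fundamental weight, of
  norm \<open>Y i i / 2\<close>. \<open>Y_bound\<close> says that the vertices
  \<open>Y i / (2 th i)\<close> of the fundamental alcove have norm at most 1, which is the bound 1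
  on the covering radius.\<close>

locale highest_root_gram = sym_gram K for K +
  fixes th :: "nat \<Rightarrow> real" and Y :: "nat \<Rightarrow> nat \<Rightarrow> real"
  assumes rows: "r \<in> set K \<Longrightarrow> length r = gdim K"
    and offdiag: "i < gdim K \<Longrightarrow> j < gdim K \<Longrightarrow> i \<noteq> j \<Longrightarrow> gent K i j \<le> 0"
    and even: "x \<in> latt K \<Longrightarrow> \<exists>m::int. bform K x x = 2 * of_int m"
    and norm2: "i < gdim K \<Longrightarrow> bform K (uvec i) (uvec i) = 2"
    and psd: "bform K x x \<ge> 0"
    and Y_latt: "i < gdim K \<Longrightarrow> Y i \<in> latt K"
    and Y_dual: "i < gdim K \<Longrightarrow> bform K (Y i) x = 2 * x i"
    and Y_bound: "i < gdim K \<Longrightarrow> Y i i \<le> 2 * (th i)\<^sup>2"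
    and th_latt: "th \<in> latt K" and th_ge_1: "i < gdim K \<Longrightarrow> th i \<ge> 1"
    and th_dominant: "i < gdim K \<Longrightarrow> bform K th (uvec i) \<ge> 0"
    and th_norm: "gdim K > 0 \<Longrightarrow> bform K th th = 2"
begin

lemma Cauchy_Schwarz: "(bform K u v)\<^sup>2 \<le> bform K u u * bform K v v"
proof -
  have quad: "0 \<le> bform K u u * a\<^sup>2 + 2 * bform K u v * a * b + bform K v v * b\<^sup>2" for a b
  proof -
    have "bform K (\<lambda>i. a * u i + b * v i) (\<lambda>i. a * u i + b * v i)
        = bform K u u * a\<^sup>2 + 2 * bform K u v * a * b + bform K v v * b\<^sup>2"
      by (simp only: bform_linear) (simp add: bform_sym[of v u] power2_eq_square algebra_simps)
    then show ?thesis using psd by metis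
  qed
  show ?thesis
  proof (cases "bform K v v = 0")
    case False
    then have pos: "bform K v v > 0" using psd[of v] by simp
    have "0 \<le> bform K v v * (bform K u u * bform K v v - (bform K u v)\<^sup>2)"
      using quad[of "bform K v v" "- bform K u v"] by (simp add: power2_eq_square algebra_simps)
    then show ?thesis using pos by (simp add: zero_le_mult_iff)
  next
    case True
    have "bform K u v = 0"
    proof (rule ccontr)
      assume nz: "bform K u v \<noteq> 0"
      have "0 \<le> bform K u u * 1\<^sup>2 + 2 * bform K u v * 1 * (- (bform K u u + 1) / (2 * bform K u v))"
        using quad[of 1 "- (bform K u u + 1) / (2 * bform K u v)"] True by simp
      also have "\<dots> = -1" using nz by (simp add: field_simps)
      finally show False by simp
    qed
    then show ?thesis using True by simp
  qed
qed

text \<open>Cauchy-Schwarz against the fundamental weight belonging to the coordinate, in doubled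
  form.\<close>

lemma coord_bound: "i < gdim K \<Longrightarrow> (x i)\<^sup>2 \<le> (th i)\<^sup>2 * bform K x x"
proof -
  assume i: "i < gdim K"
  have "(2 * x i)\<^sup>2 \<le> (2 * Y i i) * bform K x x"
    using Cauchy_Schwarz[of "Y i" x] by (simp add: Y_dual[OF i])
  also have "\<dots> \<le> (4 * (th i)\<^sup>2) * bform K x x"
    using Y_bound[OF i] psd by (intro mult_right_mono) auto
  finally show ?thesis by (simp add: power2_eq_square)
qed

lemma posdef: "x \<in> ambient K \<Longrightarrow> x \<noteq> (\<lambda>i. 0) \<Longrightarrow> bform K x x > 0"
proof (rule ccontr)
  assume x: "x \<in> ambient K" "x \<noteq> (\<lambda>i. 0)" and "\<not> bform K x x > 0"
  then have "bform K x x = 0" using psd[of x] by simp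
  then have "x i = 0" if "i < gdim K" for i using coord_bound[OF that, of x] by simp
  then have "x i = 0" for i using x(1) by (cases "i < gdim K") (auto simp: ambient_def)
  then show False using x(2) by auto
qed

lemma norm_ge_2: "x \<in> latt K \<Longrightarrow> x \<noteq> (\<lambda>i. 0) \<Longrightarrow> bform K x x \<ge> 2"
proof -
  assume x: "x \<in> latt K" "x \<noteq> (\<lambda>i. 0)"
  obtain m :: int where m: "bform K x x = 2 * of_int m" using even[OF x(1)] by blast
  then have "m > 0" using posdef[OF latt_ambient[OF x(1)] x(2)] by simp
  then have "m \<ge> 1" by simp
  then show ?thesis using m by simp
qed

lemma disjoint_nonpos:
  assumes "\<And>i. u i \<ge> 0" "\<And>i. v i \<ge> 0" "\<And>i. u i * v i = 0"
  shows "bform K u v \<le> 0"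
  unfolding bform_def
proof (intro sum_nonpos)
  fix i j assume "i \<in> {..<gdim K}" "j \<in> {..<gdim K}"
  then have ij: "i < gdim K" "j < gdim K" by auto
  show "u i * of_int (gent K i j) * v j \<le> 0"
  proof (cases "i = j")
    case True
    then have "u i = 0 \<or> v j = 0" using assms(3)[of i] by simp
    then show ?thesis by auto
  next
    case False
    then have "of_int (gent K i j) \<le> (0::real)" using offdiag[OF ij] by simp
    then show ?thesis using assms(1)[of i] assms(2)[of j]
      by (simp add: mult_nonneg_nonpos mult_nonpos_nonneg)
  qed
qed

text \<open>Each part has norm at least 2, so a root is never such a difference. This principle
  yields both the signs of roots and the maximality of \<open>th\<close> without an enumeration of
  the roots.\<close>

lemma no_split:
  assumes "a \<in> latt K" "b \<in> latt K" "a \<noteq> (\<lambda>i. 0)" "b \<noteq> (\<lambda>i. 0)" "bform K a b \<le> 0"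
  shows "bform K (\<lambda>i. a i - b i) (\<lambda>i. a i - b i) > 2"
proof -
  have "bform K (\<lambda>i. a i - b i) (\<lambda>i. a i - b i) = bform K a a + bform K b b - 2 * bform K a b"
    by (simp only: bform_linear) (simp add: bform_sym[of b a])
  then show ?thesis using norm_ge_2[OF assms(1,3)] norm_ge_2[OF assms(2,4)] assms(5) by linarith
qed

lemma max_0_latt: "x \<in> latt K \<Longrightarrow> (\<lambda>i. max (x i) 0) \<in> latt K \<and> (\<lambda>i. max (- x i) 0) \<in> latt K"
  by (auto simp: latt_def ambient_def max_def)

lemma root_sign:
  assumes x: "x \<in> latt K" "bform K x x = 2"
  shows "(\<forall>i. x i \<ge> 0) \<or> (\<forall>i. x i \<le> 0)"
proof (rule ccontr)
  assume neg: "\<not> ?thesis"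
  let ?a = "\<lambda>i. max (x i) 0" and ?b = "\<lambda>i. max (- x i) 0"
  have "?a \<in> latt K" "?b \<in> latt K" using max_0_latt[OF x(1)] by auto
  moreover have "?a \<noteq> (\<lambda>i. 0)" "?b \<noteq> (\<lambda>i. 0)" using neg by (auto simp: fun_eq_iff max_def not_le)
  moreover have "bform K ?a ?b \<le> 0" by (rule disjoint_nonpos) (auto simp: max_def)
  ultimately have "bform K (\<lambda>i. ?a i - ?b i) (\<lambda>i. ?a i - ?b i) > 2" by (rule no_split)
  moreover have "(\<lambda>i. ?a i - ?b i) = x" by (auto simp: fun_eq_iff max_def)
  ultimately show False using x(2) by simp
qed

text \<open>Split \<open>x + th\<close> into positive part \<open>?p\<close> and negative part
  \<open>?b\<close>. Then \<open>x\<close> is \<open>?p - th\<close> minus \<open>?b\<close>, and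
  dominance of \<open>th\<close> makes the product of these two vectors nonpositive. A negative
  coordinate of \<open>x + th\<close> would make both nonzero, against
  \<open>no_split\<close>.\<close>

lemma root_ge_minus_th:
  assumes x: "x \<in> latt K" "bform K x x = 2" and i: "i < gdim K"
  shows "x i + th i \<ge> 0"
proof (rule ccontr)
  assume neg: "\<not> ?thesis"
  let ?n = "\<lambda>i. x i + th i"
  let ?p = "\<lambda>i. max (?n i) 0" and ?b = "\<lambda>i. max (- ?n i) 0"
  let ?a = "\<lambda>i. ?p i - th i"
  have nl: "?n \<in> latt K" using latt_closed(1)[OF x(1) th_latt] .
  from max_0_latt[OF this] have pl: "?p \<in> latt K" and bl: "?b \<in> latt K" by blast+
  have al: "?a \<in> latt K" using latt_closed(2)[OF pl th_latt] .
  have "?a i \<noteq> 0" using neg th_ge_1[OF i] by simp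
  then have a0: "?a \<noteq> (\<lambda>i. 0)" by (auto simp: fun_eq_iff)
  have "?b i \<noteq> 0" using neg by simp
  then have b0: "?b \<noteq> (\<lambda>i. 0)" by (auto simp: fun_eq_iff)
  have "bform K th ?b = (\<Sum>j<gdim K. ?b j * bform K th (uvec j))" by (rule bform_expand_right)
  also have "\<dots> \<ge> 0" using th_dominant by (auto intro!: sum_nonneg mult_nonneg_nonneg)
  finally have "bform K th ?b \<ge> 0" .
  moreover have "bform K ?p ?b \<le> 0" by (rule disjoint_nonpos) (auto simp: max_def)
  moreover have "bform K ?a ?b = bform K ?p ?b - bform K th ?b" by (rule bform_diff_left)
  ultimately have "bform K ?a ?b \<le> 0" by simp
  then have "bform K (\<lambda>i. ?a i - ?b i) (\<lambda>i. ?a i - ?b i) > 2" by (rule no_split[OF al bl a0 b0])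
  moreover have "(\<lambda>i. ?a i - ?b i) = x" by (auto simp: fun_eq_iff max_def)
  ultimately show False using x(2) by simp
qed

lemma shift_sqrt:
  assumes i: "i < gdim K"
  shows "x i + sqrt (bform K x x) * th i \<ge> 0"
proof -
  have "(x i)\<^sup>2 \<le> (sqrt (bform K x x) * th i)\<^sup>2"
    using coord_bound[OF i, of x] psd[of x] by (simp add: power_mult_distrib mult.commute)
  moreover have "sqrt (bform K x x) * th i \<ge> 0" using th_ge_1[OF i] psd[of x] by simp
  ultimately have "\<bar>x i\<bar> \<le> sqrt (bform K x x) * th i" by (metis abs_le_square_iff abs_of_nonneg)
  then show ?thesis by linarith
qed

text \<open>From half norm \<open>m = 2\<close> on this follows from \<open>shift_sqrt\<close>,
  because \<open>sqrt (2 m) \<le> m\<close>. Norm 2 is the case where the square root is too large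
  and the highest root property is used.\<close>

lemma shift_half_norm:
  assumes x: "x \<in> latt K" and i: "i < gdim K"
  shows "x i + bform K x x / 2 * th i \<ge> 0"
proof -
  obtain m :: int where m: "bform K x x = 2 * of_int m" using even[OF x] by blast
  have "m \<ge> 0" using psd[of x] m by simp
  then consider "m = 0" | "m = 1" | "m \<ge> 2" by linarith
  then show ?thesis
  proof cases
    case 1
    then show ?thesis using coord_bound[OF i, of x] m by simp
  next
    case 2
    then show ?thesis using root_ge_minus_th[OF x _ i] m by simp
  next
    case 3
    then have "sqrt (bform K x x) \<le> bform K x x / 2"
      using m by (intro real_le_lsqrt) (auto simp: power2_eq_square)
    then have "sqrt (bform K x x) * th i \<le> bform K x x / 2 * th i"
      using th_ge_1[OF i] by (intro mult_right_mono) auto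
    then show ?thesis using shift_sqrt[OF i, of x] by linarith
  qed
qed

text \<open>Twice the inverse Gram matrix is integral, so the discriminant group is killed by 2 and
  has no 3-torsion.\<close>

lemma third_latt:
  assumes x: "x \<in> latt K" and div: "\<And>v. v \<in> latt K \<Longrightarrow> bform K x v / 3 \<in> \<int>"
  shows "(\<lambda>i. x i / 3) \<in> latt K"
proof -
  have "x i / 3 \<in> \<int>" if i: "i < gdim K" for i
  proof -
    obtain a b :: int where "x i = of_int a" "bform K x (Y i) / 3 = of_int b"
      using x i div[OF Y_latt[OF i]] by (auto simp: latt_def elim!: Ints_cases)
    then have "2 * real_of_int a = 3 * of_int b"
      using Y_dual[OF i, of x] bform_sym[of x "Y i"] by simp
    then have "x i / 3 = of_int (a - b)" using \<open>x i = of_int a\<close> by simp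
    then show ?thesis by (metis Ints_of_int)
  qed
  then show ?thesis using x by (simp add: latt_def ambient_def)
qed

text \<open>Twice the Weyl vector, an interior point of the Weyl chamber of
  \<open>K\<close>.\<close>

definition dom :: "nat \<Rightarrow> real" where "dom = (\<lambda>i. \<Sum>k<gdim K. Y k i)"

lemma dom_latt: "dom \<in> latt K"
  using Y_latt by (auto simp: dom_def latt_def ambient_def intro!: Ints_sum sum.neutral)

lemma bform_dom: "bform K dom x = 2 * (\<Sum>k<gdim K. x k)"
  by (simp add: dom_def bform_sum_left Y_dual sum_distrib_left)

lemma dom_uvec: "i < gdim K \<Longrightarrow> bform K dom (uvec i) = 2"
  by (simp add: bform_dom uvec_def)

lemma dom_th: "bform K dom th \<ge> 0"
  using th_ge_1 by (force simp: bform_dom intro!: sum_nonneg)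

end

section \<open>Arithmetic of the hexagonal lattice\<close>

text \<open>Half the norm of \<open>a \<alpha>\<^sub>1 + b \<alpha>\<^sub>2\<close> in
  \<open>A2\<close>; equivalently the norm form of the Eisenstein integers.\<close>

definition hexn :: "int \<Rightarrow> int \<Rightarrow> int" where "hexn a b = a * a - a * b + b * b"

lemma hexn_4: "4 * hexn a b = (2 * a - b)\<^sup>2 + 3 * b\<^sup>2" "4 * hexn a b = (2 * b - a)\<^sup>2 + 3 * a\<^sup>2"
  by (simp_all add: hexn_def power2_eq_square algebra_simps)

lemma hexn_nonneg: "hexn a b \<ge> 0"
  using hexn_4(1)[of a b] zero_le_power2[of "2 * a - b"] zero_le_power2[of b] by linarith

text \<open>Membership of \<open>a \<alpha>\<^sub>1 + b \<alpha>\<^sub>2 + T (\<alpha>\<^sub>1 + \<alpha>\<^sub>2)\<close> in the cone of the simple roots \<open>\<alpha>\<^sub>1\<close>, \<open>\<alpha>\<^sub>2 - \<alpha>\<^sub>1\<close> of \<open>G\<^sub>2\<close>.\<close>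

definition hex_pos :: "real \<Rightarrow> int \<Rightarrow> int \<Rightarrow> bool" where
  "hex_pos T a b \<longleftrightarrow> T \<ge> 0 \<and> of_int b + T \<ge> 0 \<and> of_int a + of_int b + 2 * T \<ge> 0"

lemma hex_pos_mono: "hex_pos t a b \<Longrightarrow> t \<le> T \<Longrightarrow> hex_pos T a b"
  by (auto simp: hex_pos_def)

text \<open>The norm in \<open>A2\<close> is \<open>2 * hexn a b\<close>, so \<open>t^2\<close> is
  2/3 of it: the squared covering radius of \<open>A2\<close>. Both inequalities come from
  completing squares in \<open>hexn\<close>.\<close>

lemma hex_pos_sqrt:
  assumes t: "t \<ge> 0" "3 * t\<^sup>2 = 4 * of_int (hexn a b)"
  shows "hex_pos t a b"
proof -
  let ?a = "real_of_int a" and ?b = "real_of_int b"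
  have h: "3 * t\<^sup>2 = 4 * (?a * ?a - ?a * ?b + ?b * ?b)" using t(2) by (simp add: hexn_def)
  have "4 * (?a * ?a - ?a * ?b + ?b * ?b) - 3 * ?b\<^sup>2 = (2 * ?a - ?b)\<^sup>2"
    by (simp add: power2_eq_square algebra_simps)
  then have "3 * t\<^sup>2 - 3 * ?b\<^sup>2 = (2 * ?a - ?b)\<^sup>2" by (simp add: h)
  then have "?b\<^sup>2 \<le> t\<^sup>2" using zero_le_power2[of "2 * ?a - ?b"] by linarith
  then have "\<bar>?b\<bar> \<le> t" using t(1) by (metis abs_le_square_iff abs_of_nonneg)
  moreover have "4 * (4 * (?a * ?a - ?a * ?b + ?b * ?b)) = 12 * (?a - ?b)\<^sup>2 + 4 * (?a + ?b)\<^sup>2"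
    by (simp add: power2_eq_square algebra_simps)
  then have "12 * t\<^sup>2 = 12 * (?a - ?b)\<^sup>2 + 4 * (?a + ?b)\<^sup>2" using h by linarith
  then have "(?a + ?b)\<^sup>2 \<le> 4 * t\<^sup>2"
    using zero_le_power2[of "?a - ?b"] zero_le_power2[of t] by linarith
  then have "(?a + ?b)\<^sup>2 \<le> (2 * t)\<^sup>2" by (simp add: power_mult_distrib)
  then have "\<bar>?a + ?b\<bar> \<le> 2 * t" using t(1) by (metis abs_le_square_iff abs_of_nonneg mult_nonneg_nonneg zero_le_numeral)
  with \<open>\<bar>?b\<bar> \<le> t\<close> t(1) show ?thesis by (auto simp: hex_pos_def)
qed

text \<open>The counterpart of \<open>shift_half_norm\<close>. It improves on
  \<open>hex_pos_sqrt\<close> only when \<open>hexn a b = 1\<close>, where it replaces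
  \<open>2 / sqrt 3\<close> by 1.\<close>

lemma hex_pos_int: "hex_pos (of_int (hexn a b)) a b"
proof -
  have "b + hexn a b \<ge> 0"
  proof -
    have e: "2 * (b + hexn a b) = (a - b)\<^sup>2 + a\<^sup>2 + (b + 1)\<^sup>2 - 1"
      by (simp add: hexn_def power2_eq_square algebra_simps)
    have "(a - b)\<^sup>2 + a\<^sup>2 + (b + 1)\<^sup>2 \<noteq> 0"
    proof
      assume "(a - b)\<^sup>2 + a\<^sup>2 + (b + 1)\<^sup>2 = 0"
      then have "(a - b)\<^sup>2 = 0 \<and> a\<^sup>2 = 0 \<and> (b + 1)\<^sup>2 = 0"
        using zero_le_power2[of "a - b"] zero_le_power2[of a] zero_le_power2[of "b + 1"] by linarith
      then have "a = b" "a = 0" "b + 1 = 0" by simp_all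
      then show False by linarith
    qed
    moreover have "(a - b)\<^sup>2 + a\<^sup>2 + (b + 1)\<^sup>2 \<ge> 0" by simp
    ultimately have "(a - b)\<^sup>2 + a\<^sup>2 + (b + 1)\<^sup>2 > 0" by (metis less_le)
    then show ?thesis using e by presburger
  qed
  moreover have "a + b + 2 * hexn a b \<ge> 0"
  proof -
    have "n * n + n \<ge> 0" for n :: int
      using mult_nonpos_nonpos[of n "n + 1"] by (cases "n \<ge> 0") (auto simp: algebra_simps)
    then have "a * a + a \<ge> 0" "b * b + b \<ge> 0" by blast+
    moreover have "a + b + 2 * hexn a b = (a - b)\<^sup>2 + (a * a + a) + (b * b + b)"
      by (simp add: hexn_def power2_eq_square algebra_simps)
    ultimately show ?thesis using zero_le_power2[of "a - b"] by linarith
  qed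
  ultimately have "real_of_int (b + hexn a b) \<ge> 0" "real_of_int (a + b + 2 * hexn a b) \<ge> 0"
    by (simp_all only: of_int_0_le_iff)
  then show ?thesis
    using hexn_nonneg[of a b] by (simp add: hex_pos_def)
qed

lemma hexn_small:
  assumes "hexn a b \<le> 3"
  shows "a \<in> {-2, -1, 0, 1, 2}" "b \<in> {-2, -1, 0, 1, 2}"
proof -
  have small: "x \<in> {-2, -1, 0, 1, 2}" if "3 * x\<^sup>2 \<le> 12" for x :: int
  proof -
    have "x\<^sup>2 \<le> 2\<^sup>2" using that by simp
    then have "\<bar>x\<bar> \<le> 2" using abs_le_square_iff[of x 2] by simp
    then show ?thesis by auto
  qed
  have "3 * a\<^sup>2 \<le> 12" "3 * b\<^sup>2 \<le> 12"
    using assms hexn_4[of a b] zero_le_power2[of "2 * a - b"] zero_le_power2[of "2 * b - a"] by linarith+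
  then show "a \<in> {-2, -1, 0, 1, 2}" "b \<in> {-2, -1, 0, 1, 2}" by (simp_all only: small)
qed

text \<open>The prime 2 is inert in the Eisenstein integers. The gap between the values 1 and 3 is
  what closes the case \<open>b = 2\<close> in \<open>root2_pos_vec\<close>.\<close>

lemma hexn_neq_2: "hexn a b \<noteq> 2"
proof
  assume h: "hexn a b = 2"
  then show False using hexn_small[of a b] by (auto simp: hexn_def)
qed

text \<open>Apart from zero, these are the short (\<open>hexn\<close> 1) and long
  (\<open>hexn\<close> 3) roots of \<open>G2\<close>.\<close>

lemma hex_pos_or_neg: "hexn a b \<le> 3 \<Longrightarrow> hex_pos 0 a b \<or> hex_pos 0 (- a) (- b)"
  using hexn_small[of a b] by (auto simp: hexn_def hex_pos_def)

lemma hexn_zero: "hexn a b = 0 \<Longrightarrow> a = 0 \<and> b = 0"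
  using hexn_small[of a b] by (auto simp: hexn_def)

lemma hexn_uminus: "hexn (- a) (- b) = hexn a b"
  by (simp add: hexn_def)

section \<open>Lattices containing a hyperbolic plane and A2\<close>

lemma sum_lessThan_add: "(\<Sum>i<m + n. f i) = (\<Sum>i<m. f i) + (\<Sum>i<n. f (m + i))"
  for f :: "nat \<Rightarrow> 'a :: comm_monoid_add"
  by (induction n) (simp_all add: add.assoc)

lemma gdim_osum: "gdim (G \<oplus>\<^sub>L H) = gdim G + gdim H"
  by (simp add: gdim_def osum_def)

lemma bform_osum:
  assumes G: "\<And>r. r \<in> set G \<Longrightarrow> length r = gdim G" and H: "\<And>r. r \<in> set H \<Longrightarrow> length r = gdim H"
  shows "bform (G \<oplus>\<^sub>L H) x y = bform G x y + bform H (\<lambda>i. x (gdim G + i)) (\<lambda>i. y (gdim G + i))"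
proof -
  have "length (G ! i) = gdim G" if "i < gdim G" for i using G[of "G ! i"] that by (simp add: gdim_def)
  then have "gent (G \<oplus>\<^sub>L H) i j = gent G i j" if "i < gdim G" "j < gdim G" for i j
    using that by (simp add: gent_def osum_def nth_append gdim_def)
  moreover have "gent (G \<oplus>\<^sub>L H) i (gdim G + j) = 0" if "i < gdim G" "j < gdim H" for i j
    using that \<open>\<And>i. i < gdim G \<Longrightarrow> length (G ! i) = gdim G\<close> by (simp add: gent_def osum_def nth_append gdim_def)
  moreover have "gent (G \<oplus>\<^sub>L H) (gdim G + i) j = 0" if "i < gdim H" "j < gdim G" for i j
    using that by (simp add: gent_def osum_def nth_append gdim_def)
  moreover have "gent (G \<oplus>\<^sub>L H) (gdim G + i) (gdim G + j) = gent H i j" if "i < gdim H" "j < gdim H" for i j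
    using that by (simp add: gent_def osum_def nth_append gdim_def)
  ultimately show ?thesis
    by (simp add: bform_def gdim_osum sum_lessThan_add sum.distrib)
qed

lemma gent_eq_bform: "i < gdim G \<Longrightarrow> j < gdim G \<Longrightarrow> of_int (gent G i j) = bform G (uvec i) (uvec j)"
  by (simp add: bform_uvec_left) (simp add: uvec_def if_distrib cong: if_cong)

definition UAK :: "int \<Rightarrow> gram \<Rightarrow> gram" where
  "UAK d K = gscale d U_lat \<oplus>\<^sub>L A2_lat \<oplus>\<^sub>L K"

definition vec4 :: "real \<Rightarrow> real \<Rightarrow> real \<Rightarrow> real \<Rightarrow> (nat \<Rightarrow> real) \<Rightarrow> nat \<Rightarrow> real" where
  "vec4 a b c e k i = (if i = 0 then a else if i = 1 then b else if i = 2 then c else if i = 3 then e else k (i - 4))"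

lemma vec4_simps [simp]:
  "vec4 a b c e k 0 = a" "vec4 a b c e k (Suc 0) = b" "vec4 a b c e k 2 = c" "vec4 a b c e k 3 = e"
  "(\<lambda>i. vec4 a b c e k (4 + i)) = k"
  by (simp_all add: vec4_def fun_eq_iff)

lemma vec4_collapse: "vec4 (x 0) (x 1) (x 2) (x 3) (\<lambda>i. x (4 + i)) = x"
proof
  fix i :: nat
  consider "i = 0" | "i = 1" | "i = 2" | "i = 3" | "i \<ge> 4" by linarith
  then show "vec4 (x 0) (x 1) (x 2) (x 3) (\<lambda>i. x (4 + i)) i = x i"
    by cases (auto simp: vec4_def)
qed

lemma gdim_UAK [simp]: "gdim (UAK d K) = 4 + gdim K"
  by (simp add: UAK_def gdim_osum) (simp add: gdim_def gscale_def U_lat_def A2_lat_def)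

lemma vec4_ambient [simp]: "vec4 a b c e k \<in> ambient (UAK d K) \<longleftrightarrow> k \<in> ambient K"
proof
  assume *: "vec4 a b c e k \<in> ambient (UAK d K)"
  show "k \<in> ambient K"
    unfolding ambient_def
  proof (intro CollectI allI impI)
    fix i assume "gdim K \<le> i"
    then show "k i = 0" using * by (auto simp: ambient_def vec4_def dest!: spec[of _ "4 + i"])
  qed
qed (auto simp: ambient_def vec4_def)

lemma vec4_latt [simp]:
  "vec4 a b c e k \<in> latt (UAK d K) \<longleftrightarrow> a \<in> \<int> \<and> b \<in> \<int> \<and> c \<in> \<int> \<and> e \<in> \<int> \<and> k \<in> latt K"
proof
  assume *: "vec4 a b c e k \<in> latt (UAK d K)"
  then have i: "vec4 a b c e k i \<in> \<int>" if "i < 4 + gdim K" for i using that by (simp add: latt_def)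
  have "k i \<in> \<int>" if "i < gdim K" for i using i[of "4 + i"] that by (simp add: vec4_def)
  then show "a \<in> \<int> \<and> b \<in> \<int> \<and> c \<in> \<int> \<and> e \<in> \<int> \<and> k \<in> latt K"
    using * i[of 0] i[of 1] i[of 2] i[of 3] by (simp add: latt_def)
qed (auto simp: latt_def vec4_def)

lemma vec4_eq_iff [simp]: "vec4 a b c e k = vec4 a' b' c' e' k' \<longleftrightarrow> a = a' \<and> b = b' \<and> c = c' \<and> e = e' \<and> k = k'"
  by (metis vec4_simps)

lemma vec4_zero: "vec4 0 0 0 0 (\<lambda>i. 0) = (\<lambda>i. 0)"
  by (auto simp: vec4_def fun_eq_iff)

lemma vec4_minus: "(\<lambda>i. - vec4 a b c e k i) = vec4 (- a) (- b) (- c) (- e) (\<lambda>i. - k i)"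
  by (auto simp: vec4_def fun_eq_iff)

locale UAK_gram = sym_gram K for K +
  fixes d :: int
  assumes K_rows: "r \<in> set K \<Longrightarrow> length r = gdim K"
    and K_pos: "x \<in> ambient K \<Longrightarrow> x \<noteq> (\<lambda>i. 0) \<Longrightarrow> bform K x x > 0"
    and K_dual: "i < gdim K \<Longrightarrow> \<exists>y\<in>ambient K. \<forall>q. bform K y q = q i"
    and d_pos: "d > 0"
begin

lemma bform_UAK: "bform (UAK d K) x y = real_of_int d * (x 0 * y 1 + x 1 * y 0)
    + (2 * x 2 * y 2 - x 2 * y 3 - x 3 * y 2 + 2 * x 3 * y 3) + bform K (\<lambda>i. x (4 + i)) (\<lambda>i. y (4 + i))"
proof -
  have 1: "length r = gdim (gscale d U_lat)" if "r \<in> set (gscale d U_lat)" for r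
    using that by (auto simp: gscale_def U_lat_def gdim_def)
  have 2: "length r = gdim A2_lat" if "r \<in> set A2_lat" for r
    using that by (auto simp: A2_lat_def gdim_def)
  have 3: "length r = gdim (gscale d U_lat \<oplus>\<^sub>L A2_lat)" if "r \<in> set (gscale d U_lat \<oplus>\<^sub>L A2_lat)" for r
    using that by (auto simp: gscale_def U_lat_def A2_lat_def gdim_def osum_def)
  have g: "gdim (gscale d U_lat \<oplus>\<^sub>L A2_lat) = 4" "gdim (gscale d U_lat) = 2"
    by (simp_all add: gscale_def U_lat_def A2_lat_def gdim_def osum_def)
  have "bform (UAK d K) x y = bform (gscale d U_lat) x y + bform A2_lat (\<lambda>i. x (2 + i)) (\<lambda>i. y (2 + i))
      + bform K (\<lambda>i. x (4 + i)) (\<lambda>i. y (4 + i))"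
    unfolding UAK_def using bform_osum[OF 3 K_rows, of x y] bform_osum[OF 1 2, of x y] by (simp add: g)
  also have "bform (gscale d U_lat) x y = real_of_int d * (x 0 * y 1 + x 1 * y 0)"
    by (simp add: bform_def gdim_def gent_def gscale_def U_lat_def lessThan_Suc algebra_simps)
  also have "bform A2_lat (\<lambda>i. x (2 + i)) (\<lambda>i. y (2 + i)) = 2 * x 2 * y 2 - x 2 * y 3 - x 3 * y 2 + 2 * x 3 * y 3"
    by (simp add: bform_def gdim_def gent_def A2_lat_def lessThan_Suc algebra_simps eval_nat_numeral)
  finally show ?thesis .
qed

lemma bform_vec4 [simp]: "bform (UAK d K) (vec4 a b c e k) (vec4 a' b' c' e' k')
    = real_of_int d * (a * b' + b * a') + (2 * c * c' - c * e' - e * c' + 2 * e * e') + bform K k k'"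
  by (simp add: bform_UAK)

text \<open>Orthogonality to \<open>u - v\<close> equates the two hyperbolic coordinates, which
  leaves \<open>2 d a^2\<close> plus the positive definite forms of \<open>A2\<close> and
  \<open>K\<close>.\<close>

lemma lorentz: "lorentz_gram (UAK d K) (vec4 1 (-1) 0 0 (\<lambda>i. 0))"
proof unfold_locales
  have s: "bform (UAK d K) x y = bform (UAK d K) y x" for x y
    by (simp add: bform_UAK bform_sym algebra_simps)
  fix i j assume "i < gdim (UAK d K)" "j < gdim (UAK d K)"
  then have "real_of_int (gent (UAK d K) i j) = of_int (gent (UAK d K) j i)"
    using s by (simp only: gent_eq_bform)
  then show "gent (UAK d K) i j = gent (UAK d K) j i" by simp
next
  show "vec4 1 (- 1) 0 0 (\<lambda>i. 0) \<in> ambient (UAK d K)" by (simp add: ambient_def[of K])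
  show "bform (UAK d K) (vec4 1 (- 1) 0 0 (\<lambda>i. 0)) (vec4 1 (- 1) 0 0 (\<lambda>i. 0)) < 0"
    using d_pos by (simp add: bform_def[of K])
next
  fix z assume z: "z \<in> ambient (UAK d K)" "bform (UAK d K) z (vec4 1 (- 1) 0 0 (\<lambda>i. 0)) = 0" "z \<noteq> (\<lambda>i. 0)"
  obtain a b c e k where zv: "z = vec4 a b c e k" by (metis vec4_collapse)
  have "real_of_int d * (b - a) = 0" using z(2) by (simp add: zv bform_def[of K] algebra_simps)
  then have ba: "b = a" using d_pos by simp
  have kA: "k \<in> ambient K" using z(1) by (simp add: zv)
  have nn: "bform K k k \<ge> 0" using K_pos[OF kA] by (cases "k = (\<lambda>i. 0)") (auto simp: bform_def)
  have zz: "bform (UAK d K) z z = 2 * real_of_int d * a\<^sup>2 + (c\<^sup>2 + e\<^sup>2 + (c - e)\<^sup>2) + bform K k k"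
    by (simp add: zv ba power2_eq_square algebra_simps)
  show "bform (UAK d K) z z > 0"
  proof (rule ccontr)
    assume "\<not> ?thesis"
    moreover have "2 * real_of_int d * a\<^sup>2 \<ge> 0" using d_pos by simp
    ultimately have "2 * real_of_int d * a\<^sup>2 = 0" "c\<^sup>2 = 0" "e\<^sup>2 = 0" "bform K k k = 0"
      using zz nn zero_le_power2[of c] zero_le_power2[of e] zero_le_power2[of "c - e"] by linarith+
    then have "a = 0" "c = 0" "e = 0" "k = (\<lambda>i. 0)" using d_pos K_pos[OF kA] by auto
    then show False using z(3) by (simp add: zv ba vec4_zero)
  qed
next
  fix i assume "i < gdim (UAK d K)"
  then have "i = 0 \<or> i = 1 \<or> i = 2 \<or> i = 3 \<or> (i = 4 + (i - 4) \<and> i - 4 < gdim K)"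
    unfolding gdim_UAK by linarith
  then consider "i = 0" | "i = 1" | "i = 2" | "i = 3" | j where "i = 4 + j" "j < gdim K" by blast
  then show "\<exists>y\<in>ambient (UAK d K). \<forall>q\<in>ambient (UAK d K). bform (UAK d K) y q = q i"
  proof cases
    case 1
    then show ?thesis using d_pos
      by (intro bexI[of _ "vec4 0 (1 / real_of_int d) 0 0 (\<lambda>i. 0)"]) (simp_all add: bform_UAK bform_def[of K] ambient_def[of K])
  next
    case 2
    then show ?thesis using d_pos
      by (intro bexI[of _ "vec4 (1 / real_of_int d) 0 0 0 (\<lambda>i. 0)"]) (simp_all add: bform_UAK bform_def[of K] ambient_def[of K])
  next
    case 3
    then show ?thesis
      by (intro bexI[of _ "vec4 0 0 (2 / 3) (1 / 3) (\<lambda>i. 0)"]) (simp_all add: bform_UAK bform_def[of K] ambient_def[of K])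
  next
    case 4
    then show ?thesis
      by (intro bexI[of _ "vec4 0 0 (1 / 3) (2 / 3) (\<lambda>i. 0)"]) (simp_all add: bform_UAK bform_def[of K] ambient_def[of K])
  next
    case (5 j)
    then obtain y where "y \<in> ambient K" "\<And>q. bform K y q = q j" using K_dual by blast
    then show ?thesis using 5
      by (intro bexI[of _ "vec4 0 0 0 0 y"]) (simp_all add: bform_UAK)
  qed
qed

lemma latt_cases:
  assumes "r \<in> latt (UAK d K)"
  obtains a b n1 n2 :: int and k where "r = vec4 (of_int a) (of_int b) (of_int n1) (of_int n2) k" "k \<in> latt K"
proof -
  obtain a b c e k where "r = vec4 a b c e k" by (metis vec4_collapse)
  then show ?thesis using assms that by (auto elim!: Ints_cases)
qed

lemma norm_vec4: "bform (UAK d K) (vec4 (of_int a) (of_int b) (of_int n1) (of_int n2) k)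
    (vec4 (of_int a) (of_int b) (of_int n1) (of_int n2) k)
    = of_int (2 * d * a * b + 2 * hexn n1 n2) + bform K k k"
  by (simp add: hexn_def algebra_simps)

lemma root6_vec4:
  assumes "root6 (UAK d K) (vec4 (of_int a) (of_int b) (of_int n1) (of_int n2) k)"
  shows "3 dvd d * a" "3 dvd d * b" "v \<in> latt K \<Longrightarrow> bform K k v / 3 \<in> \<int>"
proof -
  let ?r = "vec4 (of_int a) (of_int b) (of_int n1) (of_int n2) k"
  have z: "(\<lambda>i. 0) \<in> latt K" by (simp add: latt_def ambient_def)
  have b0: "bform K k (\<lambda>i. 0) = 0" by (simp add: bform_def)
  have div: "bform (UAK d K) ?r w / 3 \<in> \<int>" if "w \<in> latt (UAK d K)" for w
    using assms that by (simp add: root6_def)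
  have dvd: "3 dvd m" if m: "real_of_int m / 3 \<in> \<int>" for m :: int
  proof -
    obtain z :: int where "real_of_int m / 3 = of_int z" using m by (rule Ints_cases)
    then have "real_of_int m = of_int (3 * z)" by simp
    then show ?thesis by (simp only: of_int_eq_iff) simp
  qed
  show "3 dvd d * a" using div[of "vec4 0 1 0 0 (\<lambda>i. 0)"] z b0 by (intro dvd) simp
  show "3 dvd d * b" using div[of "vec4 1 0 0 0 (\<lambda>i. 0)"] z b0 by (intro dvd) simp
  show "bform K k v / 3 \<in> \<int>" if "v \<in> latt K" using div[of "vec4 0 0 0 0 v"] that by simp
qed

end

lemma le_from_mult: "b > 0 \<Longrightarrow> 0 \<le> b * (c - x) \<Longrightarrow> x \<le> c" for b c x :: real
  by (simp add: zero_le_mult_iff)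

lemma root_third_sqrt: "hexn a b \<ge> 0 \<Longrightarrow> \<exists>t\<ge>0. 3 * t\<^sup>2 = 4 * real_of_int (hexn a b)"
  by (intro exI[of _ "sqrt (4 / 3 * of_int (hexn a b))"]) simp

section \<open>Positivity of the roots of U + A2 + K\<close>

context highest_root_gram
begin

sublocale UK: UAK_gram K 1
proof unfold_locales
  fix i assume i: "i < gdim K"
  have "(\<lambda>j. 1/2 * Y i j) \<in> ambient K" using Y_latt[OF i] by (auto simp: latt_def ambient_def)
  moreover have "bform K (\<lambda>j. 1/2 * Y i j) q = q i" for q
    by (simp only: bform_scale_left Y_dual[OF i])
  ultimately show "\<exists>y\<in>ambient K. \<forall>q. bform K y q = q i" by blast
qed (use rows posdef in auto)

text \<open>With \<open>\<delta> = -u\<close>, the vector is \<open>b e + s (\<delta> - \<theta>) + T (\<delta> - \<alpha>\<^sub>1 - \<alpha>\<^sub>2)\<close> plus finite parts, where \<open>T = b - a - s\<close>.\<close>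

definition pos_vec :: "int \<Rightarrow> int \<Rightarrow> int \<Rightarrow> int \<Rightarrow> (nat \<Rightarrow> real) \<Rightarrow> bool" where
  "pos_vec a b n1 n2 k \<longleftrightarrow> b \<ge> 0 \<and> (\<exists>s\<ge>0. (gdim K = 0 \<longrightarrow> s = 0) \<and>
     (\<forall>i<gdim K. k i + s * th i \<ge> 0) \<and> hex_pos (of_int b - of_int a - s) n1 n2)"

text \<open>\<open>hex_pos\<close> is monotone in its first argument, so the two finite parts can be
  estimated separately; only the sum of their shifts \<open>s\<close> and \<open>t\<close> is
  compared with \<open>b - a\<close>.\<close>

lemma pos_vecI:
  assumes "b \<ge> 0" "s \<ge> 0" "gdim K = 0 \<Longrightarrow> s = 0" "\<And>i. i < gdim K \<Longrightarrow> k i + s * th i \<ge> 0"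
    "hex_pos t n1 n2" "s + t \<le> of_int b - of_int a"
  shows "pos_vec a b n1 n2 k"
  unfolding pos_vec_def using assms hex_pos_mono[OF assms(5), of "of_int b - of_int a - s"] by auto

lemma bform_gdim_0: "gdim K = 0 \<Longrightarrow> bform K x y = 0"
  by (simp add: bform_def)

lemma bform_third: "bform K (\<lambda>i. x i / 3) (\<lambda>i. x i / 3) = bform K x x / 9"
  by (simp add: bform_def sum_divide_distrib)

text \<open>By the norm equation, \<open>2 b (b - a - s - t)\<close> equals
  \<open>(s - b)^2 + 3/2 (t - 2/3 b)^2 + b^2/3 - 2\<close> when \<open>s\<close> and
  \<open>t\<close> are the covering radius shifts. This is nonnegative from \<open>b = 3\<close> on;
  smaller \<open>b\<close> use the integral estimates.\<close>

lemma root2_pos_vec: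
  assumes k: "k \<in> latt K" and norm: "of_int (2 * a * b + 2 * hexn n1 n2) + bform K k k = 2" and b: "b > 0"
  shows "pos_vec a b n1 n2 k"
proof -
  define s where "s = sqrt (bform K k k)"
  have s: "s \<ge> 0" "s\<^sup>2 = bform K k k" "gdim K = 0 \<Longrightarrow> s = 0" "\<And>i. i < gdim K \<Longrightarrow> k i + s * th i \<ge> 0"
    using psd shift_sqrt by (auto simp: s_def bform_gdim_0)
  obtain t where t: "t \<ge> 0" "3 * t\<^sup>2 = 4 * real_of_int (hexn n1 n2)"
    using root_third_sqrt[OF hexn_nonneg] by blast
  have eq: "2 * real_of_int a * of_int b + 2 * of_int (hexn n1 n2) + s\<^sup>2 = 2" using norm s(2) by simp
  consider "b = 1" | "b = 2" | "b \<ge> 3" using b by linarith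
  then show ?thesis
  proof cases
    case 1
    show ?thesis
    \<comment> \<open>For \<open>b = 1\<close> the norm equation reads
      \<open>1 - a = hexn n1 n2 + bform K k k / 2\<close>, so the half norm shifts fit
      exactly.\<close>
    proof (rule pos_vecI[where s = "bform K k k / 2" and t = "of_int (hexn n1 n2)"])
      show "bform K k k / 2 + of_int (hexn n1 n2) \<le> real_of_int b - of_int a" using norm 1 by simp
    qed (use b psd[of k] shift_half_norm[OF k] hex_pos_int in \<open>auto simp: bform_gdim_0\<close>)
  next
    case 2
    have eq2: "4 * real_of_int a + 2 * of_int (hexn n1 n2) + s\<^sup>2 = 2" using eq 2 by simp
    have "\<exists>t'. hex_pos t' n1 n2 \<and> s + t' \<le> real_of_int b - of_int a"
    proof -
      \<comment> \<open>The square root shift \<open>t\<close> suffices only outside the interval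
        between 2/3 and 2. The value 1 of \<open>hexn\<close> gives a \<open>t\<close> inside it and
        is treated with the shift \<open>hexn\<close> instead; from 3 on, \<open>t\<close> is at
        least 2.\<close>
      have "hexn n1 n2 = 0 \<or> hexn n1 n2 = 1 \<or> hexn n1 n2 \<ge> 3"
        using hexn_nonneg[of n1 n2] hexn_neq_2[of n1 n2] by linarith
      then consider "hexn n1 n2 = 0 \<or> hexn n1 n2 = 1" | "hexn n1 n2 \<ge> 3" by blast
      then show ?thesis
      proof cases
        case 1
        have "0 \<le> (s - 2)\<^sup>2" by simp
        then have "s + of_int (hexn n1 n2) \<le> real_of_int b - of_int a"
          using 1 eq2 \<open>b = 2\<close> by (auto simp: power2_eq_square algebra_simps)
        then show ?thesis using hex_pos_int by blast
      next
        case 2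
        then have "t\<^sup>2 \<ge> 2\<^sup>2" using t(2) by simp
        then have t2: "t \<ge> 2" using t(1) by (rule power2_le_imp_le)
        have "0 \<le> (s - 2)\<^sup>2 + (t - 2) * (3/2 * t - 1)" using t2 by simp
        also have "\<dots> = s\<^sup>2 + 3/2 * t\<^sup>2 - 4 * s - 4 * t + 6"
          by (simp add: power2_eq_square field_simps)
        also have "\<dots> = 4 * ((real_of_int b - of_int a) - (s + t))"
          using eq2 t(2) \<open>b = 2\<close> by simp
        finally have "s + t \<le> real_of_int b - of_int a" by simp
        then show ?thesis using hex_pos_sqrt[OF t] by blast
      qed
    qed
    then show ?thesis using pos_vecI[of b s k _ n1 n2 a] s b by auto
  next
    case 3
    define B where "B = real_of_int b"
    have B: "B \<ge> 3" using 3 by (simp add: B_def)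
    then have "B\<^sup>2 \<ge> 3\<^sup>2" by (intro power_mono) auto
    then have "0 \<le> (s - B)\<^sup>2 + 3/2 * (t - 2/3 * B)\<^sup>2 + (B\<^sup>2 / 3 - 2)" by simp
    also have "\<dots> = s\<^sup>2 + 3/2 * t\<^sup>2 + 2 * B\<^sup>2 - 2 * (s * B) - 2 * (t * B) - 2"
      by (simp add: power2_eq_square algebra_simps)
    also have "\<dots> = 2 * B\<^sup>2 - 2 * of_int a * B - 2 * (s * B) - 2 * (t * B)"
      using eq t(2) unfolding B_def[symmetric] by linarith
    also have "\<dots> = (2 * B) * ((B - of_int a) - (s + t))"
      by (simp add: power2_eq_square algebra_simps)
    finally have "s + t \<le> B - of_int a" by (rule le_from_mult[rotated]) (use B in simp)
    then show ?thesis using pos_vecI[of b s k t n1 n2 a] s b hex_pos_sqrt[OF t] by (auto simp: B_def)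
  qed
qed

lemma root2_pos_or_neg:
  assumes k: "k \<in> latt K" and norm: "of_int (2 * a * b + 2 * hexn n1 n2) + bform K k k = 2"
  shows "pos_vec a b n1 n2 k \<or> pos_vec (- a) (- b) (- n1) (- n2) (\<lambda>i. - k i)"
proof -
  have k': "(\<lambda>i. - k i) \<in> latt K" "bform K (\<lambda>i. - k i) (\<lambda>i. - k i) = bform K k k"
    using latt_closed(3)[OF k k, of "-1"] bform_scale_left[of K "-1" k] bform_scale_right[of K _ "-1" k] by auto
  \<comment> \<open>With \<open>b = 0\<close> the two half norms add up to 1, and the integer
    \<open>- a\<close> is at least 1.\<close>
  have zero: "pos_vec a 0 n1 n2 k" if "a < 0" "k \<in> latt K" "of_int (2 * hexn n1 n2) + bform K k k = 2" for a n1 n2 k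
  proof (rule pos_vecI[where s = "bform K k k / 2" and t = "of_int (hexn n1 n2)"])
    show "bform K k k / 2 + of_int (hexn n1 n2) \<le> real_of_int 0 - of_int a" using that by simp
  qed (use psd[of k] shift_half_norm[OF that(2)] hex_pos_int in \<open>auto simp: bform_gdim_0\<close>)
  consider "b > 0" | "b < 0" | "b = 0" "a < 0" | "b = 0" "a > 0" | "b = 0" "a = 0" by linarith
  then show ?thesis
  proof cases
    case 1
    then show ?thesis using root2_pos_vec[OF k norm] by blast
  next
    case 2
    then show ?thesis using root2_pos_vec[OF k'(1), of "-a" "-b" "-n1" "-n2"] norm k'(2) by (simp add: hexn_uminus)
  next
    case 3
    then show ?thesis using zero[OF _ k] norm by simp
  next
    case 4
    then show ?thesis using zero[OF _ k'(1), of "-a" "-n1" "-n2"] norm k'(2) by (simp add: hexn_uminus)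
  next
    case 5
    obtain m :: int where m: "bform K k k = 2 * of_int m" using even[OF k] by blast
    have "m \<ge> 0" using psd[of k] m by simp
    have "real_of_int (hexn n1 n2 + m) = of_int 1" using norm m 5 by simp
    then have hm: "hexn n1 n2 + m = 1" by (simp only: of_int_eq_iff)
    then consider "hexn n1 n2 = 1" "m = 0" | "hexn n1 n2 = 0" "m = 1"
      using \<open>m \<ge> 0\<close> hexn_nonneg[of n1 n2] by linarith
    then show ?thesis
    proof cases
      case 1
      then have "k i = 0" if "i < gdim K" for i using coord_bound[OF that, of k] m by simp
      then show ?thesis using hex_pos_or_neg[of n1 n2] 1 5 by (auto simp: pos_vec_def intro!: exI[of _ 0])
    next
      case 2
      then have "n1 = 0" "n2 = 0" using hexn_zero by blast+
      moreover have "(\<forall>i. k i \<ge> 0) \<or> (\<forall>i. k i \<le> 0)" using root_sign[OF k] m 2 by simp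
      ultimately show ?thesis using 5 by (auto simp: pos_vec_def hex_pos_def intro!: exI[of _ 0])
    qed
  qed
qed

text \<open>The same completion of squares, now with remainder \<open>b^2/3 - 6\<close>, covers
  \<open>b \<ge> 6\<close>. As \<open>b\<close> is a multiple of 3, only \<open>b = 3\<close> is
  left.\<close>

lemma root6_pos_vec:
  assumes k: "(\<lambda>i. k i / 3) \<in> latt K" and norm: "of_int (2 * a * b + 2 * hexn n1 n2) + bform K k k = 6"
    and b: "b > 0" "3 dvd b"
  shows "pos_vec a b n1 n2 k"
proof -
  obtain t where t: "t \<ge> 0" "3 * t\<^sup>2 = 4 * real_of_int (hexn n1 n2)"
    using root_third_sqrt[OF hexn_nonneg] by blast
  have "b = 3 \<or> b \<ge> 6" using b by presburger
  then consider "b = 3" | "b \<ge> 6" by blast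
  then show ?thesis
  proof cases
    case 1
    have kk: "bform K k k = 9 * bform K (\<lambda>i. k i / 3) (\<lambda>i. k i / 3)"
      using bform_third[of k] by simp
    show ?thesis
    \<comment> \<open>The shift is three times the half norm of the lattice vector
      \<open>k / 3\<close>.\<close>
    proof (rule pos_vecI[where s = "bform K k k / 6" and t = t])
      show "k i + bform K k k / 6 * th i \<ge> 0" if "i < gdim K" for i
        using shift_half_norm[OF k that] by (simp add: kk)
      have "0 \<le> 3/2 * (t - 2)\<^sup>2 + 6" by simp
      also have "\<dots> = 3/2 * t\<^sup>2 - 6 * t + 12" by (simp add: power2_eq_square algebra_simps)
      also have "\<dots> = 6 * ((real_of_int b - of_int a) - (bform K k k / 6 + t))"
        using norm t(2) 1 by simp
      finally show "bform K k k / 6 + t \<le> real_of_int b - of_int a" by simp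
    qed (use b psd[of k] hex_pos_sqrt[OF t] in \<open>auto simp: bform_gdim_0\<close>)
  next
    case 2
    define s where "s = sqrt (bform K k k)"
    have s: "s \<ge> 0" "s\<^sup>2 = bform K k k" "gdim K = 0 \<Longrightarrow> s = 0" "\<And>i. i < gdim K \<Longrightarrow> k i + s * th i \<ge> 0"
      using psd shift_sqrt by (auto simp: s_def bform_gdim_0)
    define B where "B = real_of_int b"
    have eq: "2 * real_of_int a * B + 2 * of_int (hexn n1 n2) + s\<^sup>2 = 6" using norm s(2) by (simp add: B_def)
    have B: "B \<ge> 6" using 2 by (simp add: B_def)
    then have "B\<^sup>2 \<ge> 6\<^sup>2" by (intro power_mono) auto
    then have "0 \<le> (s - B)\<^sup>2 + 3/2 * (t - 2/3 * B)\<^sup>2 + (B\<^sup>2 / 3 - 6)" by simp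
    also have "\<dots> = s\<^sup>2 + 3/2 * t\<^sup>2 + 2 * B\<^sup>2 - 2 * (s * B) - 2 * (t * B) - 6"
      by (simp add: power2_eq_square algebra_simps)
    also have "\<dots> = 2 * B\<^sup>2 - 2 * of_int a * B - 2 * (s * B) - 2 * (t * B)"
      using eq t(2) by linarith
    also have "\<dots> = (2 * B) * ((B - of_int a) - (s + t))"
      by (simp add: power2_eq_square algebra_simps)
    finally have "s + t \<le> B - of_int a" by (rule le_from_mult[rotated]) (use B in simp)
    then show ?thesis using pos_vecI[of b s k t n1 n2 a] s b hex_pos_sqrt[OF t] by (auto simp: B_def)
  qed
qed

lemma root6_pos_or_neg:
  assumes k: "(\<lambda>i. k i / 3) \<in> latt K" and norm: "of_int (2 * a * b + 2 * hexn n1 n2) + bform K k k = 6"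
    and dvd: "3 dvd a" "3 dvd b"
  shows "pos_vec a b n1 n2 k \<or> pos_vec (- a) (- b) (- n1) (- n2) (\<lambda>i. - k i)"
proof -
  have k': "(\<lambda>i. - k i / 3) \<in> latt K" "bform K (\<lambda>i. - k i) (\<lambda>i. - k i) = bform K k k"
    using latt_closed(3)[OF k k, of "-1"] bform_scale_left[of K "-1" k] bform_scale_right[of K _ "-1" k] by auto
  consider "b > 0" | "b < 0" | "b = 0" by linarith
  then show ?thesis
  proof cases
    case 1
    then show ?thesis using root6_pos_vec[OF k norm] dvd by blast
  next
    case 2
    then show ?thesis using root6_pos_vec[OF k'(1), of "-a" "-b" "-n1" "-n2"] norm k'(2) dvd by (simp add: hexn_uminus)
  next
    case 3
    obtain m :: int where m: "bform K (\<lambda>i. k i / 3) (\<lambda>i. k i / 3) = 2 * of_int m" using even[OF k] by blast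
    then have kk: "bform K k k = 18 * of_int m"
      using bform_third[of k] m by simp
    have "m \<ge> 0" using psd[of k] kk by simp
    \<comment> \<open>Divisibility of \<open>k\<close> by 3 makes its norm a multiple of 18, so the
      \<open>K\<close> part must vanish and a long root of \<open>G2\<close> remains.\<close>
    have "real_of_int (hexn n1 n2 + 9 * m) = of_int 3" using norm kk 3 by simp
    then have "hexn n1 n2 + 9 * m = 3" by (simp only: of_int_eq_iff)
    then have "hexn n1 n2 = 3 \<and> m = 0" using \<open>m \<ge> 0\<close> hexn_nonneg[of n1 n2] by presburger
    then have h3: "hexn n1 n2 = 3" and "m = 0" by auto
    then have k0: "k i = 0" if "i < gdim K" for i using coord_bound[OF that, of k] kk by simp
    \<comment> \<open>For \<open>hexn\<close> equal to 3 the covering radius shift is 2, and a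
      nonzero multiple \<open>a\<close> of 3 exceeds it in absolute value.\<close>
    have hp: "hex_pos 2 n1 n2" "hex_pos 2 (- n1) (- n2)"
      by (rule hex_pos_sqrt; simp add: h3 hexn_uminus)+
    have "a \<le> -3 \<or> a \<ge> 3 \<or> a = 0" using dvd(1) by presburger
    then consider "a \<le> -3" | "a \<ge> 3" | "a = 0" by blast
    then show ?thesis
    proof cases
      case 1
      then have "hex_pos (- real_of_int a) n1 n2" using hex_pos_mono[OF hp(1)] by simp
      then show ?thesis using 3 k0 by (auto simp: pos_vec_def intro!: exI[of _ 0])
    next
      case 2
      then have "hex_pos (real_of_int a) (- n1) (- n2)" using hex_pos_mono[OF hp(2)] by simp
      then show ?thesis using 3 k0 by (auto simp: pos_vec_def intro!: exI[of _ 0])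
    next
      case 3
      then show ?thesis using hex_pos_or_neg[of n1 n2] h3 \<open>b = 0\<close> k0
        by (auto simp: pos_vec_def intro!: exI[of _ 0])
    qed
  qed
qed

text \<open>\<open>E 0\<close> and \<open>E 1\<close> are the long and short simple roots of
  \<open>G2\<close>. They are extended by \<open>E 2\<close>, formed with the highest short root,
  since 6-roots can be shifted along \<open>u\<close> only by multiples of 3. The simple roots of
  \<open>K\<close> are extended by the highest root in the usual way, and \<open>E 3\<close>, that
  is \<open>u + v\<close>, joins the two affine nodes.\<close>

definition E :: "nat \<Rightarrow> nat \<Rightarrow> real" where
  "E j = (if j = 0 then vec4 0 0 (-1) 1 (\<lambda>i. 0) else if j = 1 then vec4 0 0 1 0 (\<lambda>i. 0)
     else if j = 2 then vec4 (-1) 0 (-1) (-1) (\<lambda>i. 0) else if j = 3 then vec4 1 1 0 0 (\<lambda>i. 0)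
     else if j < 4 + gdim K then vec4 0 0 0 0 (uvec (j - 4)) else vec4 (-1) 0 0 0 (\<lambda>i. - th i))"

text \<open>If \<open>K\<close> is zero there is no second affine node, and the indices stop at
  3.\<close>

definition m :: nat where "m = 4 + (if gdim K = 0 then 0 else Suc (gdim K))"

lemma E_cases:
  assumes "j < m"
  obtains "j = 0" "E j = vec4 0 0 (-1) 1 (\<lambda>i. 0)" | "j = 1" "E j = vec4 0 0 1 0 (\<lambda>i. 0)"
    | "j = 2" "E j = vec4 (-1) 0 (-1) (-1) (\<lambda>i. 0)" | "j = 3" "E j = vec4 1 1 0 0 (\<lambda>i. 0)"
    | i where "i < gdim K" "j = 4 + i" "E j = vec4 0 0 0 0 (uvec i)"
    | "gdim K > 0" "j = 4 + gdim K" "E j = vec4 (-1) 0 0 0 (\<lambda>i. - th i)"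
proof -
  have "j = 0 \<or> j = 1 \<or> j = 2 \<or> j = 3 \<or> (j = 4 + (j - 4) \<and> j - 4 < gdim K) \<or> (gdim K > 0 \<and> j = 4 + gdim K)"
    using assms by (auto simp: m_def split: if_splits)
  then show ?thesis
    using that(1-4,6) that(5)[of "j - 4"] by (auto simp: E_def)
qed

lemma pos_vec_cone:
  assumes pos: "pos_vec a b n1 n2 k" and k: "k \<in> ambient K"
  shows "\<exists>n. (\<forall>j<m. n j \<ge> 0) \<and> vec4 (of_int a) (of_int b) (of_int n1) (of_int n2) k = (\<lambda>i. \<Sum>j<m. n j * E j i)"
proof -
  obtain s where s: "s \<ge> 0" "gdim K = 0 \<longrightarrow> s = 0" "\<forall>i<gdim K. k i + s * th i \<ge> 0"
    and hp: "hex_pos (of_int b - of_int a - s) n1 n2" and b: "b \<ge> 0"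
    using pos by (auto simp: pos_vec_def)
  define T where "T = of_int b - of_int a - s"
  \<comment> \<open>Comparing the \<open>A2\<close> part with \<open>hex_pos\<close> gives the
    coefficients of \<open>E 0\<close> and \<open>E 1\<close>; \<open>E 3\<close> carries all of
    \<open>v\<close>, and what remains of \<open>u\<close> is divided into \<open>T\<close> for
    \<open>E 2\<close> and \<open>s\<close> for the affine node of \<open>K\<close>, the last
    branch.\<close>
  define n where "n = (\<lambda>j. if j = 0 then of_int n2 + T else if j = 1 then of_int n1 + of_int n2 + 2 * T
     else if j = 2 then T else if j = 3 then of_int b else if j < 4 + gdim K then k (j - 4) + s * th (j - 4) else s)"
  have nn: "n j \<ge> 0" if "j < m" for j
    using that hp b s by (auto simp: n_def m_def T_def[symmetric] hex_pos_def split: if_splits)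
  define q where "q = (if gdim K = 0 then 0 else Suc (gdim K))"
  have tail: "(\<Sum>j<q. n (4 + j) * E (4 + j) i) = vec4 (- s) 0 0 0 k i" for i
  proof (cases "gdim K = 0")
    case True
    then have "k = (\<lambda>i. 0)" using k by (auto simp: ambient_def)
    then show ?thesis using True s(2) by (simp add: q_def vec4_zero)
  next
    case False
    have "(\<Sum>j<gdim K. n (4 + j) * E (4 + j) i) = (\<Sum>j<gdim K. (k j + s * th j) * vec4 0 0 0 0 (uvec j) i)"
      by (rule sum.cong) (auto simp: n_def E_def)
    also have "\<dots> = vec4 0 0 0 0 (\<lambda>i. k i + s * th i) i"
    proof (cases "i < 4")
      case True
      then show ?thesis by (auto simp: vec4_def)
    next
      case i: False
      show ?thesis
      proof (cases "i - 4 < gdim K")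
        case True
        then show ?thesis using i by (simp add: vec4_def uvec_def if_distrib cong: if_cong)
      next
        case False
        then have "k (i - 4) = 0" "th (i - 4) = 0"
          using k latt_ambient[OF th_latt] by (auto simp: ambient_def)
        moreover have "\<And>j. j < gdim K \<Longrightarrow> j \<noteq> i - 4" using False by auto
        ultimately show ?thesis using i by (auto simp: vec4_def uvec_def intro!: sum.neutral)
      qed
    qed
    finally have "(\<Sum>j<q. n (4 + j) * E (4 + j) i)
        = vec4 0 0 0 0 (\<lambda>i. k i + s * th i) i + s * vec4 (-1) 0 0 0 (\<lambda>i. - th i) i"
      using False by (simp add: q_def) (simp add: n_def E_def)
    then show ?thesis by (simp add: vec4_def)
  qed
  have "(\<Sum>j<m. n j * E j i) = vec4 (of_int a) (of_int b) (of_int n1) (of_int n2) k i" for i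
  proof -
    have "(\<Sum>j<m. n j * E j i) = (\<Sum>j<4. n j * E j i) + vec4 (- s) 0 0 0 k i"
      unfolding m_def q_def[symmetric] sum_lessThan_add tail ..
    also have "(\<Sum>j<4. n j * E j i) = n 0 * E 0 i + n 1 * E 1 i + n 2 * E 2 i + n 3 * E 3 i"
      by (simp add: eval_nat_numeral)
    also have "\<dots> = (of_int n2 + T) * vec4 0 0 (-1) 1 (\<lambda>i. 0) i + (of_int n1 + of_int n2 + 2 * T) * vec4 0 0 1 0 (\<lambda>i. 0) i
        + T * vec4 (-1) 0 (-1) (-1) (\<lambda>i. 0) i + of_int b * vec4 1 1 0 0 (\<lambda>i. 0) i"
      by (simp add: n_def E_def)
    finally show ?thesis by (auto simp: vec4_def T_def)
  qed
  then show ?thesis using nn by (intro exI[of _ n]) auto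
qed

lemma wroot_cone:
  assumes r: "wroot (UAK 1 K) r"
  shows "\<exists>n. (\<forall>k<m. n k \<ge> 0) \<and>
     (r = (\<lambda>i. \<Sum>k<m. n k * E k i) \<or> r = (\<lambda>i. - (\<Sum>k<m. n k * E k i)))"
proof -
  obtain a b n1 n2 :: int and k where rv: "r = vec4 (of_int a) (of_int b) (of_int n1) (of_int n2) k"
    and k: "k \<in> latt K" using UK.latt_cases[OF wroot_latt[OF r]] by blast
  have "pos_vec a b n1 n2 k \<or> pos_vec (- a) (- b) (- n1) (- n2) (\<lambda>i. - k i)"
  proof (cases "root2 (UAK 1 K) r")
    case True
    then show ?thesis using UK.norm_vec4[of a b n1 n2 k] by (intro root2_pos_or_neg[OF k]) (simp add: root2_def rv)
  next
    case False
    then have r6: "root6 (UAK 1 K) r" using r by (simp add: wroot_def)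
    show ?thesis
    proof (rule root6_pos_or_neg)
      show "(\<lambda>i. k i / 3) \<in> latt K"
        using third_latt[OF k] UK.root6_vec4(3)[OF r6[unfolded rv]] by blast
      show "of_int (2 * a * b + 2 * hexn n1 n2) + bform K k k = 6"
        using UK.norm_vec4[of a b n1 n2 k] r6 by (simp add: root6_def rv)
      show "3 dvd a" "3 dvd b" using UK.root6_vec4(1,2)[OF r6[unfolded rv]] by simp_all
    qed
  qed
  then show ?thesis
  proof
    assume "pos_vec a b n1 n2 k"
    then show ?thesis using pos_vec_cone[OF _ latt_ambient[OF k]] rv by blast
  next
    assume *: "pos_vec (- a) (- b) (- n1) (- n2) (\<lambda>i. - k i)"
    have "(\<lambda>i. - k i) \<in> ambient K" using latt_ambient[OF k] by (simp add: ambient_def)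
    from pos_vec_cone[OF * this] obtain n where n: "\<forall>j<m. n j \<ge> 0"
      "vec4 (- of_int a) (- of_int b) (- of_int n1) (- of_int n2) (\<lambda>i. - k i) = (\<lambda>i. \<Sum>j<m. n j * E j i)"
      by auto
    have "r = (\<lambda>i. - vec4 (- of_int a) (- of_int b) (- of_int n1) (- of_int n2) (\<lambda>i. - k i) i)"
      by (simp add: rv vec4_minus)
    then show ?thesis using n by auto
  qed
qed

text \<open>In the witnesses below, \<open>dom\<close> is positive on the simple roots of
  \<open>K\<close>. The \<open>A2\<close> part \<open>(2, 3)\<close> has products 3 and 1 with
  \<open>E 0\<close> and \<open>E 1\<close>, while \<open>(1, 1)\<close> has products 0 and 1. The
  second hyperbolic coordinate outweighs \<open>h\<close>, the product with the highest root; the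
  two hyperbolic coordinates have positive sum because of \<open>E 3\<close>. The summand
  \<open>P\<close> makes the norm of \<open>p\<close> negative.\<close>

theorem chiral: "chiral (UAK 1 K)"
proof -
  define h where "h = bform K dom th"
  define P where "P = bform K dom dom"
  have hP: "h \<ge> 0" "P \<ge> 0" "h \<in> \<int>" "P \<in> \<int>"
    using dom_th psd bform_latt_Ints[OF dom_latt th_latt] bform_latt_Ints[OF dom_latt dom_latt] by (auto simp: h_def P_def)
  have zl: "(\<lambda>i. 0) \<in> latt K" "(\<lambda>i. - th i) \<in> latt K"
    using latt_closed(3)[OF th_latt th_latt, of "-1"] by (auto simp: latt_def ambient_def)
  have z0: "bform K x (\<lambda>i. 0) = 0" "bform K (\<lambda>i. 0) x = 0" for x by (simp_all add: bform_def)
  have pth: "bform K dom (\<lambda>i. - th i) = - h" "bform K (\<lambda>i. - th i) (\<lambda>i. - th i) = bform K th th"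
    using bform_scale_right[of K _ "-1" th] bform_scale_left[of K "-1" th] by (auto simp: h_def)
  interpret L: lorentz_gram "UAK 1 K" "vec4 1 (-1) 0 0 (\<lambda>i. 0)" by (rule UK.lorentz)
  interpret simple_roots "UAK 1 K" "vec4 1 (-1) 0 0 (\<lambda>i. 0)" E m
    "vec4 (h + 7 + P) (- (h + 6)) 2 3 dom" "vec4 (h + 4) (- (h + 3)) 1 1 dom"
  proof (unfold_locales, goal_cases)
    case 1
    show ?case by (simp add: m_def)
  next
    case 2
    have "bform (UAK 1 K) (E 0) w / 3 \<in> \<int>" if w: "w \<in> latt (UAK 1 K)" for w
    proof -
      obtain a b n1 n2 :: int and k where "w = vec4 (of_int a) (of_int b) (of_int n1) (of_int n2) k"
        by (rule UK.latt_cases[OF w])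
      then have "bform (UAK 1 K) (E 0) w / 3 = of_int (n2 - n1)" by (simp add: E_def z0)
      then show ?thesis by (metis Ints_of_int)
    qed
    then show ?case by (simp add: root6_def) (simp add: E_def z0 zl)
  next
    case (3 k)
    from 3(2) show ?case
      by (cases rule: E_cases) (use 3(1) zl in \<open>simp_all add: root2_def z0 pth norm2 uvec_latt th_norm\<close>)
  next
    case 4
    show ?case by (rule exI[of _ 3]) (simp add: E_def)
  next
    case 5
    show ?case using hP dom_latt by auto
  next
    case 6
    define Z where "Z = (h + 7 + P) * (h + 6)"
    have "(7 + P) * 6 \<le> Z" unfolding Z_def using hP by (intro mult_mono) auto
    have "bform (UAK 1 K) (vec4 (h + 7 + P) (- (h + 6)) 2 3 dom) (vec4 (h + 7 + P) (- (h + 6)) 2 3 dom)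
        = - 2 * Z + 14 + P"
      unfolding UK.bform_vec4 by (simp add: P_def Z_def algebra_simps)
    moreover have "- 2 * Z + 14 + P < 0" using \<open>(7 + P) * 6 \<le> Z\<close> hP(2) by (simp add: algebra_simps)
    ultimately show ?case by (simp only:)
  next
    case (7 k)
    then show ?case
      by (cases rule: E_cases) (use hP in \<open>simp_all add: z0 pth dom_uvec\<close>)
  next
    case 8
    show ?case using latt_ambient[OF dom_latt] by simp
  next
    case 9
    show ?case by (simp add: E_def z0)
  next
    case (10 k)
    from 10(2) show ?case
      by (cases rule: E_cases) (use hP 10(1) in \<open>simp_all add: z0 pth dom_uvec\<close>)
  next
    case (11 r)
    then show ?case by (rule wroot_cone)
  qed
  show ?thesis by (rule chiral)
qed

end

section \<open>The four chiral lattices\<close>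

definition lvec :: "int list \<Rightarrow> nat \<Rightarrow> real" where
  "lvec l i = (if i < length l then of_int (l ! i) else 0)"

definition highest_root_certificate :: "gram \<Rightarrow> int list \<Rightarrow> int list list \<Rightarrow> bool" where
  "highest_root_certificate K th Y \<longleftrightarrow> (let n = length K in
     has_shape n n K \<and> cols n K = K \<and> has_shape n n Y \<and> mul_tr Y K = scalar_mat n 2 \<and> length th = n \<and>
     (\<forall>i\<in>set [0..<n]. K ! i ! i = 2 \<and> th ! i \<ge> 1 \<and> Y ! i ! i \<le> 2 * (th ! i * th ! i) \<and>
        dot th (K ! i) \<ge> 0 \<and> (\<forall>j\<in>set [0..<n]. i \<noteq> j \<longrightarrow> K ! i ! j \<le> 0)) \<and>
     (n \<noteq> 0 \<longrightarrow> dot th (map (dot th) K) = 2))"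

lemma highest_root_gramI:
  assumes cert: "highest_root_certificate K th Y"
    and even: "\<And>x. x \<in> latt K \<Longrightarrow> \<exists>m::int. bform K x x = 2 * of_int m"
    and psd: "\<And>x. bform K x x \<ge> 0"
  shows "highest_root_gram K (lvec th) (\<lambda>i. lvec (Y ! i))"
proof -
  define n where "n = length K"
  have shapes: "has_shape n n K" "has_shape n n Y" "length th = n"
    and KK: "cols n K = K" and YK: "mul_tr Y K = scalar_mat n 2"
    and diag: "\<And>i. i < n \<Longrightarrow> K ! i ! i = 2" "\<And>i. i < n \<Longrightarrow> th ! i \<ge> 1"
      "\<And>i. i < n \<Longrightarrow> Y ! i ! i \<le> 2 * (th ! i * th ! i)" "\<And>i. i < n \<Longrightarrow> dot th (K ! i) \<ge> 0"
    and off: "\<And>i j. i < n \<Longrightarrow> j < n \<Longrightarrow> i \<noteq> j \<Longrightarrow> K ! i ! j \<le> 0"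
    and th2: "n \<noteq> 0 \<Longrightarrow> dot th (map (dot th) K) = 2"
    using cert by (simp_all add: highest_root_certificate_def Let_def n_def)
  have sym: "K ! i ! j = K ! j ! i" if "i < n" "j < n" for i j
    using nth_cols[OF shapes(1) that(2,1)] KK by simp
  have gd: "gdim K = n" "gent K i j = K ! i ! j" for i j by (simp_all add: gdim_def n_def gent_def)
  have len: "length (K ! i) = n" "length (Y ! i) = n" if "i < n" for i
    using has_shape_length(2)[OF shapes(1) that] has_shape_length(2)[OF shapes(2) that] .
  have dth: "bform K (lvec th) (uvec i) = of_int (dot th (K ! i))" if "i < n" for i
  proof -
    have "bform K (lvec th) (uvec i) = (\<Sum>j<n. of_int (th ! j) * of_int (K ! j ! i))"
      using that by (simp add: bform_uvec_right gd lvec_def shapes)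
    also have "\<dots> = of_int (dot th (K ! i))"
      using that by (simp add: dot_eq_sum[where n = n] shapes len sym)
    finally show ?thesis .
  qed
  show ?thesis
  proof (unfold_locales, goal_cases)
    case (1 i j)
    then show ?case using sym by (simp add: gd)
  next
    case (2 r)
    then show ?case using shapes(1) by (auto simp: has_shape_def list_all_iff gd)
  next
    case (3 i j)
    then show ?case using off by (simp add: gd)
  next
    case (4 x)
    then show ?case by (rule even)
  next
    case (5 i)
    then show ?case using gent_eq_bform[of i K i] diag(1) by (simp add: gd)
  next
    case (6 x)
    show ?case by (rule psd)
  next
    case (7 i)
    then show ?case using len by (auto simp: latt_def ambient_def lvec_def gd)
  next
    case (8 i x)
    then have i: "i < n" by (simp add: gd)
    have "bform K (lvec (Y ! i)) (uvec j) = (if j = i then 2 else 0)" if j: "j < n" for j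
    proof -
      have "bform K (lvec (Y ! i)) (uvec j) = (\<Sum>l<n. of_int (Y ! i ! l) * of_int (K ! l ! j))"
        using i j by (simp add: bform_uvec_right gd lvec_def len)
      also have "\<dots> = of_int (mul_tr Y K ! i ! j)"
        using i j by (simp add: nth_mul_tr[OF shapes(2,1)] sym)
      finally show ?thesis using i j by (simp add: YK nth_scalar_mat)
    qed
    then have "bform K (lvec (Y ! i)) x = (\<Sum>j<n. x j * (if j = i then 2 else 0))"
      by (subst bform_expand_right) (simp add: gd)
    then show ?case using i by (simp add: if_distrib cong: if_cong)
  next
    case (9 i)
    then have i: "i < n" by (simp add: gd)
    have "real_of_int (Y ! i ! i) \<le> of_int (2 * (th ! i * th ! i))" using diag(3)[OF i] by (simp only: of_int_le_iff)
    then show ?case using i by (simp add: lvec_def len shapes power2_eq_square)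
  next
    case 10
    show ?case using shapes by (auto simp: latt_def ambient_def lvec_def gd)
  next
    case (11 i)
    then show ?case using diag(2)[of i] by (simp add: lvec_def gd shapes)
  next
    case (12 i)
    then show ?case using dth diag(4) by (simp add: gd)
  next
    case 13
    have "bform K (lvec th) (lvec th) = (\<Sum>i<n. of_int (th ! i) * of_int (dot th (K ! i)))"
      by (subst bform_expand_right) (simp add: gd dth lvec_def shapes)
    also have "\<dots> = of_int (dot th (map (dot th) K))"
      by (subst dot_eq_sum[where n = n]) (simp_all add: shapes n_def)
    finally show ?case using th2 13 by (simp add: gd)
  qed
qed

lemma UAK_1: "UAK 1 K = U_lat \<oplus>\<^sub>L A2_lat \<oplus>\<^sub>L K"
  by (simp add: UAK_def gscale_def)

lemma osum_Nil: "G \<oplus>\<^sub>L [] = G"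
  by (simp add: osum_def)

lemma gdim_Nil: "gdim [] = 0"
  by (simp add: gdim_def)

lemma bform_Nil: "bform [] x y = 0"
  by (simp add: bform_def gdim_Nil)

lemma chiral_U_A2: "chiral (U_lat \<oplus>\<^sub>L A2_lat)"
proof -
  have "highest_root_gram [] (lvec []) (\<lambda>i. lvec ([] ! i))"
  proof (rule highest_root_gramI)
    show "highest_root_certificate [] [] []" by code_simp
  qed (auto simp: bform_Nil intro!: exI[of _ 0])
  from highest_root_gram.chiral[OF this] show ?thesis by (simp add: UAK_1 osum_Nil)
qed

lemma bform_D4: "bform D4_lat x x
    = 2 * (x 0 * x 0 + x 1 * x 1 + x 2 * x 2 + x 3 * x 3 - x 0 * x 1 - x 1 * x 2 - x 1 * x 3)"
  by (simp add: bform_def gdim_def gent_def D4_lat_def eval_nat_numeral algebra_simps)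

lemma bform_E8: "bform E8_lat x x
    = 2 * (x 0 * x 0 + x 1 * x 1 + x 2 * x 2 + x 3 * x 3 + x 4 * x 4 + x 5 * x 5 + x 6 * x 6 + x 7 * x 7
      - x 0 * x 2 - x 1 * x 3 - x 2 * x 3 - x 3 * x 4 - x 4 * x 5 - x 5 * x 6 - x 6 * x 7)"
  by (simp add: bform_def gdim_def gent_def E8_lat_def eval_nat_numeral algebra_simps)

lemma chiral_U_A2_D4: "chiral (U_lat \<oplus>\<^sub>L A2_lat \<oplus>\<^sub>L D4_lat)"
proof -
  let ?Y = "[[2, 2, 1, 1], [2, 4, 2, 2], [1, 2, 2, 1], [1, 2, 1, 2]]"
  have "highest_root_gram D4_lat (lvec [1, 2, 1, 1]) (\<lambda>i. lvec (?Y ! i))"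
  proof (rule highest_root_gramI)
    show "highest_root_certificate D4_lat [1, 2, 1, 1] ?Y" by code_simp
  next
    fix x assume "x \<in> latt D4_lat"
    then have "x i \<in> \<int>" if "i < 4" for i using that by (auto simp: latt_def gdim_def D4_lat_def)
    then have "x 0 * x 0 + x 1 * x 1 + x 2 * x 2 + x 3 * x 3 - x 0 * x 1 - x 1 * x 2 - x 1 * x 3 \<in> \<int>" (is "?q \<in> \<int>")
      by (intro Ints_add Ints_diff Ints_mult) simp_all
    then obtain m :: int where "?q = of_int m" by (rule Ints_cases)
    then show "\<exists>m::int. bform D4_lat x x = 2 * of_int m"
      unfolding bform_D4 by (intro exI[of _ m]) (simp only:)
  next
    fix x
    have "bform D4_lat x x = 2 * (x 0 - 1/2 * x 1)\<^sup>2 + 3/2 * (x 1 - 2/3 * x 2 - 2/3 * x 3)\<^sup>2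
        + 4/3 * (x 2 - 1/2 * x 3)\<^sup>2 + (x 3)\<^sup>2"
      by (simp add: bform_D4 power2_eq_square field_simps)
    then show "bform D4_lat x x \<ge> 0" by simp
  qed
  from highest_root_gram.chiral[OF this] show ?thesis by (simp add: UAK_1)
qed

lemma chiral_U_A2_E8: "chiral (U_lat \<oplus>\<^sub>L A2_lat \<oplus>\<^sub>L E8_lat)"
proof -
  let ?Y = "[[8, 10, 14, 20, 16, 12, 8, 4], [10, 16, 20, 30, 24, 18, 12, 6], [14, 20, 28, 40, 32, 24, 16, 8],
    [20, 30, 40, 60, 48, 36, 24, 12], [16, 24, 32, 48, 40, 30, 20, 10], [12, 18, 24, 36, 30, 24, 16, 8],
    [8, 12, 16, 24, 20, 16, 12, 6], [4, 6, 8, 12, 10, 8, 6, 4]]"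
  have "highest_root_gram E8_lat (lvec [2, 3, 4, 6, 5, 4, 3, 2]) (\<lambda>i. lvec (?Y ! i))"
  proof (rule highest_root_gramI)
    show "highest_root_certificate E8_lat [2, 3, 4, 6, 5, 4, 3, 2] ?Y" by code_simp
  next
    fix x assume "x \<in> latt E8_lat"
    then have "x i \<in> \<int>" if "i < 8" for i using that by (auto simp: latt_def gdim_def E8_lat_def)
    then have "x 0 * x 0 + x 1 * x 1 + x 2 * x 2 + x 3 * x 3 + x 4 * x 4 + x 5 * x 5 + x 6 * x 6 + x 7 * x 7
      - x 0 * x 2 - x 1 * x 3 - x 2 * x 3 - x 3 * x 4 - x 4 * x 5 - x 5 * x 6 - x 6 * x 7 \<in> \<int>" (is "?q \<in> \<int>")
      by (intro Ints_add Ints_diff Ints_mult) simp_all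
    then obtain m :: int where "?q = of_int m" by (rule Ints_cases)
    then show "\<exists>m::int. bform E8_lat x x = 2 * of_int m"
      unfolding bform_E8 by (intro exI[of _ m]) (simp only:)
  next
    fix x
    have "bform E8_lat x x = 2 * (x 0 - 1/2 * x 2)\<^sup>2 + 2 * (x 1 - 1/2 * x 3)\<^sup>2 + 3/2 * (x 2 - 2/3 * x 3)\<^sup>2
        + 5/6 * (x 3 - 6/5 * x 4)\<^sup>2 + 4/5 * (x 4 - 5/4 * x 5)\<^sup>2 + 3/4 * (x 5 - 4/3 * x 6)\<^sup>2
        + 2/3 * (x 6 - 3/2 * x 7)\<^sup>2 + 1/2 * (x 7)\<^sup>2"
      by (simp add: bform_E8 power2_eq_square field_simps)
    then show "bform E8_lat x x \<ge> 0" by simp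
  qed
  from highest_root_gram.chiral[OF this] show ?thesis by (simp add: UAK_1)
qed

text \<open>Over \<open>U(2)\<close> the vector \<open>u + v\<close> has norm 4 and is no root.
  Instead each of the isotropic vectors \<open>-u\<close> and \<open>v\<close> yields a root after
  subtraction of the highest short root of \<open>G2\<close>; the two roots are orthogonal, and both
  are attached to \<open>E_U2 1\<close>.\<close>

definition E_U2 :: "nat \<Rightarrow> nat \<Rightarrow> real" where
  "E_U2 j = (if j = 0 then vec4 0 0 (-1) 1 (\<lambda>i. 0) else if j = 1 then vec4 0 0 1 0 (\<lambda>i. 0)
     else if j = 2 then vec4 (-1) 0 (-1) (-1) (\<lambda>i. 0) else vec4 0 1 (-1) (-1) (\<lambda>i. 0))"

text \<open>\<open>N\<close> is half the norm of the root. The coefficients of the last two simple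
  roots will be \<open>- a\<close> and \<open>b\<close>, which add up to the shift in
  \<open>hex_pos\<close>. Here \<open>4 b (b - a - t)\<close> equals
  \<open>3/2 (t - 4/3 b)^2 + 4/3 b^2 - 2 N\<close>, which settles every \<open>b > 0\<close> except
  \<open>b = 1\<close> with \<open>N = 1\<close>.\<close>

lemma U2_root_pos:
  fixes a b n1 n2 N :: int
  assumes norm: "2 * a * b + hexn n1 n2 = N" and N: "N = 1 \<or> (N = 3 \<and> 3 dvd a \<and> 3 dvd b)"
    and b: "b > 0 \<or> b = 0 \<and> a < 0"
  shows "a \<le> 0 \<and> hex_pos (of_int (b - a)) n1 n2"
proof -
  have sq: "hex_pos T n1 n2" if "t \<ge> 0" "3 * t\<^sup>2 = 4 * real_of_int (hexn n1 n2)" "t \<le> T" for t T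
    using hex_pos_mono[OF hex_pos_sqrt[OF that(1,2)] that(3)] .
  obtain t where t: "t \<ge> 0" "3 * t\<^sup>2 = 4 * real_of_int (hexn n1 n2)"
    using root_third_sqrt[OF hexn_nonneg] by blast
  show ?thesis
  proof (cases "b = 0")
    case True
    then have a: "a < 0" and h: "hexn n1 n2 = N" using b norm by auto
    have "hex_pos (of_int (b - a)) n1 n2"
    proof (cases "N = 1")
      case True
      have "real_of_int (hexn n1 n2) \<le> of_int (b - a)" using a h True \<open>b = 0\<close> by simp
      then show ?thesis using hex_pos_mono[OF hex_pos_int] by blast
    next
      case False
      then have "N = 3" "3 dvd a" using N by auto
      then have "a \<le> -3" using a by presburger
      then show ?thesis using sq[of 2 "of_int (b - a)"] h \<open>N = 3\<close> \<open>b = 0\<close> by simp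
    qed
    then show ?thesis using a by simp
  next
    case False
    then have b1: "b \<ge> 1" using b by auto
    have a0: "a \<le> 0"
    \<comment> \<open>Two positive hyperbolic coordinates would already push \<open>2 a b\<close>
      above \<open>N\<close>.\<close>
    proof (rule ccontr)
      assume "\<not> a \<le> 0"
      then have a1: "a \<ge> 1" by simp
      show False
      proof (cases "N = 1")
        case True
        have "1 \<le> a * b" using mult_mono[of 1 a 1 b] a1 b1 by simp
        then show False using norm True hexn_nonneg[of n1 n2] by simp
      next
        case False
        then have "N = 3" "a \<ge> 3" "b \<ge> 3" using N a1 b1 by presburger+
        moreover have "3 * 3 \<le> a * b" using \<open>a \<ge> 3\<close> \<open>b \<ge> 3\<close> by (intro mult_mono) auto
        ultimately show False using norm hexn_nonneg[of n1 n2] by simp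
      qed
    qed
    define B where "B = real_of_int b"
    have eq: "2 * (real_of_int a * B) + of_int (hexn n1 n2) = of_int N"
      using arg_cong[OF norm, of real_of_int] by (simp add: B_def)
    have "hex_pos (of_int (b - a)) n1 n2"
    \<comment> \<open>In the exceptional case \<open>hexn\<close> is the odd number
      \<open>1 - 2 a\<close>: either 1, where the integral estimate is sharp, or at least 3, which
      gives \<open>t \<ge> 2\<close>.\<close>
    proof (cases "N = 1 \<and> b = 1")
      case True
      then have h: "hexn n1 n2 = 1 - 2 * a" using norm by simp
      show ?thesis
      proof (cases "a = 0")
        case True
        then show ?thesis using h hex_pos_int[of n1 n2] \<open>N = 1 \<and> b = 1\<close> by simp
      next
        case False
        then have "hexn n1 n2 \<ge> 3" using h a0 by simp
        then have "t\<^sup>2 \<ge> 2\<^sup>2" using t(2) by simp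
        then have "t \<ge> 2" using t(1) by (rule power2_le_imp_le)
        then have "0 \<le> (t - 2) * (3/2 * t - 1)" by simp
        also have "\<dots> = 3/2 * t\<^sup>2 - 4 * t + 2" by (simp add: power2_eq_square field_simps)
        finally have "0 \<le> 3/2 * t\<^sup>2 - 4 * t + 2" .
        moreover have "3 * t\<^sup>2 = 4 - 8 * real_of_int a" "real_of_int (b - a) = 1 - of_int a"
          using t(2) h True by simp_all
        ultimately have "t \<le> of_int (b - a)" by linarith
        then show ?thesis using sq[OF t] by blast
      qed
    next
      case False
      have "b\<^sup>2 * 2 \<ge> 3 * N"
      proof (cases "N = 1")
        case True
        then have "b \<ge> 2" using False b1 by simp
        then have "2\<^sup>2 \<le> b\<^sup>2" by (intro power_mono) auto
        then show ?thesis using True by simp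
      next
        case False
        then have "N = 3" "b \<ge> 3" using N b1 by presburger+
        then have "3\<^sup>2 \<le> b\<^sup>2" by (intro power_mono) auto
        then show ?thesis using \<open>N = 3\<close> by simp
      qed
      then have "real_of_int (b\<^sup>2 * 2) \<ge> of_int (3 * N)" by (simp only: of_int_le_iff)
      then have BN: "2 * B\<^sup>2 \<ge> 3 * of_int N" by (simp add: B_def)
      then have "0 \<le> 3/2 * (t - 4/3 * B)\<^sup>2 + (4/3 * B\<^sup>2 - 2 * of_int N)" by simp
      also have "\<dots> = 3/2 * t\<^sup>2 - 4 * (t * B) + 4 * B\<^sup>2 - 2 * of_int N"
        by (simp add: power2_eq_square field_simps)
      also have "\<dots> = 4 * B\<^sup>2 - 4 * (real_of_int a * B) - 4 * (t * B)" using eq t(2) by linarith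
      also have "\<dots> = (4 * B) * (of_int (b - a) - t)" by (simp add: B_def power2_eq_square algebra_simps)
      finally have "t \<le> of_int (b - a)" by (rule le_from_mult[rotated]) (use b1 in \<open>simp add: B_def\<close>)
      then show ?thesis using sq[OF t] by blast
    qed
    then show ?thesis using a0 by simp
  qed
qed

lemma chiral_U2_A2: "chiral (gscale 2 U_lat \<oplus>\<^sub>L A2_lat)"
proof -
  interpret U2: UAK_gram "[]" 2
    by unfold_locales (auto simp: gdim_Nil ambient_def)
  have amb: "k = (\<lambda>i. 0)" if "k \<in> ambient []" for k
    using that by (auto simp: ambient_def gdim_Nil)
  have zl: "(\<lambda>i. 0) \<in> latt []" "(\<lambda>i. 0) \<in> ambient []" by (simp_all add: latt_def ambient_def)
  have cone: "\<exists>n. (\<forall>k<4. n k \<ge> 0) \<and> vec4 (of_int a) (of_int b) (of_int n1) (of_int n2) (\<lambda>i. 0) = (\<lambda>i. \<Sum>k<4. n k * E_U2 k i)"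
    if "b \<ge> 0" "a \<le> 0" "hex_pos (of_int (b - a)) n1 n2" for a b n1 n2 :: int
  proof -
    define T where "T = real_of_int (b - a)"
    define n where "n = (\<lambda>k::nat. if k = 0 then of_int n2 + T else if k = 1 then of_int n1 + of_int n2 + 2 * T
       else if k = 2 then - real_of_int a else of_int b)"
    have "vec4 (of_int a) (of_int b) (of_int n1) (of_int n2) (\<lambda>i. 0) i = (\<Sum>k<4. n k * E_U2 k i)" for i
    proof -
      have "(\<Sum>k<4. n k * E_U2 k i) = n 0 * E_U2 0 i + n 1 * E_U2 1 i + n 2 * E_U2 2 i + n 3 * E_U2 3 i"
        by (simp add: eval_nat_numeral)
      also have "\<dots> = (of_int n2 + T) * vec4 0 0 (-1) 1 (\<lambda>i. 0) i + (of_int n1 + of_int n2 + 2 * T) * vec4 0 0 1 0 (\<lambda>i. 0) i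
          - of_int a * vec4 (-1) 0 (-1) (-1) (\<lambda>i. 0) i + of_int b * vec4 0 1 (-1) (-1) (\<lambda>i. 0) i"
        by (simp add: n_def E_U2_def)
      finally show ?thesis by (auto simp: vec4_def T_def)
    qed
    moreover have "\<forall>k<4. n k \<ge> 0" using that by (auto simp: n_def hex_pos_def T_def)
    ultimately show ?thesis by blast
  qed
  have pos_or_neg: "(b \<ge> 0 \<and> a \<le> 0 \<and> hex_pos (of_int (b - a)) n1 n2)
      \<or> (b \<le> 0 \<and> a \<ge> 0 \<and> hex_pos (of_int (a - b)) (- n1) (- n2))"
    if norm: "2 * a * b + hexn n1 n2 = N" and N: "N = 1 \<or> (N = 3 \<and> 3 dvd a \<and> 3 dvd b)" for a b n1 n2 N :: int
  proof -
    consider "b > 0 \<or> b = 0 \<and> a < 0" | "- b > 0 \<or> - b = 0 \<and> - a < 0" | "a = 0" "b = 0" by linarith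
    then show ?thesis
    proof cases
      case 1
      then show ?thesis using U2_root_pos[OF norm N] by auto
    next
      case 2
      have "2 * (- a) * (- b) + hexn (- n1) (- n2) = N" using norm by (simp add: hexn_uminus)
      from U2_root_pos[OF this _ 2] N show ?thesis using 2 by auto
    next
      case 3
      then show ?thesis using hex_pos_or_neg[of n1 n2] norm N by auto
    qed
  qed
  have wroot: "\<exists>n. (\<forall>k<4. n k \<ge> 0) \<and> (r = (\<lambda>i. \<Sum>k<4. n k * E_U2 k i) \<or> r = (\<lambda>i. - (\<Sum>k<4. n k * E_U2 k i)))"
    if r: "wroot (UAK 2 []) r" for r
  proof -
    obtain a b n1 n2 :: int and k where rv: "r = vec4 (of_int a) (of_int b) (of_int n1) (of_int n2) k" and "k \<in> latt []"
      by (rule U2.latt_cases[OF wroot_latt[OF r]])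
    then have k: "k = (\<lambda>i. 0)" using amb latt_ambient by blast
    have norm: "bform (UAK 2 []) r r = of_int (2 * (2 * a * b + hexn n1 n2))"
      using U2.norm_vec4[of a b n1 n2 k] by (simp add: rv bform_Nil)
    have "\<exists>N. 2 * a * b + hexn n1 n2 = N \<and> (N = 1 \<or> (N = 3 \<and> 3 dvd a \<and> 3 dvd b))"
    proof (cases "root2 (UAK 2 []) r")
      case True
      then have "of_int (2 * (2 * a * b + hexn n1 n2)) = real_of_int 2" using norm by (simp add: root2_def)
      then have "2 * (2 * a * b + hexn n1 n2) = 2" by (simp only: of_int_eq_iff)
      then show ?thesis by simp
    next
      case False
      then have r6: "root6 (UAK 2 []) r" using r by (simp add: wroot_def)
      then have "of_int (2 * (2 * a * b + hexn n1 n2)) = real_of_int 6" using norm by (simp add: root6_def)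
      then have "2 * (2 * a * b + hexn n1 n2) = 6" by (simp only: of_int_eq_iff)
      moreover have "3 dvd 2 * a" "3 dvd 2 * b" using U2.root6_vec4(1,2)[OF r6[unfolded rv]] by simp_all
      then have "3 dvd a" "3 dvd b" by presburger+
      ultimately show ?thesis by simp
    qed
    then obtain N where N: "2 * a * b + hexn n1 n2 = N" "N = 1 \<or> (N = 3 \<and> 3 dvd a \<and> 3 dvd b)" by blast
    from pos_or_neg[OF N] show ?thesis
    proof
      assume "b \<ge> 0 \<and> a \<le> 0 \<and> hex_pos (of_int (b - a)) n1 n2"
      then show ?thesis using cone[of b a n1 n2] rv k by blast
    next
      assume "b \<le> 0 \<and> a \<ge> 0 \<and> hex_pos (of_int (a - b)) (- n1) (- n2)"
      then obtain n where n: "\<forall>k<4. n k \<ge> 0"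
        "vec4 (- of_int a) (- of_int b) (- of_int n1) (- of_int n2) (\<lambda>i. 0) = (\<lambda>i. \<Sum>k<4. n k * E_U2 k i)"
        using cone[of "- b" "- a" "- n1" "- n2"] by auto
      have "r = (\<lambda>i. - vec4 (- of_int a) (- of_int b) (- of_int n1) (- of_int n2) (\<lambda>i. 0) i)"
        by (simp add: rv k vec4_minus)
      then show ?thesis using n by auto
    qed
  qed
  have E: "k = 0 \<or> k = 1 \<or> k = 2 \<or> k = 3" if "k < 4" for k :: nat using that by linarith
  interpret L: lorentz_gram "UAK 2 []" "vec4 1 (-1) 0 0 (\<lambda>i. 0)" by (rule U2.lorentz)
  \<comment> \<open>The \<open>A2\<close> parts of the two witnesses are those used over
    \<open>U\<close>; opposite hyperbolic coordinates treat the last two simple roots alike and are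
    large enough to outweigh their \<open>A2\<close> parts.\<close>
  interpret simple_roots "UAK 2 []" "vec4 1 (-1) 0 0 (\<lambda>i. 0)" E_U2 4
    "vec4 3 (-3) 2 3 (\<lambda>i. 0)" "vec4 2 (-2) 1 1 (\<lambda>i. 0)"
  proof (unfold_locales, goal_cases)
    case 2
    have "bform (UAK 2 []) (E_U2 0) w / 3 \<in> \<int>" if w: "w \<in> latt (UAK 2 [])" for w
    proof -
      obtain a b n1 n2 :: int and k where "w = vec4 (of_int a) (of_int b) (of_int n1) (of_int n2) k"
        by (rule U2.latt_cases[OF w])
      then have "bform (UAK 2 []) (E_U2 0) w / 3 = of_int (n2 - n1)" by (simp add: E_U2_def bform_Nil)
      then show ?thesis by (metis Ints_of_int)
    qed
    then show ?case by (simp add: root6_def) (simp add: E_U2_def bform_Nil zl)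
  next
    case (3 k)
    then show ?case using E[of k] by (auto simp: E_U2_def root2_def bform_Nil zl)
  next
    case 4
    show ?case by (rule exI[of _ 3]) (simp add: E_U2_def)
  next
    case (7 k)
    then show ?case using E[of k] by (auto simp: E_U2_def bform_Nil)
  next
    case (10 k)
    then show ?case using E[of k] by (auto simp: E_U2_def bform_Nil)
  next
    case (11 r)
    then show ?case by (rule wroot)
  qed (simp_all add: zl bform_Nil E_U2_def)
  show ?thesis using chiral by (simp add: UAK_def osum_Nil)
qed

theorem theorem3p1:
  shows "{G \<in> set sixteen_lattices. chiral G} =
           {U_lat \<oplus>\<^sub>L A2_lat,
            gscale 2 U_lat \<oplus>\<^sub>L A2_lat,
            U_lat \<oplus>\<^sub>L A2_lat \<oplus>\<^sub>L D4_lat,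
            U_lat \<oplus>\<^sub>L A2_lat \<oplus>\<^sub>L E8_lat}"
proof -
  note achiral = achiral_U2_A2_D4 achiral_U_E6t achiral_U2_E6t achiral_U2_A2_E8 achiral_U_A2_D4_D4
    achiral_U2_A2_D4_D4 achiral_U_A2_E8t achiral_U2_A2_E8t achiral_U_A2_D4_E8 achiral_U2_A2_D4_E8
    achiral_U_A2_E8_E8 achiral_U2_A2_E8_E8
  note chiral = chiral_U_A2 chiral_U2_A2 chiral_U_A2_D4 chiral_U_A2_E8
  show ?thesis
    unfolding sixteen_lattices_def
    using achiral chiral by (auto simp: chiral_def)
qed

end
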